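(* Let $n\ge1$ be an integer, let $\sigma\ge1$ be a real number, and let $p,q>1$ satisfy $$\frac{n}{2\sigma}\le\frac{1+\max\{p,q\}}{pq-1}.$$ Then there exist suitable nonnegative constants $\epsilon_1,\epsilon_2$ such that the following holds: if $u_0=v_0=0$ and $u_1,v_1\in L^1(\mathbb{R}^n)$ satisfy $$\int_{\mathbb{R}^n}u_1(x)\,dx>\epsilon_1\quad\text{and}\quad\int_{\mathbb{R}^n}v_1(x)\,dx>\epsilon_2,$$ then there is no global (in time) Sobolev solution $(u,v)\in C\big([0,\infty),L^2\big)\times C\big([0,\infty),L^2\big)$ to the Cauchy problem $$\begin{cases}u_{tt}+(-\Delta)^{\sigma}u+u_t=|v|^p,& x\in\mathbb{R}^n,\ t\ge0,\\ v_{tt}+(-\Delta)^{\sigma}v+v_t=|u|^q,& x\in\mathbb{R}^n,\ t\ge0,\\ u(0,x)=u_0(x),\ u_t(0,x)=u_1(x),& x\in\mathbb{R}^n,\\ v(0,x)=v_0(x),\ v_t(0,x)=v_1(x),& x\in\mathbb{R}^n.\end{cases}$$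
   Context: $(-\Delta)^\sigma$ is the Fourier multiplier with symbol $|\xi|^{2\sigma}$, and $H^{2\sigma}$ is the $L^2$-based Sobolev space on $\mathbb{R}^n$. A global Sobolev solution (with $u_0=v_0=0$) is a pair $(u,v)\in C([0,\infty),L^2)\times C([0,\infty),L^2)$ with $u(0,\cdot)=v(0,\cdot)=0$ satisfying the equations in the weak sense, i.e. for all nonnegative $\eta\in C_0^\infty([0,\infty))$ and all nonnegative bounded $\varphi\in C^\infty(\mathbb{R}^n)\cap H^{2\sigma}(\mathbb{R}^n)$, with $\eta'(0)=0$, $$\int_0^\infty\!\!\int_{\mathbb{R}^n}|v|^p\,\eta\varphi\,dx\,dt+\eta(0)\int_{\mathbb{R}^n}u_1\varphi\,dx=\int_0^\infty\!\!\int_{\mathbb{R}^n}u\,\big(\eta''\varphi-\eta'\varphi+\eta\,(-\Delta)^\sigma\varphi\big)\,dx\,dt,$$ $$\int_0^\infty\!\!\int_{\mathbb{R}^n}|u|^q\,\eta\varphi\,dx\,dt+\eta(0)\int_{\mathbb{R}^n}v_1\varphi\,dx=\int_0^\infty\!\!\int_{\mathbb{R}^n}v\,\big(\eta''\varphi-\eta'\varphi+\eta\,(-\Delta)^\sigma\varphi\big)\,dx\,dt$$ (in particular the left-hand integrals are finite). *)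

theory Defs
  imports "HOL-Analysis.Analysis"
begin

definition L2_space :: "('a::euclidean_space \<Rightarrow> 'b::{banach, second_countable_topology}) set" where
  "L2_space = {f \<in> borel_measurable lebesgue. integrable lebesgue (\<lambda>x. (norm (f x))\<^sup>2)}"

definition L2_norm :: "('a::euclidean_space \<Rightarrow> 'b::{banach, second_countable_topology}) \<Rightarrow> real" where
  "L2_norm f = sqrt (LINT x|lebesgue. (norm (f x))\<^sup>2)"

definition fourier :: "('a::euclidean_space \<Rightarrow> complex) \<Rightarrow> 'a \<Rightarrow> complex" where
  "fourier f \<xi> = of_real ((2 * pi) powr (- (real DIM('a) / 2))) *
     (LINT x|lebesgue. cis (- (x \<bullet> \<xi>)) * f x)"

text \<open>The Plancherel extension of the Fourier transform from \<open>L\<^sup>1 \<inter> L\<^sup>2\<close> to \<open>L\<^sup>2\<close>, as a relation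
  because the transform is determined only up to a null set.  By Plancherel's theorem
  \<open>fourier (f' k) \<in> L2_space\<close> is automatic and the limit does not depend on the approximation.\<close>

definition has_fourier_L2 :: "('a::euclidean_space \<Rightarrow> complex) \<Rightarrow> ('a \<Rightarrow> complex) \<Rightarrow> bool" where
  "has_fourier_L2 f F \<longleftrightarrow> f \<in> L2_space \<and> F \<in> L2_space \<and>
     (\<exists>f' :: nat \<Rightarrow> 'a \<Rightarrow> complex.
        (\<forall>k. integrable lebesgue (f' k) \<and> f' k \<in> L2_space \<and> fourier (f' k) \<in> L2_space) \<and>
        (\<lambda>k. L2_norm (\<lambda>x. f' k x - f x)) \<longlonglongrightarrow> 0 \<and>
        (\<lambda>k. L2_norm (\<lambda>\<xi>. fourier (f' k) \<xi> - F \<xi>)) \<longlonglongrightarrow> 0)"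

definition sobolev_space :: "real \<Rightarrow> ('a::euclidean_space \<Rightarrow> real) set" where
  "sobolev_space s = {f. \<exists>F. has_fourier_L2 (\<lambda>x. of_real (f x)) F \<and>
     (\<lambda>\<xi>. of_real ((1 + (norm \<xi>)\<^sup>2) powr (s / 2)) * F \<xi>) \<in> L2_space}"

text \<open>\<open>g\<close> represents \<open>(-\<Delta>)\<^sup>\<sigma> f\<close>.  Every \<open>f \<in> sobolev_space (2 * \<sigma>)\<close> has such a \<open>g\<close>, unique up to a
  null set; it can be taken real-valued because the symbol is real and even.\<close>

definition has_frac_laplacian ::
    "real \<Rightarrow> ('a::euclidean_space \<Rightarrow> real) \<Rightarrow> ('a \<Rightarrow> real) \<Rightarrow> bool" where
  "has_frac_laplacian \<sigma> f g \<longleftrightarrow>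
     (\<exists>F. has_fourier_L2 (\<lambda>x. of_real (f x)) F \<and>
          has_fourier_L2 (\<lambda>x. of_real (g x)) (\<lambda>\<xi>. of_real (norm \<xi> powr (2 * \<sigma>)) * F \<xi>))"

definition partial_deriv :: "'a::euclidean_space \<Rightarrow> ('a \<Rightarrow> real) \<Rightarrow> 'a \<Rightarrow> real" where
  "partial_deriv i f x = frechet_derivative f (at x) i"

definition smooth :: "('a::euclidean_space \<Rightarrow> real) \<Rightarrow> bool" where
  "smooth f \<longleftrightarrow> (\<forall>is. set is \<subseteq> Basis \<longrightarrow> foldr partial_deriv is f differentiable_on UNIV)"

text \<open>Differentiation on \<open>[0,\<infinity>)\<close>, one-sided at \<open>0\<close>.\<close>

definition time_deriv :: "(real \<Rightarrow> real) \<Rightarrow> real \<Rightarrow> real" where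
  "time_deriv \<eta> t = vector_derivative \<eta> (at t within {0..})"

text \<open>\<open>C\<^sub>0\<^sup>\<infinity>([0,\<infinity>))\<close>: the support is compact in \<open>[0,\<infinity>)\<close>, so it may contain \<open>0\<close>.\<close>

definition time_test_function :: "(real \<Rightarrow> real) \<Rightarrow> bool" where
  "time_test_function \<eta> \<longleftrightarrow>
     (\<forall>k. (time_deriv ^^ k) \<eta> differentiable_on {0..}) \<and> (\<exists>T. \<forall>t\<ge>T. \<eta> t = 0)"

definition continuous_L2 :: "(real \<Rightarrow> 'a::euclidean_space \<Rightarrow> real) \<Rightarrow> bool" where
  "continuous_L2 u \<longleftrightarrow> (\<forall>t\<ge>0. u t \<in> L2_space) \<and>
     (\<forall>t\<ge>0. ((\<lambda>s. L2_norm (\<lambda>x. u s x - u t x)) \<longlongrightarrow> 0) (at t within {0..}))"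

text \<open>Weak form of \<open>u\<^sub>t\<^sub>t + (-\<Delta>)\<^sup>\<sigma> u + u\<^sub>t = |w|\<^sup>r\<close> with \<open>u(0) = 0\<close>, \<open>u\<^sub>t(0) = h\<close>.  The integral of the
  (nonnegative) nonlinear term is taken in \<open>[0,\<infinity>]\<close> so that its finiteness is an explicit
  requirement.  The space integrals are inner integrals, so that only the spatial measurability of
  \<open>u t\<close> and \<open>w t\<close> matters: for \<open>u\<close>, \<open>w\<close> continuous into \<open>L\<^sup>2\<close> they are, as functions of \<open>t\<close>,
  continuous on the right-hand side and lower semicontinuous in the nonlinear term.\<close>

definition weak_damped_equation ::
    "real \<Rightarrow> real \<Rightarrow> (real \<Rightarrow> 'a::euclidean_space \<Rightarrow> real) \<Rightarrow> (real \<Rightarrow> 'a \<Rightarrow> real) \<Rightarrow>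
     ('a \<Rightarrow> real) \<Rightarrow> bool" where
  "weak_damped_equation \<sigma> r u w h \<longleftrightarrow>
     (\<forall>\<eta> \<phi> g.
        time_test_function \<eta> \<and> (\<forall>t\<ge>0. \<eta> t \<ge> 0) \<and> time_deriv \<eta> 0 = 0 \<and>
        smooth \<phi> \<and> \<phi> \<in> sobolev_space (2 * \<sigma>) \<and> bounded (range \<phi>) \<and> (\<forall>x. \<phi> x \<ge> 0) \<and>
        has_frac_laplacian \<sigma> \<phi> g \<longrightarrow>
        (let N = (\<integral>\<^sup>+t\<in>{0..}. (\<integral>\<^sup>+x. ennreal (\<bar>w t x\<bar> powr r * \<eta> t * \<phi> x) \<partial>lebesgue) \<partial>lebesgue)
         in N < \<infinity> \<and>
            enn2real N + \<eta> 0 * (LINT x|lebesgue. h x * \<phi> x) =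
            (LINT t:{0..}|lebesgue. LINT x|lebesgue.
               u t x * (time_deriv (time_deriv \<eta>) t * \<phi> x - time_deriv \<eta> t * \<phi> x + \<eta> t * g x))))"

definition global_sobolev_solution ::
    "real \<Rightarrow> real \<Rightarrow> real \<Rightarrow> ('a::euclidean_space \<Rightarrow> real) \<Rightarrow> ('a \<Rightarrow> real) \<Rightarrow>
     (real \<Rightarrow> 'a \<Rightarrow> real) \<Rightarrow> (real \<Rightarrow> 'a \<Rightarrow> real) \<Rightarrow> bool" where
  "global_sobolev_solution \<sigma> p q u\<^sub>1 v\<^sub>1 u v \<longleftrightarrow>
     continuous_L2 u \<and> continuous_L2 v \<and>
     (AE x in lebesgue. u 0 x = 0) \<and> (AE x in lebesgue. v 0 x = 0) \<and>
     weak_damped_equation \<sigma> p u v u\<^sub>1 \<and> weak_damped_equation \<sigma> q v u v\<^sub>1"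

end

theory Submission
  imports Defs "HOL-Probability.Probability"
begin

text \<open>The proof is the test function method.  Testing both equations with the product of a time cutoff
  living on \<open>[0, R\<^bsup>2\<sigma>\<^esup>]\<close> and a bump concentrated on the ball of radius \<open>R\<close>, and moving all derivatives onto
  the test function, Hoelder's inequality bounds the energy \<open>I\<^sub>v = \<integral>\<integral>|v|\<^sup>p \<eta> \<phi>\<close> plus the contribution of
  the datum \<open>u\<^sub>1\<close> by a power of \<open>R\<close> times \<open>I\<^sub>u\<^bsup>1/q\<^esup>\<close>, where \<open>I\<^sub>u = \<integral>\<integral>|u|\<^sup>q \<eta> \<phi>\<close>, and symmetrically with
  the roles exchanged (\<open>weak_energy_bound\<close>).  Inserting one bound into the other gives
  \<open>I\<^sub>v + e\<^sup>-\<^sup>1 \<integral>u\<^sub>1 \<phi> \<le> M R\<^sup>\<kappa> I\<^sub>v\<^bsup>1/(pq)\<^esup>\<close>, and \<open>\<kappa> \<le> 0\<close> is exactly the hypothesis on \<open>n\<close>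
  when \<open>p \<ge> q\<close> (\<open>scaling_exponent_nonpos\<close>).  By Young's inequality the power of \<open>I\<^sub>v\<close> is absorbed on the
  left, so that \<open>\<integral>u\<^sub>1 \<phi>\<close> stays below a constant depending only on \<open>n\<close>, \<open>\<sigma>\<close>, \<open>p\<close>, \<open>q\<close>.  As \<open>R \<rightarrow> \<infinity>\<close> it tends to
  a multiple of \<open>\<integral>u\<^sub>1\<close>, which contradicts a large mean (\<open>blow_up_ordered\<close>); this treats the critical
  exponent together with the subcritical ones, at the price of the threshold for the data.

  The delicate point is the bump: the fractional Laplacian is nonlocal, so \<open>\<phi>\<close> has to satisfy
  \<open>|(-\<Delta>)\<^sup>\<sigma> \<phi>| \<le> C \<phi>\<close> on the whole space, and in particular cannot decay fast.  It is built as a mixture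
  of Gaussians \<open>gauss s\<close> of variance \<open>1 + s\<close>, for which every Fourier-side identity turns into an
  identity of Laplace transforms in \<open>l = |\<xi>|\<^sup>2/2\<close> of the mixing densities on the half-line.  Put
  \<open>z = 1/(1+l)\<close>, the Laplace transform of the exponential distribution, so that \<open>l = (1-z)/z\<close>.  A power series
  \<open>z \<Sum> a\<^sub>k z\<^sup>k\<close> is the transform of a series of Erlang densities with coefficients \<open>a\<^sub>k\<close>, and \<open>z\<^sup>\<sigma>\<close> is the transform
  of the Gamma density.  For the mixing density of \<open>\<phi>\<close> with transform \<open>z\<^sup>\<sigma> z m(z)\<close>, \<open>m(z) = 2 - (1-z)\<^bsup>1/2\<^esup>\<close>,
  the symbol \<open>l\<^sup>\<sigma>\<close> cancels the factor \<open>z\<^sup>\<sigma>\<close> and leaves \<open>z (1-z)\<^sup>\<sigma> m(z)\<close>.  All coefficients of \<open>m\<close> are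
  positive and decay as slowly as those of \<open>(1-z)\<^bsup>1/2\<^esup>\<close>, so they dominate those of \<open>(1-z)\<^sup>\<sigma> m(z)\<close>
  (\<open>sing_coeff_le_tail_coeff\<close>).  This yields the pointwise bound up to the Gamma factor, and the latter
  costs only a constant because enlarging the variance of a Gaussian by a fixed factor lowers it by at
  most a constant factor (\<open>gauss_add_ge\<close>, \<open>abs_bump_laplacian_le\<close>).\<close>

section \<open>The Fourier transform of a Gaussian\<close>

lemma borel_measurable_cis [measurable (raw)]:
  "f \<in> borel_measurable M \<Longrightarrow> (\<lambda>x. cis (f x)) \<in> borel_measurable M"
  by (rule borel_measurable_continuous_on[of cis]) (auto intro: continuous_intros)

text \<open>This is the characteristic function of the standard normal distribution, rescaled.\<close>

lemma gaussian_fourier_real_line: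
  fixes v t :: real
  assumes v: "v > 0"
  shows "has_bochner_integral lborel (\<lambda>x. cis (- (x * t)) * of_real (exp (- x\<^sup>2 / (2 * v))))
           (of_real (sqrt (2 * pi * v) * exp (- v * t\<^sup>2 / 2)))"
proof -
  define r where "r = sqrt v"
  have r: "r > 0" "r\<^sup>2 = v" using v by (auto simp: r_def)
  have int: "integrable lborel (\<lambda>x. iexp (- t * r * x) * complex_of_real (std_normal_density x))"
    by (rule Bochner_Integration.integrable_bound[of _ std_normal_density])
       (auto simp: norm_mult integrable_normal_density)
  have "of_real (exp (- ((- t * r)\<^sup>2) / 2)) = char std_normal_distribution (- t * r)"
    by (simp add: char_std_normal_distribution)
  also have "\<dots> = (LINT x|lborel. std_normal_density x *\<^sub>R iexp (- t * r * x))"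
    unfolding char_def
    by (subst integral_density) (auto simp: )
  also have "\<dots> = (LINT x|lborel. iexp (- t * r * x) * complex_of_real (std_normal_density x))"
    by (simp add: scaleR_conv_of_real mult.commute)
  finally have "has_bochner_integral lborel
      (\<lambda>x. iexp (- t * r * x) * complex_of_real (std_normal_density x)) (of_real (exp (- v * t\<^sup>2 / 2)))"
    using int r by (simp add: has_bochner_integral_iff power_mult_distrib mult.commute)
  then have "has_bochner_integral lborel
      (\<lambda>x. iexp (- t * r * (0 + (1/r) * x)) * complex_of_real (std_normal_density (0 + (1/r) * x)))
      (of_real (exp (- v * t\<^sup>2 / 2)) /\<^sub>R \<bar>1/r\<bar>)"
    using r by (subst (asm) lborel_has_bochner_integral_real_affine_iff[of "1/r" _ _ 0]) auto
  then have "has_bochner_integral lborel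
      (\<lambda>x. of_real (sqrt (2 * pi)) * (iexp (- t * r * (0 + (1/r) * x)) * complex_of_real (std_normal_density (0 + (1/r) * x))))
      (of_real (sqrt (2 * pi)) * (of_real (exp (- v * t\<^sup>2 / 2)) /\<^sub>R \<bar>1/r\<bar>))"
    by (rule has_bochner_integral_mult_right)
  moreover have "of_real (sqrt (2 * pi)) * (iexp (- t * r * (0 + (1/r) * x)) * complex_of_real (std_normal_density (0 + (1/r) * x)))
     = cis (- (x * t)) * of_real (exp (- x\<^sup>2 / (2 * v)))" for x
    using r by (simp add: std_normal_density_def cis_conv_exp power_divide mult.commute
        flip: of_real_mult)
  moreover have "of_real (sqrt (2 * pi)) * (of_real (exp (- v * t\<^sup>2 / 2)) /\<^sub>R \<bar>1/r\<bar>) =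
     complex_of_real (sqrt (2 * pi * v) * exp (- v * t\<^sup>2 / 2))"
    using r by (simp add: scaleR_conv_of_real r_def real_sqrt_mult)
  ultimately show ?thesis by simp
qed

text \<open>The integrand is a product of functions of the single coordinates.\<close>

lemma gaussian_fourier:
  fixes \<xi> :: "'a::euclidean_space"
  assumes v: "v > 0"
  shows "has_bochner_integral lborel
           (\<lambda>x. cis (- (x \<bullet> \<xi>)) * of_real (exp (- (norm x)\<^sup>2 / (2 * v))))
           (of_real ((2 * pi * v) powr (real DIM('a) / 2) * exp (- v * (norm \<xi>)\<^sup>2 / 2)))"
proof -
  interpret product_sigma_finite "\<lambda>_::'a. lborel :: real measure"
    by unfold_locales
  let ?h = "\<lambda>b y. cis (- (y * (\<xi> \<bullet> b))) * complex_of_real (exp (- y\<^sup>2 / (2 * v)))"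
  have normsq: "(norm x)\<^sup>2 = (\<Sum>b\<in>Basis. (x \<bullet> b)\<^sup>2)" for x :: 'a
    by (subst power2_norm_eq_inner, subst euclidean_inner) (simp add: power2_eq_square)
  have sumB: "(\<Sum>b\<in>Basis. f b *\<^sub>R b) \<bullet> b = f b" if "b \<in> Basis" for f and b :: 'a
    using that by simp
  have prod: "cis (- (x \<bullet> \<xi>)) * of_real (exp (- (norm x)\<^sup>2 / (2 * v))) = (\<Prod>b\<in>Basis. ?h b (x \<bullet> b))" for x
  proof -
    have "cis (- (x \<bullet> \<xi>)) = (\<Prod>b\<in>Basis. cis (- ((x \<bullet> b) * (\<xi> \<bullet> b))))"
      by (simp add: cis_conv_exp euclidean_inner[of x \<xi>] exp_sum[symmetric] sum_distrib_left sum_negf)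
    moreover have "exp (- (norm x)\<^sup>2 / (2 * v)) = (\<Prod>b\<in>Basis. exp (- (x \<bullet> b)\<^sup>2 / (2 * v)))"
      by (subst exp_sum[symmetric], simp) (simp add: normsq sum_divide_distrib sum_negf)
    ultimately show ?thesis by (simp add: prod.distrib)
  qed
  have h1: "has_bochner_integral lborel (?h b)
      (of_real (sqrt (2 * pi * v) * exp (- v * (\<xi> \<bullet> b)\<^sup>2 / 2)))" for b
    by (rule gaussian_fourier_real_line[OF v])
  have "integrable (\<Pi>\<^sub>M b\<in>Basis. lborel) (\<lambda>x. \<Prod>b\<in>Basis. ?h b (x b))"
    by (rule product_integrable_prod) (use h1 in \<open>auto simp: has_bochner_integral_iff\<close>)
  moreover have "integral\<^sup>L (\<Pi>\<^sub>M b\<in>Basis. lborel) (\<lambda>x. \<Prod>b\<in>Basis. ?h b (x b)) =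
      (\<Prod>b\<in>Basis. of_real (sqrt (2 * pi * v) * exp (- v * (\<xi> \<bullet> b)\<^sup>2 / 2)))"
    by (subst product_integral_prod)
       (use h1 in \<open>auto simp: has_bochner_integral_iff\<close>)
  moreover have "(\<Prod>b\<in>Basis. complex_of_real (sqrt (2 * pi * v) * exp (- v * (\<xi> \<bullet> b)\<^sup>2 / 2))) =
      of_real ((2 * pi * v) powr (real DIM('a) / 2) * exp (- v * (norm \<xi>)\<^sup>2 / 2))"
  proof -
    have "(\<Prod>b\<in>Basis. exp (- v * (\<xi> \<bullet> b)\<^sup>2 / 2)) = exp (- v * (norm \<xi>)\<^sup>2 / 2)"
      by (subst exp_sum[symmetric], simp)
         (simp add: normsq sum_divide_distrib sum_negf sum_distrib_left)
    moreover have "sqrt (2 * pi * v) ^ DIM('a) = (2 * pi * v) powr (real DIM('a) / 2)"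
      using v by (simp add: powr_half_sqrt[symmetric] powr_realpow[symmetric] powr_powr)
    ultimately show ?thesis
      by (simp add: prod.distrib flip: of_real_prod of_real_power)
  qed
  ultimately have "has_bochner_integral (\<Pi>\<^sub>M b\<in>Basis. lborel)
      (\<lambda>x. \<Prod>b\<in>Basis. ?h b (x b))
      (of_real ((2 * pi * v) powr (real DIM('a) / 2) * exp (- v * (norm \<xi>)\<^sup>2 / 2)))"
    by (simp add: has_bochner_integral_iff)
  moreover define F where "F = (\<lambda>x::'a. \<Prod>b\<in>Basis. ?h b (x \<bullet> b))"
  have [measurable]: "F \<in> borel_measurable borel" unfolding F_def by measurable
  have "F (\<Sum>b\<in>Basis. f b *\<^sub>R b) = (\<Prod>b\<in>Basis. ?h b (f b))" for f
    unfolding F_def by (rule prod.cong[OF refl]) (simp only: sumB)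
  ultimately have "has_bochner_integral (\<Pi>\<^sub>M b\<in>Basis. lborel) (\<lambda>f. F (\<Sum>b\<in>Basis. f b *\<^sub>R b))
      (of_real ((2 * pi * v) powr (real DIM('a) / 2) * exp (- v * (norm \<xi>)\<^sup>2 / 2)))"
    by (simp only:)
  then have "has_bochner_integral (distr (\<Pi>\<^sub>M b\<in>Basis. lborel) borel (\<lambda>f. \<Sum>b\<in>Basis. f b *\<^sub>R b)) F
      (of_real ((2 * pi * v) powr (real DIM('a) / 2) * exp (- v * (norm \<xi>)\<^sup>2 / 2)))"
    unfolding has_bochner_integral_iff
    by (subst integrable_distr_eq, simp, simp, subst integral_distr) simp_all
  then show ?thesis
    unfolding lborel_eq[symmetric] by (simp only: F_def prod)
qed

section \<open>Mixtures of Gaussians\<close>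

text \<open>The density of the centred normal distribution with variance \<open>1 + s\<close> in each coordinate, without
  the factor \<open>(2\<pi>)\<^bsup>-n/2\<^esup>\<close>.  The offset \<open>1\<close> keeps the mixtures bounded and their Fourier transforms
  bounded by a Gaussian when \<open>s\<close> comes close to \<open>0\<close>.\<close>

definition gauss :: "real \<Rightarrow> 'a::euclidean_space \<Rightarrow> real" where
  "gauss s x = (1 + s) powr (- (real DIM('a) / 2)) * exp (- (norm x)\<^sup>2 / (2 * (1 + s)))"

lemma gauss_pos: "s \<ge> 0 \<Longrightarrow> 0 < gauss s x"
  by (simp add: gauss_def)

lemma gauss_le_1: "s \<ge> 0 \<Longrightarrow> gauss s (x::'a::euclidean_space) \<le> 1"
proof -
  assume "s \<ge> 0"
  then have "1 \<le> (1 + s) powr (real DIM('a) / 2)" by (intro ge_one_powr_ge_zero) auto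
  then show ?thesis
    unfolding gauss_def using \<open>s \<ge> 0\<close>
    by (intro mult_le_one) (auto simp: powr_minus inverse_le_1_iff)
qed

lemma gauss_measurable [measurable]:
  assumes [measurable]: "f \<in> borel_measurable M" "g \<in> borel_measurable M"
  shows "(\<lambda>\<omega>. gauss (f \<omega>) (g \<omega> :: 'a::euclidean_space)) \<in> borel_measurable M"
  unfolding gauss_def by measurable

text \<open>Adding variance widens the exponential, so only the normalising factor can decrease.\<close>

lemma gauss_add_ge:
  fixes x :: "'a::euclidean_space"
  assumes "s \<ge> 0" "s' \<ge> 0"
  shows "(1 + s') powr (- (real DIM('a) / 2)) * gauss s x \<le> gauss (s + s') x"
proof -
  have "((1 + s) * (1 + s')) powr (- (real DIM('a) / 2)) \<le> (1 + (s + s')) powr (- (real DIM('a) / 2))"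
    using assms by (intro powr_mono2') (auto simp: algebra_simps)
  moreover have "exp (- (norm x)\<^sup>2 / (2 * (1 + s))) \<le> exp (- (norm x)\<^sup>2 / (2 * (1 + (s + s'))))"
    using assms by (auto intro!: divide_left_mono)
  ultimately show ?thesis
    unfolding gauss_def using assms
    by (subst mult.assoc[symmetric])
       (intro mult_mono, auto simp: powr_mult[symmetric] mult.commute)
qed

lemma gauss_fourier:
  fixes \<xi> :: "'a::euclidean_space"
  assumes s: "s \<ge> 0"
  shows "has_bochner_integral lborel (\<lambda>x. cis (- (x \<bullet> \<xi>)) * of_real (gauss s x))
           (of_real ((2 * pi) powr (real DIM('a) / 2) * exp (- (1 + s) * (norm \<xi>)\<^sup>2 / 2)))"
proof -
  have "has_bochner_integral lborel
     (\<lambda>x. of_real ((1 + s) powr (- (real DIM('a) / 2))) *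
        (cis (- (x \<bullet> \<xi>)) * of_real (exp (- (norm x)\<^sup>2 / (2 * (1 + s))))))
     (of_real ((1 + s) powr (- (real DIM('a) / 2))) *
        of_real ((2 * pi * (1 + s)) powr (real DIM('a) / 2) * exp (- (1 + s) * (norm \<xi>)\<^sup>2 / 2)))"
    by (intro has_bochner_integral_mult_right gaussian_fourier) (use s in auto)
  moreover have "(1 + s) powr (- (real DIM('a) / 2)) * (2 * pi * (1 + s)) powr (real DIM('a) / 2) =
     (2 * pi) powr (real DIM('a) / 2)"
    using s by (subst powr_mult) (auto simp: powr_minus)
  then have "(1 + s) powr (- (real DIM('a) / 2)) * ((2 * pi * (1 + s)) powr (real DIM('a) / 2) * c) =
     (2 * pi) powr (real DIM('a) / 2) * c" for c
    by (simp only: mult.assoc[symmetric])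
  ultimately show ?thesis
    unfolding of_real_mult[symmetric] by (simp only: gauss_def of_real_mult mult.left_commute)
qed

lemma gauss_inversion:
  fixes x :: "'a::euclidean_space"
  assumes s: "s \<ge> 0"
  shows "has_bochner_integral lborel (\<lambda>\<xi>. cis (x \<bullet> \<xi>) * of_real (exp (- (1 + s) * (norm \<xi>)\<^sup>2 / 2)))
           (of_real ((2 * pi) powr (real DIM('a) / 2) * gauss s x))"
proof -
  have "has_bochner_integral lborel
      (\<lambda>\<xi>. cis (- (\<xi> \<bullet> - x)) * of_real (exp (- (norm \<xi>)\<^sup>2 / (2 * (1 / (1 + s))))))
      (of_real ((2 * pi * (1 / (1 + s))) powr (real DIM('a) / 2) * exp (- (1 / (1 + s)) * (norm (- x))\<^sup>2 / 2)))"
    by (rule gaussian_fourier) (use s in auto)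
  moreover have "(2 * pi * (1 / (1 + s))) powr (real DIM('a) / 2) =
     (2 * pi) powr (real DIM('a) / 2) * (1 + s) powr (- (real DIM('a) / 2))"
    using s by (simp add: powr_divide powr_minus_divide)
  moreover have "- (norm \<xi>)\<^sup>2 / (2 * (1 / (1 + s))) = - (1 + s) * (norm \<xi>)\<^sup>2 / 2" for \<xi> :: 'a
    using s by (simp add: field_simps)
  moreover have "- (1 / (1 + s)) * (norm (- x))\<^sup>2 / 2 = - (norm x)\<^sup>2 / (2 * (1 + s))"
    using s by (simp add: field_simps)
  ultimately show ?thesis
    by (simp only: gauss_def inner_commute[of x] inner_minus_right minus_minus mult.assoc)
qed

lemma gauss_integral:
  assumes "s \<ge> 0"
  shows "has_bochner_integral lborel (gauss s :: 'a::euclidean_space \<Rightarrow> real)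
           ((2 * pi) powr (real DIM('a) / 2))"
proof -
  have "has_bochner_integral lborel (\<lambda>x::'a. complex_of_real (gauss s x))
     (of_real ((2 * pi) powr (real DIM('a) / 2)))"
    using gauss_fourier[OF assms, of "0::'a"] by simp
  then show ?thesis by (simp add: has_bochner_integral_iff complex_of_real_integrable_eq)
qed

definition gauss_mix :: "'b measure \<Rightarrow> ('b \<Rightarrow> real) \<Rightarrow> ('b \<Rightarrow> real) \<Rightarrow> 'a::euclidean_space \<Rightarrow> real" where
  "gauss_mix M w \<tau> x = (LINT \<omega>|M. w \<omega> * gauss (\<tau> \<omega>) x)"

text \<open>The Laplace transform of the law of \<open>\<tau>\<close> under the signed measure \<open>w M\<close>.\<close>

definition mix_laplace :: "'b measure \<Rightarrow> ('b \<Rightarrow> real) \<Rightarrow> ('b \<Rightarrow> real) \<Rightarrow> real \<Rightarrow> real" where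
  "mix_laplace M w \<tau> l = (LINT \<omega>|M. w \<omega> * exp (- l * \<tau> \<omega>))"

text \<open>Gaussians of random variance \<open>1 + \<tau>\<close>, weighted by a signed density \<open>w\<close>.  The measure space is kept
  abstract because the density lives on the line for the fractional Laplacian of the bump, but on the plane for
  the bump itself, whose variance is the sum of two independent variables.\<close>

locale mixing = sigma_finite_measure M for M :: "'b measure" +
  fixes w \<tau> :: "'b \<Rightarrow> real"
  assumes w_int: "integrable M w"
    and \<tau>_meas [measurable]: "\<tau> \<in> borel_measurable M"
    and \<tau>_nonneg: "\<And>\<omega>. 0 \<le> \<tau> \<omega>"
begin

lemma gauss_exponent_split:
  "exp (- (1 + s) * (norm \<xi>)\<^sup>2 / 2) = exp (- ((norm \<xi>)\<^sup>2 / 2)) * exp (- ((norm \<xi>)\<^sup>2 / 2) * s)"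
  by (simp add: mult_exp_exp field_simps)

lemma w_meas [measurable]: "w \<in> borel_measurable M"
  using w_int by simp

lemma mix_integrand: "integrable M (\<lambda>\<omega>. w \<omega> * gauss (\<tau> \<omega>) (x :: 'a::euclidean_space))"
  by (rule Bochner_Integration.integrable_bound[OF w_int])
     (auto simp: abs_mult gauss_pos less_imp_le \<tau>_nonneg gauss_le_1 intro!: mult_left_le)

lemma laplace_integrand: "l \<ge> 0 \<Longrightarrow> integrable M (\<lambda>\<omega>. w \<omega> * exp (- l * \<tau> \<omega>))"
  by (rule Bochner_Integration.integrable_bound[OF w_int])
     (auto simp: abs_mult \<tau>_nonneg intro!: mult_left_le)

lemma abs_laplace_le: "l \<ge> 0 \<Longrightarrow> \<bar>mix_laplace M w \<tau> l\<bar> \<le> (LINT \<omega>|M. \<bar>w \<omega>\<bar>)"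
  unfolding mix_laplace_def
  by (rule order_trans[OF integral_abs_bound])
     (use integrable_abs[OF laplace_integrand] in
       \<open>auto intro!: integral_mono integrable_abs[OF w_int] simp: abs_mult \<tau>_nonneg mult_left_le\<close>)

lemma laplace_meas [measurable]: "mix_laplace M w \<tau> \<in> borel_measurable borel"
  unfolding mix_laplace_def by measurable

lemma mix_meas [measurable]: "(gauss_mix M w \<tau> :: 'a::euclidean_space \<Rightarrow> real) \<in> borel_measurable borel"
  unfolding gauss_mix_def by measurable

lemma abs_mix_le: "\<bar>gauss_mix M w \<tau> (x::'a::euclidean_space)\<bar> \<le> (LINT \<omega>|M. \<bar>w \<omega>\<bar>)"
  unfolding gauss_mix_def
  by (rule order_trans[OF integral_abs_bound])
     (use integrable_abs[OF mix_integrand] in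
       \<open>auto intro!: integral_mono integrable_abs[OF w_int]
           simp: abs_mult \<tau>_nonneg mult_left_le gauss_pos less_imp_le gauss_le_1\<close>)

lemma mix_pair_integrable:
  fixes \<xi> :: "'a::euclidean_space"
  shows "integrable (lborel \<Otimes>\<^sub>M M) (\<lambda>(x, \<omega>). cis (- (x \<bullet> \<xi>)) * of_real (w \<omega> * gauss (\<tau> \<omega>) x))"
proof -
  interpret P: pair_sigma_finite M "lborel :: 'a measure" by unfold_locales
  have "integrable (M \<Otimes>\<^sub>M lborel) (\<lambda>(\<omega>, x). cis (- (x \<bullet> \<xi>)) * of_real (w \<omega> * gauss (\<tau> \<omega>) x))"
  proof (rule P.Fubini_integrable)
    show "(\<lambda>(\<omega>, x). cis (- (x \<bullet> \<xi>)) * of_real (w \<omega> * gauss (\<tau> \<omega>) x)) \<in> borel_measurable (M \<Otimes>\<^sub>M lborel)"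
      by measurable
    have "(LINT x|lborel. norm (cis (- (x \<bullet> \<xi>)) * of_real (w \<omega> * gauss (\<tau> \<omega>) x))) =
        \<bar>w \<omega>\<bar> * (2 * pi) powr (real DIM('a) / 2)" for \<omega>
      using gauss_integral[OF \<tau>_nonneg[of \<omega>], where 'a = 'a]
      by (simp add: norm_mult abs_mult gauss_pos less_imp_le \<tau>_nonneg has_bochner_integral_iff)
    then show "integrable M (\<lambda>\<omega>. LINT x|lborel. norm (case (\<omega>, x) of (\<omega>, x) \<Rightarrow> cis (- (x \<bullet> \<xi>)) * of_real (w \<omega> * gauss (\<tau> \<omega>) x)))"
      using w_int by simp
    show "AE \<omega> in M. integrable lborel (\<lambda>x. case (\<omega>, x) of (\<omega>, x) \<Rightarrow> cis (- (x \<bullet> \<xi>)) * of_real (w \<omega> * gauss (\<tau> \<omega>) x))"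
    proof (rule AE_I2)
      fix \<omega>
      have "integrable lborel (\<lambda>x. of_real (w \<omega>) * (cis (- (x \<bullet> \<xi>)) * of_real (gauss (\<tau> \<omega>) x)))"
        using gauss_fourier[OF \<tau>_nonneg, of \<xi> \<omega>] by (intro integrable_mult_right) (auto simp: has_bochner_integral_iff)
      then show "integrable lborel (\<lambda>x. case (\<omega>, x) of (\<omega>, x) \<Rightarrow> cis (- (x \<bullet> \<xi>)) * of_real (w \<omega> * gauss (\<tau> \<omega>) x))"
        by (simp add: mult_ac)
    qed
  qed
  from P.integrable_product_swap[OF this] show ?thesis by (simp add: case_prod_unfold)
qed

lemma mix_integrable: "integrable lborel (gauss_mix M w \<tau> :: 'a::euclidean_space \<Rightarrow> real)"
proof -
  interpret P: pair_sigma_finite "lborel :: 'a measure" M by unfold_locales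
  have "integrable lborel (\<lambda>x::'a. LINT \<omega>|M. complex_of_real (w \<omega> * gauss (\<tau> \<omega>) x))"
    using P.integrable_fst'[OF mix_pair_integrable[of 0]] by simp
  then have "integrable lborel (\<lambda>x::'a. complex_of_real (gauss_mix M w \<tau> x))"
    by (simp add: gauss_mix_def del: of_real_mult)
  then show ?thesis by (simp add: complex_of_real_integrable_eq)
qed

text \<open>By Fubini the transform acts on each Gaussian separately, and a Gaussian of variance \<open>1 + s\<close>
  contributes \<open>exp (- s l)\<close> with \<open>l = |\<xi>|\<^sup>2/2\<close>: hence the Laplace transform of the mixture.\<close>

lemma mix_fourier:
  fixes \<xi> :: "'a::euclidean_space"
  shows "(LINT x|lborel. cis (- (x \<bullet> \<xi>)) * of_real (gauss_mix M w \<tau> x)) =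
     of_real ((2 * pi) powr (real DIM('a) / 2) * (exp (- ((norm \<xi>)\<^sup>2 / 2)) * mix_laplace M w \<tau> ((norm \<xi>)\<^sup>2 / 2)))"
proof -
  interpret P: pair_sigma_finite "lborel :: 'a measure" M by unfold_locales
  have "(LINT x|lborel. cis (- (x \<bullet> \<xi>)) * of_real (gauss_mix M w \<tau> x)) =
     (LINT x|lborel. LINT \<omega>|M. cis (- (x \<bullet> \<xi>)) * of_real (w \<omega> * gauss (\<tau> \<omega>) x))"
    by (simp add: gauss_mix_def del: of_real_mult)
  also have "\<dots> = (LINT \<omega>|M. LINT x|lborel. cis (- (x \<bullet> \<xi>)) * of_real (w \<omega> * gauss (\<tau> \<omega>) x))"
    by (rule P.Fubini_integral[symmetric, OF mix_pair_integrable])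
  also have "\<dots> = (LINT \<omega>|M. of_real (w \<omega> * ((2 * pi) powr (real DIM('a) / 2) * exp (- (1 + \<tau> \<omega>) * (norm \<xi>)\<^sup>2 / 2))))"
  proof (rule Bochner_Integration.integral_cong[OF refl])
    fix \<omega>
    have "has_bochner_integral lborel (\<lambda>x. of_real (w \<omega>) * (cis (- (x \<bullet> \<xi>)) * of_real (gauss (\<tau> \<omega>) x)))
       (of_real (w \<omega>) * of_real ((2 * pi) powr (real DIM('a) / 2) * exp (- (1 + \<tau> \<omega>) * (norm \<xi>)\<^sup>2 / 2)))"
      by (intro has_bochner_integral_mult_right gauss_fourier \<tau>_nonneg)
    then show "(LINT x|lborel. cis (- (x \<bullet> \<xi>)) * of_real (w \<omega> * gauss (\<tau> \<omega>) x)) =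
      of_real (w \<omega> * ((2 * pi) powr (real DIM('a) / 2) * exp (- (1 + \<tau> \<omega>) * (norm \<xi>)\<^sup>2 / 2)))"
      by (simp add: has_bochner_integral_iff mult_ac)
  qed
  also have "\<dots> = of_real (LINT \<omega>|M. ((2 * pi) powr (real DIM('a) / 2) * exp (- ((norm \<xi>)\<^sup>2 / 2))) * (w \<omega> * exp (- ((norm \<xi>)\<^sup>2 / 2) * \<tau> \<omega>)))"
    unfolding integral_complex_of_real
    by (intro arg_cong[of _ _ of_real] Bochner_Integration.integral_cong refl)
       (simp only: gauss_exponent_split mult_ac)
  also have "\<dots> = of_real ((2 * pi) powr (real DIM('a) / 2) * (exp (- ((norm \<xi>)\<^sup>2 / 2)) * mix_laplace M w \<tau> ((norm \<xi>)\<^sup>2 / 2)))"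
    by (subst integral_mult_right_zero) (simp add: mix_laplace_def mult_ac)
  finally show ?thesis .
qed

lemma mix_inversion:
  fixes x :: "'a::euclidean_space"
  shows "of_real ((2 * pi) powr (real DIM('a) / 2) * gauss_mix M w \<tau> x) =
     (LINT \<xi>|lborel. cis (x \<bullet> \<xi>) * of_real (exp (- ((norm \<xi>)\<^sup>2 / 2)) * mix_laplace M w \<tau> ((norm \<xi>)\<^sup>2 / 2)))"
proof -
  interpret P: pair_sigma_finite M "lborel :: 'a measure" by unfold_locales
  let ?h = "\<lambda>\<omega> \<xi>. cis (x \<bullet> \<xi>) * complex_of_real (w \<omega> * exp (- (1 + \<tau> \<omega>) * (norm \<xi>)\<^sup>2 / 2))"
  have hb: "has_bochner_integral lborel (?h \<omega>)
      (of_real (w \<omega>) * of_real ((2 * pi) powr (real DIM('a) / 2) * gauss (\<tau> \<omega>) x))" for \<omega>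
    using has_bochner_integral_mult_right[OF gauss_inversion[OF \<tau>_nonneg, of x \<omega>], of "of_real (w \<omega>)"]
    by (simp add: mult_ac)
  have int: "integrable (M \<Otimes>\<^sub>M lborel) (\<lambda>(\<omega>, \<xi>). ?h \<omega> \<xi>)"
  proof (rule P.Fubini_integrable)
    show "(\<lambda>(\<omega>, \<xi>). ?h \<omega> \<xi>) \<in> borel_measurable (M \<Otimes>\<^sub>M lborel)" by measurable
    have g0: "integrable lborel (\<lambda>\<xi>::'a. exp (- (norm \<xi>)\<^sup>2 / 2))"
      using gauss_integral[of 0, where 'a = 'a] by (simp add: gauss_def[abs_def] has_bochner_integral_iff)
    show "integrable M (\<lambda>\<omega>. LINT \<xi>|lborel. norm (case (\<omega>, \<xi>) of (\<omega>, \<xi>) \<Rightarrow> ?h \<omega> \<xi>))"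
    proof (rule Bochner_Integration.integrable_bound)
      show "integrable M (\<lambda>\<omega>. w \<omega> * (LINT \<xi>|lborel. exp (- (norm (\<xi>::'a))\<^sup>2 / 2)))"
        using w_int by simp
      show "AE \<omega> in M. norm (LINT \<xi>|lborel. norm (case (\<omega>, \<xi>) of (\<omega>, \<xi>) \<Rightarrow> ?h \<omega> \<xi>))
         \<le> norm (w \<omega> * (LINT \<xi>|lborel. exp (- (norm (\<xi>::'a))\<^sup>2 / 2)))"
      proof (rule AE_I2)
        fix \<omega>
        have "(LINT \<xi>|lborel. norm (?h \<omega> \<xi>)) \<le> (LINT \<xi>|lborel. \<bar>w \<omega>\<bar> * exp (- (norm (\<xi>::'a))\<^sup>2 / 2))"
        proof (rule integral_mono)
          show "integrable lborel (\<lambda>\<xi>. norm (?h \<omega> \<xi>))" using hb[of \<omega>] by (auto simp: has_bochner_integral_iff)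
          show "integrable lborel (\<lambda>\<xi>::'a. \<bar>w \<omega>\<bar> * exp (- (norm \<xi>)\<^sup>2 / 2))" using g0 by simp
          show "norm (?h \<omega> \<xi>) \<le> \<bar>w \<omega>\<bar> * exp (- (norm \<xi>)\<^sup>2 / 2)" for \<xi>
            using \<tau>_nonneg[of \<omega>] by (auto simp: norm_mult abs_mult algebra_simps intro!: mult_left_mono)
        qed
        then show "norm (LINT \<xi>|lborel. norm (case (\<omega>, \<xi>) of (\<omega>, \<xi>) \<Rightarrow> ?h \<omega> \<xi>))
         \<le> norm (w \<omega> * (LINT \<xi>|lborel. exp (- (norm (\<xi>::'a))\<^sup>2 / 2)))"
          by (simp add: abs_mult)
      qed
    qed measurable
    show "AE \<omega> in M. integrable lborel (\<lambda>\<xi>. case (\<omega>, \<xi>) of (\<omega>, \<xi>) \<Rightarrow> ?h \<omega> \<xi>)"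
      using hb by (auto simp: has_bochner_integral_iff)
  qed
  have "(LINT \<xi>|lborel. cis (x \<bullet> \<xi>) * of_real (exp (- ((norm \<xi>)\<^sup>2 / 2)) * mix_laplace M w \<tau> ((norm \<xi>)\<^sup>2 / 2)))
      = (LINT \<xi>|lborel. LINT \<omega>|M. ?h \<omega> \<xi>)"
  proof (rule Bochner_Integration.integral_cong[OF refl])
    fix \<xi> :: 'a
    have "exp (- ((norm \<xi>)\<^sup>2 / 2)) * mix_laplace M w \<tau> ((norm \<xi>)\<^sup>2 / 2) =
      (LINT \<omega>|M. w \<omega> * exp (- (1 + \<tau> \<omega>) * (norm \<xi>)\<^sup>2 / 2))"
      unfolding mix_laplace_def
      by (subst integral_mult_right_zero[symmetric])
         (intro Bochner_Integration.integral_cong refl, simp only: gauss_exponent_split mult_ac)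
    then show "cis (x \<bullet> \<xi>) * of_real (exp (- ((norm \<xi>)\<^sup>2 / 2)) * mix_laplace M w \<tau> ((norm \<xi>)\<^sup>2 / 2)) = (LINT \<omega>|M. ?h \<omega> \<xi>)"
      by (simp del: of_real_mult)
  qed
  also have "\<dots> = (LINT \<omega>|M. LINT \<xi>|lborel. ?h \<omega> \<xi>)"
    by (rule P.Fubini_integral[OF int])
  also have "\<dots> = (LINT \<omega>|M. of_real ((2 * pi) powr (real DIM('a) / 2) * (w \<omega> * gauss (\<tau> \<omega>) x)))"
    using hb by (intro Bochner_Integration.integral_cong refl) (simp add: has_bochner_integral_iff mult_ac)
  also have "\<dots> = of_real ((2 * pi) powr (real DIM('a) / 2) * gauss_mix M w \<tau> x)"
    unfolding integral_complex_of_real by (simp add: gauss_mix_def)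
  finally show ?thesis ..
qed

end

section \<open>Mixing densities from binomial series\<close>

lemma (in mixing) mix_pos:
  assumes "\<And>\<omega>. 0 \<le> w \<omega>" "0 < (LINT \<omega>|M. w \<omega>)"
  shows "0 < gauss_mix M w \<tau> (x::'a::euclidean_space)"
proof -
  have nn: "0 \<le> w \<omega> * gauss (\<tau> \<omega>) x" for \<omega>
    using assms(1)[of \<omega>] gauss_pos[OF \<tau>_nonneg[of \<omega>], of x] by (simp add: less_imp_le)
  have "gauss_mix M w \<tau> x \<noteq> 0"
  proof
    assume "gauss_mix M w \<tau> x = 0"
    then have "AE \<omega> in M. w \<omega> * gauss (\<tau> \<omega>) x = 0"
      unfolding gauss_mix_def using nn by (subst (asm) integral_nonneg_eq_0_iff_AE[OF mix_integrand]) auto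
    then have "AE \<omega> in M. w \<omega> = 0"
      by eventually_elim (use gauss_pos[OF \<tau>_nonneg] in \<open>auto simp: less_le\<close>)
    then have "(LINT \<omega>|M. w \<omega>) = 0" by (rule integral_eq_zero_AE)
    then show False using assms(2) by simp
  qed
  moreover have "0 \<le> gauss_mix M w \<tau> x"
    unfolding gauss_mix_def using nn by (intro integral_nonneg_AE) auto
  ultimately show ?thesis by simp
qed

text \<open>The Taylor coefficients of \<open>(1 - z)\<^sup>a\<close>.\<close>

definition alt_binom :: "real \<Rightarrow> nat \<Rightarrow> real" where
  "alt_binom a k = (-1) ^ k * (a gchoose k)"

lemma alt_binom_0 [simp]: "alt_binom a 0 = 1"
  by (simp add: alt_binom_def)

lemma alt_binom_Suc: "alt_binom a (Suc k) = alt_binom a k * ((real k - a) / real (Suc k))"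
proof -
  have "real (Suc k) * (a gchoose Suc k) = (a - real k) * (a gchoose k)"
    using gbinomial_mult_1[of a k] by (simp add: algebra_simps)
  then have "((a::real) gchoose Suc k) = (a - real k) * (a gchoose k) / real (Suc k)"
    by (simp add: field_simps)
  then have "alt_binom a (Suc k) = - ((-1) ^ k * ((a - real k) * (a gchoose k) / real (Suc k)))"
    unfolding alt_binom_def by simp
  then show ?thesis
    unfolding alt_binom_def by (simp add: algebra_simps diff_divide_distrib del: of_nat_Suc)
qed

lemma alt_binom_sums:
  assumes "0 \<le> z" "z < 1"
  shows "(\<lambda>k. alt_binom a k * z ^ k) sums (1 - z) powr a"
  using gen_binomial_real[of "-z" a] assms
  by (simp add: alt_binom_def power_minus[of z] mult_ac)

text \<open>The Taylor coefficients of \<open>2 - (1 - z)\<^bsup>1/2\<^esup>\<close>.  They are positive and summable, but decay only like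
  \<open>k\<^bsup>-3/2\<^esup>\<close>.  An exponent
  strictly between \<open>0\<close> and \<open>1\<close> is what makes the coefficients positive.\<close>

definition tail_coeff :: "nat \<Rightarrow> real" where
  "tail_coeff k = \<bar>alt_binom (1/2) k\<bar>"

lemma alt_binom_half_neg: "alt_binom (1/2) (Suc k) < 0"
proof (induction k)
  case (Suc k)
  have "0 < (real (Suc k) - 1/2) / real (Suc (Suc k))" by simp
  with Suc show ?case by (subst alt_binom_Suc) (rule mult_neg_pos)
qed (simp add: alt_binom_Suc)

lemma tail_coeff_pos: "0 < tail_coeff k"
  using alt_binom_half_neg by (cases k) (auto simp: tail_coeff_def less_imp_neq)

lemma tail_coeff_Suc: "tail_coeff (Suc k) = tail_coeff k * (\<bar>real k - 1/2\<bar> / real (Suc k))"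
  by (simp add: tail_coeff_def alt_binom_Suc abs_mult)

lemma tail_coeff_eq: "tail_coeff k = (if k = 0 then 2 else 0) - alt_binom (1/2) k"
  using alt_binom_half_neg by (cases k) (auto simp: tail_coeff_def abs_of_neg)

text \<open>The partial sums of \<open>alt_binom a\<close> are the coefficients \<open>alt_binom (a - 1)\<close>, which are positive for
  \<open>a = 1/2\<close>.\<close>

lemma summable_tail_coeff: "summable tail_coeff"
proof (rule bounded_imp_summable)
  fix n
  have pos: "0 \<le> alt_binom (-1/2) n" for n
    by (induction n) (auto simp: alt_binom_Suc)
  have "(\<Sum>k\<le>n. tail_coeff k) = (\<Sum>k\<le>n. if k = 0 then 2 else 0) - (\<Sum>k\<le>n. ((1/2::real) gchoose k) * (-1) ^ k)"
    unfolding tail_coeff_eq sum_subtractf by (simp add: alt_binom_def mult.commute)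
  also have "\<dots> = 2 - alt_binom (-1/2) n"
    by (simp add: gbinomial_sum_lower_neg alt_binom_def)
  finally show "(\<Sum>k\<le>n. tail_coeff k) \<le> 2" using pos[of n] by simp
qed (simp add: tail_coeff_def)

lemma tail_coeff_sums:
  assumes "0 \<le> z" "z < 1"
  shows "(\<lambda>k. tail_coeff k * z ^ k) sums (2 - (1 - z) powr (1/2))"
proof -
  have "(\<lambda>k. (if k = 0 then 2 else 0) - alt_binom (1/2) k * z ^ k) sums (2 - (1 - z) powr (1/2))"
    using sums_single[of 0 "\<lambda>_. 2::real"] by (intro sums_diff alt_binom_sums assms) simp
  moreover have "tail_coeff k * z ^ k = (if k = 0 then 2 else 0) - alt_binom (1/2) k * z ^ k" for k
    by (simp add: tail_coeff_eq algebra_simps)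
  ultimately show ?thesis by simp
qed

text \<open>The ratio of two consecutive terms has absolute value \<open>|k - a| / (k + 1)\<close>, which decreases in \<open>a\<close> as
  soon as \<open>k \<ge> a\<close>.  Hence the quotient of the two sequences is eventually decreasing.\<close>

lemma alt_binom_le_tail_coeff:
  assumes "a \<ge> 1/2"
  shows "\<exists>C\<ge>0. \<forall>k. \<bar>alt_binom a k\<bar> \<le> C * tail_coeff k"
proof -
  define r where "r = (\<lambda>k. \<bar>alt_binom a k\<bar> / tail_coeff k)"
  define K where "K = Suc (nat \<lceil>a\<rceil>)"
  have K: "a \<le> real K" "1 \<le> real K" unfolding K_def by linarith+
  \<comment> \<open>From index \<open>K\<close> on the quotient decreases, so its maximum is attained among the first \<open>K\<close> terms.\<close>
  have step: "r (Suc k) \<le> r k" if "K \<le> k" for k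
  proof -
    have k: "a \<le> real k" "1 \<le> real k" using K that by linarith+
    have "r (Suc k) = r k * (\<bar>real k - a\<bar> / \<bar>real k - 1/2\<bar>)"
      by (simp add: r_def tail_coeff_Suc alt_binom_Suc abs_mult abs_divide del: of_nat_Suc)
    also have "\<dots> \<le> r k * 1"
      using k assms tail_coeff_pos[of k]
      by (intro mult_left_mono) (auto simp: r_def less_imp_le divide_le_eq_1)
    finally show ?thesis by simp
  qed
  have tail: "r k \<le> r K" if "K \<le> k" for k
    using that by (induction k rule: dec_induct) (auto intro: order_trans step)
  define C where "C = Max (r ` {..K})"
  have rC: "r k \<le> C" for k
  proof (cases "k \<le> K")
    case True then show ?thesis unfolding C_def by (intro Max_ge) auto
  next
    case False
    then have "r k \<le> r K" by (intro tail) simp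
    also have "r K \<le> C" unfolding C_def by (intro Max_ge) auto
    finally show ?thesis .
  qed
  have "\<bar>alt_binom a k\<bar> \<le> C * tail_coeff k" for k
    using tail_coeff_pos[of k] rC[of k] by (simp add: r_def pos_divide_le_eq)
  moreover have "0 \<le> C" using rC[of 0] by (rule order_trans[rotated]) (simp add: r_def tail_coeff_def)
  ultimately show ?thesis by blast
qed

text \<open>The Taylor coefficients of \<open>(1 - z)\<^sup>\<sigma> (2 - (1 - z)\<^bsup>1/2\<^esup>)\<close>.\<close>

definition sing_coeff :: "real \<Rightarrow> nat \<Rightarrow> real" where
  "sing_coeff \<sigma> k = 2 * alt_binom \<sigma> k - alt_binom (\<sigma> + 1/2) k"

lemma sing_coeff_sums:
  assumes "0 \<le> z" "z < 1"
  shows "(\<lambda>k. sing_coeff \<sigma> k * z ^ k) sums ((1 - z) powr \<sigma> * (2 - (1 - z) powr (1/2)))"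
proof -
  have "(\<lambda>k. 2 * (alt_binom \<sigma> k * z ^ k) - alt_binom (\<sigma> + 1/2) k * z ^ k)
      sums (2 * (1 - z) powr \<sigma> - (1 - z) powr (\<sigma> + 1/2))"
    by (intro sums_diff sums_mult alt_binom_sums assms)
  then show ?thesis by (simp add: sing_coeff_def powr_add algebra_simps)
qed

lemma sing_coeff_le_tail_coeff:
  assumes "\<sigma> \<ge> 1/2"
  shows "\<exists>C\<ge>0. \<forall>k. \<bar>sing_coeff \<sigma> k\<bar> \<le> C * tail_coeff k"
proof -
  obtain C D where CD: "0 \<le> C" "\<And>k. \<bar>alt_binom \<sigma> k\<bar> \<le> C * tail_coeff k"
    "0 \<le> D" "\<And>k. \<bar>alt_binom (\<sigma> + 1/2) k\<bar> \<le> D * tail_coeff k"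
    using alt_binom_le_tail_coeff[of \<sigma>] alt_binom_le_tail_coeff[of "\<sigma> + 1/2"] assms by auto
  have "\<bar>sing_coeff \<sigma> k\<bar> \<le> (2 * C + D) * tail_coeff k" for k
  proof -
    have "\<bar>sing_coeff \<sigma> k\<bar> \<le> 2 * \<bar>alt_binom \<sigma> k\<bar> + \<bar>alt_binom (\<sigma> + 1/2) k\<bar>"
      unfolding sing_coeff_def by linarith
    also have "\<dots> \<le> 2 * (C * tail_coeff k) + D * tail_coeff k"
      by (intro add_mono mult_left_mono CD) auto
    finally show ?thesis by (simp add: algebra_simps)
  qed
  with CD show ?thesis
    by (intro exI[of _ "2 * C + D"]) auto
qed

text \<open>The density whose Laplace transform is \<open>z \<Sum> a\<^sub>k z\<^sup>k\<close> with \<open>z = 1/(1+l)\<close>, since the Erlang density of index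
  \<open>k\<close> has transform \<open>z\<^bsup>k+1\<^esup>\<close>.\<close>

definition erlang_series :: "(nat \<Rightarrow> real) \<Rightarrow> real \<Rightarrow> real" where
  "erlang_series a s = (\<Sum>k. a k * erlang_density k 1 s)"

text \<open>One term of the exponential series does not exceed its sum.\<close>

lemma erlang_density_1_le_1: "erlang_density k 1 s \<le> 1"
proof (cases "s < 0")
  case False
  then have "(\<Sum>i\<in>{k}. s ^ i /\<^sub>R fact i) \<le> (\<Sum>i. s ^ i /\<^sub>R fact i)"
    by (intro sum_le_suminf summable_exp_generic) (auto)
  then have "s ^ k / fact k \<le> exp s" by (simp add: exp_def divide_inverse mult.commute)
  then show ?thesis using False by (simp add: erlang_density_def exp_minus field_simps)
qed (simp add: erlang_density_def)

lemma erlang_laplace: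
  assumes "0 \<le> l"
  shows "has_bochner_integral lborel (\<lambda>s. erlang_density k 1 s * exp (- l * s)) ((1 / (1 + l)) ^ Suc k)"
proof -
  have "has_bochner_integral lborel (\<lambda>s. erlang_density k (1 + l) s) 1"
    using nn_integral_erlang_ith_moment[of "1 + l" k 0] assms
    by (intro has_bochner_integral_nn_integral) auto
  then have "has_bochner_integral lborel (\<lambda>s. (1 / (1 + l)) ^ Suc k * erlang_density k (1 + l) s) ((1 / (1 + l)) ^ Suc k * 1)"
    by (rule has_bochner_integral_mult_right)
  moreover have "(1 / (1 + l)) ^ Suc k * erlang_density k (1 + l) s = erlang_density k 1 s * exp (- l * s)" for s
  proof -
    have "(1 / (1 + l)) ^ Suc k * (1 + l) ^ Suc k = 1"
      using assms by (subst power_mult_distrib[symmetric]) simp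
    moreover have "exp (- (1 + l) * s) = exp (- s) * exp (- l * s)"
      by (simp add: mult_exp_exp left_diff_distrib)
    ultimately show ?thesis by (simp add: erlang_density_def mult.assoc del: power_Suc)
  qed
  ultimately show ?thesis by simp
qed

context
  fixes a :: "nat \<Rightarrow> real"
  assumes a: "summable (\<lambda>k. \<bar>a k\<bar>)"
begin

lemma erlang_series_summable: "summable (\<lambda>k. \<bar>a k * erlang_density k 1 s\<bar>)"
  by (rule summable_comparison_test'[OF a, of 0])
     (auto simp: abs_mult intro!: mult_left_le erlang_density_1_le_1)

lemma erlang_series_neg: "s < 0 \<Longrightarrow> erlang_series a s = 0"
  by (simp add: erlang_series_def erlang_density_def)

lemma erlang_series_laplace:
  assumes "0 \<le> l"
  shows "integrable lborel (\<lambda>s. erlang_series a s * exp (- l * \<bar>s\<bar>))"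
    and "(\<lambda>k. a k * (1 / (1 + l)) ^ Suc k) sums mix_laplace lborel (erlang_series a) abs l"
proof -
  let ?f = "\<lambda>k s. a k * (erlang_density k 1 s * exp (- l * s))"
  have hb: "has_bochner_integral lborel (?f k) (a k * (1 / (1 + l)) ^ Suc k)" for k
    by (intro has_bochner_integral_mult_right erlang_laplace assms)
  have eq: "erlang_series a s * exp (- l * \<bar>s\<bar>) = (\<Sum>k. ?f k s)" for s
  proof (cases "s < 0")
    case True then show ?thesis by (simp add: erlang_series_neg) (simp add: erlang_density_def)
  next
    case False
    have "erlang_series a s * exp (- l * s) = (\<Sum>k. (a k * erlang_density k 1 s) * exp (- l * s))"
      unfolding erlang_series_def
      by (rule suminf_mult2[OF summable_rabs_cancel[OF erlang_series_summable]])
    with False show ?thesis by (simp add: mult.assoc)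
  qed
  have norm: "norm (?f k s) \<le> norm (a k * erlang_density k 1 s)" for k s
  proof (cases "s < 0")
    case False
    then have "erlang_density k 1 s * exp (- l * s) \<le> erlang_density k 1 s"
      using assms by (intro mult_left_le) auto
    then show ?thesis by (simp add: abs_mult mult_left_mono)
  qed (simp add: erlang_density_def)
  have z: "0 \<le> 1 / (1 + l)" "1 / (1 + l) \<le> 1" using assms by auto
  have int: "\<And>k. integrable lborel (?f k)" using hb by (auto simp: has_bochner_integral_iff)
  have s1: "AE s in lborel. summable (\<lambda>k. norm (?f k s))"
    using norm by (intro AE_I2 summable_comparison_test'[OF erlang_series_summable, of 0]) auto
  have "(LINT s|lborel. norm (?f k s)) = \<bar>a k\<bar> * (1 / (1 + l)) ^ Suc k" for k
    using erlang_laplace[OF assms, of k] by (simp add: abs_mult has_bochner_integral_iff)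
  moreover have "summable (\<lambda>k. \<bar>a k\<bar> * (1 / (1 + l)) ^ Suc k)"
    using z by (intro summable_comparison_test'[OF a, of 0])
      (auto simp: abs_mult power_le_one simp del: power_Suc intro!: mult_left_le)
  ultimately have s2: "summable (\<lambda>k. LINT s|lborel. norm (?f k s))" by simp
  show "integrable lborel (\<lambda>s. erlang_series a s * exp (- l * \<bar>s\<bar>))"
    unfolding eq by (rule integrable_suminf[OF int s1 s2])
  have "(\<lambda>k. integral\<^sup>L lborel (?f k)) sums (LINT s|lborel. (\<Sum>k. ?f k s))"
    by (rule sums_integral[OF int s1 s2])
  then show "(\<lambda>k. a k * (1 / (1 + l)) ^ Suc k) sums mix_laplace lborel (erlang_series a) abs l"
    using hb unfolding mix_laplace_def eq by (simp add: has_bochner_integral_iff)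
qed

lemma erlang_series_integrable: "integrable lborel (erlang_series a)"
  using erlang_series_laplace(1)[of 0] by simp

end

lemma abs_erlang_series_le:
  assumes b: "summable b" and le: "\<And>k. \<bar>a k\<bar> \<le> b k"
  shows "\<bar>erlang_series a s\<bar> \<le> erlang_series b s"
proof -
  have nn: "0 \<le> b k" for k using le[of k] by linarith
  have sb: "summable (\<lambda>k. \<bar>b k\<bar>)" using b nn by simp
  have sa: "summable (\<lambda>k. \<bar>a k\<bar>)" by (rule summable_comparison_test'[OF b, of 0]) (use le in auto)
  have "\<bar>erlang_series a s\<bar> \<le> (\<Sum>k. \<bar>a k * erlang_density k 1 s\<bar>)"
    unfolding erlang_series_def by (rule summable_rabs[OF erlang_series_summable[OF sa]])
  also have "\<dots> \<le> erlang_series b s"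
    unfolding erlang_series_def
    by (intro suminf_le erlang_series_summable[OF sa] summable_rabs_cancel[OF erlang_series_summable[OF sb]])
       (auto simp: abs_mult le intro!: mult_right_mono)
  finally show ?thesis .
qed

definition gamma_density :: "real \<Rightarrow> real \<Rightarrow> real" where
  "gamma_density \<sigma> s = indicator {0..} s * s powr (\<sigma> - 1) / exp s / Gamma \<sigma>"

lemma gamma_density_nonneg: "\<sigma> > 0 \<Longrightarrow> 0 \<le> gamma_density \<sigma> s"
  by (simp add: gamma_density_def Gamma_real_pos less_imp_le)

text \<open>The substitution \<open>t = (1 + l) s\<close> in the Gamma integral.\<close>

lemma gamma_density_laplace:
  assumes "\<sigma> > 0" "0 \<le> l"
  shows "has_bochner_integral lborel (\<lambda>s. gamma_density \<sigma> s * exp (- l * \<bar>s\<bar>)) ((1 / (1 + l)) powr \<sigma>)"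
proof -
  have "has_bochner_integral lborel (\<lambda>s. indicator {0..} s * s powr (\<sigma> - 1) / exp s) (Gamma \<sigma>)"
    using Gamma_conv_nn_integral_real[OF assms(1)]
    by (intro has_bochner_integral_nn_integral) (auto simp: Gamma_real_pos assms less_imp_le)
  then have "has_bochner_integral lborel
      (\<lambda>s. indicator {0..} (0 + (1 + l) * s) * (0 + (1 + l) * s) powr (\<sigma> - 1) / exp (0 + (1 + l) * s))
      (Gamma \<sigma> /\<^sub>R \<bar>1 + l\<bar>)"
    using assms by (subst (asm) lborel_has_bochner_integral_real_affine_iff[of "1 + l" _ _ 0]) auto
  then have "has_bochner_integral lborel
      (\<lambda>s. (1 + l) powr (1 - \<sigma>) / Gamma \<sigma> * (indicator {0..} (0 + (1 + l) * s) * (0 + (1 + l) * s) powr (\<sigma> - 1) / exp (0 + (1 + l) * s)))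
      ((1 + l) powr (1 - \<sigma>) / Gamma \<sigma> * (Gamma \<sigma> /\<^sub>R \<bar>1 + l\<bar>))"
    by (rule has_bochner_integral_mult_right)
  moreover have "(1 + l) powr (1 - \<sigma>) / Gamma \<sigma> * (Gamma \<sigma> /\<^sub>R \<bar>1 + l\<bar>) = (1 / (1 + l)) powr \<sigma>"
    using assms Gamma_real_pos[of \<sigma>] powr_gt_zero[of "1 + l" \<sigma>]
    by (simp add: powr_diff powr_divide del: powr_gt_zero, simp add: less_le)
  moreover have "(1 + l) powr (1 - \<sigma>) / Gamma \<sigma> * (indicator {0..} (0 + (1 + l) * s) * (0 + (1 + l) * s) powr (\<sigma> - 1) / exp (0 + (1 + l) * s))
      = gamma_density \<sigma> s * exp (- l * \<bar>s\<bar>)" for s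
  proof (cases "s < 0")
    case True
    then show ?thesis using assms by (simp add: gamma_density_def mult_less_0_iff not_le indicator_def)
  next
    case False
    have "(1 + l) powr (1 - \<sigma>) * ((1 + l) * s) powr (\<sigma> - 1) = s powr (\<sigma> - 1)"
      using assms False by (simp add: powr_mult mult.assoc[symmetric] powr_add[symmetric])
    then show ?thesis using False assms
      by (simp add: gamma_density_def indicator_def exp_add exp_minus field_simps)
  qed
  ultimately show ?thesis by (simp only:)
qed

lemma gamma_density_integral: "\<sigma> > 0 \<Longrightarrow> has_bochner_integral lborel (gamma_density \<sigma>) 1"
  using gamma_density_laplace[of \<sigma> 0] by simp

lemma has_bochner_integral_product:
  fixes f :: "'a \<Rightarrow> real" and g :: "'b \<Rightarrow> real"
  assumes "sigma_finite_measure M" "sigma_finite_measure N"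
    and f: "has_bochner_integral M f c" and g: "has_bochner_integral N g d"
  shows "has_bochner_integral (M \<Otimes>\<^sub>M N) (\<lambda>(x, y). f x * g y) (c * d)"
proof -
  interpret pair_sigma_finite M N
    using assms(1,2) by (simp add: pair_sigma_finite_def)
  have [measurable]: "f \<in> borel_measurable M" "g \<in> borel_measurable N"
    using f g by (auto simp: has_bochner_integral_iff)
  have int: "integrable (M \<Otimes>\<^sub>M N) (\<lambda>(x, y). f x * g y)"
    using f g by (intro Fubini_integrable) (auto simp: has_bochner_integral_iff abs_mult)
  moreover have "(\<integral>x. (\<integral>y. (case (x, y) of (x, y) \<Rightarrow> f x * g y) \<partial>N) \<partial>M) = c * d"
    using f g by (simp add: has_bochner_integral_iff)
  ultimately show ?thesis
    using integral_fst'[OF int] by (simp add: has_bochner_integral_iff)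
qed

section \<open>A positive function dominating its fractional Laplacian\<close>

text \<open>The law of the variance of the bump: the sum of two independent variables, one with density
  \<open>erlang_series tail_coeff\<close> and one Gamma distributed with parameter \<open>\<sigma>\<close>.\<close>

definition bump_weight :: "real \<Rightarrow> real \<times> real \<Rightarrow> real" where
  "bump_weight \<sigma> = (\<lambda>(s, t). erlang_series tail_coeff s * gamma_density \<sigma> t)"

definition bump :: "real \<Rightarrow> 'a::euclidean_space \<Rightarrow> real" where
  "bump \<sigma> = gauss_mix (lborel \<Otimes>\<^sub>M lborel) (bump_weight \<sigma>) (\<lambda>(s, t). \<bar>s\<bar> + \<bar>t\<bar>)"

text \<open>The factor \<open>2 powr \<sigma>\<close> accounts for \<open>|\<xi>|\<^bsup>2\<sigma>\<^esup> = (2 l)\<^sup>\<sigma>\<close> when \<open>l = |\<xi>|\<^sup>2/2\<close>.\<close>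

definition lap_weight :: "real \<Rightarrow> real \<Rightarrow> real" where
  "lap_weight \<sigma> s = 2 powr \<sigma> * erlang_series (sing_coeff \<sigma>) s"

definition bump_laplacian :: "real \<Rightarrow> 'a::euclidean_space \<Rightarrow> real" where
  "bump_laplacian \<sigma> = gauss_mix lborel (lap_weight \<sigma>) abs"

lemma summable_abs_tail_coeff: "summable (\<lambda>k. \<bar>tail_coeff k\<bar>)"
  using summable_tail_coeff tail_coeff_pos by (simp add: less_imp_le)

lemma summable_abs_sing_coeff: "\<sigma> \<ge> 1/2 \<Longrightarrow> summable (\<lambda>k. \<bar>sing_coeff \<sigma> k\<bar>)"
proof -
  assume "\<sigma> \<ge> 1/2"
  then obtain C where "\<And>k. \<bar>sing_coeff \<sigma> k\<bar> \<le> C * tail_coeff k"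
    using sing_coeff_le_tail_coeff by blast
  then show ?thesis
    by (intro summable_comparison_test'[OF summable_mult[OF summable_tail_coeff, of C], of 0]) auto
qed

lemma erlang_series_tail_nonneg: "0 \<le> erlang_series tail_coeff s"
  using abs_erlang_series_le[OF summable_tail_coeff, of tail_coeff s] tail_coeff_pos
  by (simp add: less_imp_le)

lemma erlang_series_tail_integral_pos: "0 < (LINT s|lborel. erlang_series tail_coeff s)"
proof -
  have "tail_coeff sums (LINT s|lborel. erlang_series tail_coeff s)"
    using erlang_series_laplace(2)[OF summable_abs_tail_coeff, of 0] by (simp add: mix_laplace_def)
  then show ?thesis
    using suminf_pos[OF summable_tail_coeff tail_coeff_pos] by (simp add: sums_iff)
qed

lemma sigma_finite_plane: "sigma_finite_measure (lborel \<Otimes>\<^sub>M lborel :: (real \<times> real) measure)"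
  by (rule sigma_finite_pair_measure) (rule lborel.sigma_finite_measure_axioms)+

lemma bump_mixing: "\<sigma> > 0 \<Longrightarrow> mixing (lborel \<Otimes>\<^sub>M lborel) (bump_weight \<sigma>) (\<lambda>(s, t). \<bar>s\<bar> + \<bar>t\<bar>)"
proof -
  assume "\<sigma> > 0"
  interpret S: sigma_finite_measure "lborel \<Otimes>\<^sub>M lborel :: (real \<times> real) measure"
    by (rule sigma_finite_plane)
  show ?thesis
  proof
    show "integrable (lborel \<Otimes>\<^sub>M lborel) (bump_weight \<sigma>)"
      using has_bochner_integral_product[OF lborel.sigma_finite_measure_axioms lborel.sigma_finite_measure_axioms
          has_bochner_integral_integrable[OF erlang_series_integrable[OF summable_abs_tail_coeff]]
          gamma_density_integral[OF \<open>\<sigma> > 0\<close>]]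
      by (simp add: bump_weight_def has_bochner_integral_iff)
  qed (auto simp: case_prod_unfold)
qed

lemma lap_mixing: "\<sigma> \<ge> 1/2 \<Longrightarrow> mixing lborel (lap_weight \<sigma>) abs"
  by unfold_locales
     (auto simp: lap_weight_def[abs_def] intro!: integrable_mult_right erlang_series_integrable summable_abs_sing_coeff)

lemma bump_laplace:
  assumes "\<sigma> > 0" "0 \<le> l"
  shows "mix_laplace (lborel \<Otimes>\<^sub>M lborel) (bump_weight \<sigma>) (\<lambda>(s, t). \<bar>s\<bar> + \<bar>t\<bar>) l =
     mix_laplace lborel (erlang_series tail_coeff) abs l * (1 / (1 + l)) powr \<sigma>"
proof -
  have exp_add_split: "exp (- l * (a + b)) = exp (- l * a) * exp (- l * b)" for a b
    by (simp add: mult_exp_exp distrib_left)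
  have "has_bochner_integral (lborel \<Otimes>\<^sub>M lborel)
      (\<lambda>(s, t). (erlang_series tail_coeff s * exp (- l * \<bar>s\<bar>)) * (gamma_density \<sigma> t * exp (- l * \<bar>t\<bar>)))
      (mix_laplace lborel (erlang_series tail_coeff) abs l * (1 / (1 + l)) powr \<sigma>)"
    unfolding mix_laplace_def
    by (intro has_bochner_integral_product lborel.sigma_finite_measure_axioms has_bochner_integral_integrable
        erlang_series_laplace(1) summable_abs_tail_coeff gamma_density_laplace assms)
  moreover have "(\<lambda>(s, t). (erlang_series tail_coeff s * exp (- l * \<bar>s\<bar>)) * (gamma_density \<sigma> t * exp (- l * \<bar>t\<bar>)))
     = (\<lambda>\<omega>. bump_weight \<sigma> \<omega> * exp (- l * (case \<omega> of (s, t) \<Rightarrow> \<bar>s\<bar> + \<bar>t\<bar>)))"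
    by (rule ext) (simp only: split_beta bump_weight_def exp_add_split mult_ac)
  ultimately show ?thesis by (simp add: mix_laplace_def has_bochner_integral_iff)
qed

text \<open>With \<open>z = 1/(1+l)\<close> one has \<open>1 - z = l z\<close>, so \<open>(1 - z)\<^sup>\<sigma> = l\<^sup>\<sigma> z\<^sup>\<sigma>\<close>, and \<open>z\<^sup>\<sigma>\<close> is the transform of the Gamma
  density.  This identity is the reason for the choice of all the densities.\<close>

lemma lap_laplace:
  assumes "\<sigma> \<ge> 1/2" "0 < l"
  shows "mix_laplace lborel (lap_weight \<sigma>) abs l =
     (2 * l) powr \<sigma> * mix_laplace (lborel \<Otimes>\<^sub>M lborel) (bump_weight \<sigma>) (\<lambda>(s, t). \<bar>s\<bar> + \<bar>t\<bar>) l"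
proof -
  define z where "z = 1 / (1 + l)"
  have z: "0 \<le> z" "z < 1" "1 - z = l * z" using assms by (auto simp: z_def field_simps)
  have "(\<lambda>k. z * (tail_coeff k * z ^ k)) sums (z * (2 - (1 - z) powr (1/2)))"
    by (intro sums_mult tail_coeff_sums z)
  moreover have "(\<lambda>k. z * (tail_coeff k * z ^ k)) sums mix_laplace lborel (erlang_series tail_coeff) abs l"
    using erlang_series_laplace(2)[OF summable_abs_tail_coeff, of l] assms by (simp add: z_def mult_ac)
  ultimately have 1: "mix_laplace lborel (erlang_series tail_coeff) abs l = z * (2 - (1 - z) powr (1/2))"
    by (rule sums_unique2[symmetric])
  have "(\<lambda>k. z * (sing_coeff \<sigma> k * z ^ k)) sums (z * ((1 - z) powr \<sigma> * (2 - (1 - z) powr (1/2))))"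
    by (intro sums_mult sing_coeff_sums z)
  moreover have "(\<lambda>k. z * (sing_coeff \<sigma> k * z ^ k)) sums mix_laplace lborel (erlang_series (sing_coeff \<sigma>)) abs l"
    using erlang_series_laplace(2)[OF summable_abs_sing_coeff, of \<sigma> l] assms by (simp add: z_def mult_ac)
  ultimately have 2: "mix_laplace lborel (erlang_series (sing_coeff \<sigma>)) abs l =
      z * ((1 - z) powr \<sigma> * (2 - (1 - z) powr (1/2)))"
    by (rule sums_unique2[symmetric])
  have "mix_laplace lborel (lap_weight \<sigma>) abs l = 2 powr \<sigma> * mix_laplace lborel (erlang_series (sing_coeff \<sigma>)) abs l"
    by (simp add: mix_laplace_def lap_weight_def mult.assoc)
  also have "\<dots> = (2 * l) powr \<sigma> * (z * (2 - (1 - z) powr (1/2)) * z powr \<sigma>)"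
    using z(1) assms unfolding 2 z(3) by (simp add: powr_mult)
  finally show ?thesis
    using assms by (simp add: bump_laplace 1 z_def)
qed

lemma bump_pos:
  assumes "\<sigma> > 0" shows "0 < bump \<sigma> (x::'a::euclidean_space)"
proof -
  interpret mixing "lborel \<Otimes>\<^sub>M lborel" "bump_weight \<sigma>" "\<lambda>(s, t). \<bar>s\<bar> + \<bar>t\<bar>"
    by (rule bump_mixing[OF assms])
  show ?thesis unfolding bump_def
  proof (rule mix_pos)
    show "0 \<le> bump_weight \<sigma> \<omega>" for \<omega>
      using assms by (auto simp: bump_weight_def erlang_series_tail_nonneg gamma_density_nonneg split: prod.split)
    have "(LINT \<omega>|(lborel \<Otimes>\<^sub>M lborel). bump_weight \<sigma> \<omega>) = (LINT s|lborel. erlang_series tail_coeff s)"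
      using bump_laplace[OF assms, of 0] by (simp add: mix_laplace_def)
    then show "0 < (LINT \<omega>|(lborel \<Otimes>\<^sub>M lborel). bump_weight \<sigma> \<omega>)"
      using erlang_series_tail_integral_pos by simp
  qed
qed

text \<open>Domination of the coefficients gives \<open>|bump_laplacian| \<le> C E\<close>, where \<open>E\<close> is the mixture with density
  \<open>erlang_series tail_coeff\<close>.  The bump arises from \<open>E\<close> by adding an independent Gamma variable to the variance,
  and by \<open>gauss_add_ge\<close> this costs at most the factor \<open>c\<close>, the mean of \<open>(1 + t)\<^bsup>-n/2\<^esup>\<close> over that
  variable.\<close>

lemma abs_bump_laplacian_le:
  assumes "\<sigma> \<ge> 1/2"
  shows "\<exists>C\<ge>0. \<forall>x::'a::euclidean_space. \<bar>bump_laplacian \<sigma> x\<bar> \<le> C * bump \<sigma> x"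
proof -
  have \<sigma>: "\<sigma> > 0" using assms by simp
  interpret B: mixing "lborel \<Otimes>\<^sub>M lborel" "bump_weight \<sigma>" "\<lambda>(s, t). \<bar>s\<bar> + \<bar>t\<bar>"
    by (rule bump_mixing[OF \<sigma>])
  interpret L: mixing lborel "lap_weight \<sigma>" abs by (rule lap_mixing[OF assms])
  interpret E: mixing lborel "erlang_series tail_coeff" abs
    by unfold_locales (auto intro: erlang_series_integrable summable_abs_tail_coeff)
  interpret G: mixing lborel "gamma_density \<sigma>" abs
    using gamma_density_integral[OF \<sigma>] by unfold_locales (auto simp: has_bochner_integral_iff)
  obtain C where C: "0 \<le> C" "\<And>k. \<bar>sing_coeff \<sigma> k\<bar> \<le> C * tail_coeff k"
    using sing_coeff_le_tail_coeff[OF assms] by blast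
  define c where "c = gauss_mix lborel (gamma_density \<sigma>) abs (0::'a)"
  have c: "0 < c"
    unfolding c_def using gamma_density_integral[OF \<sigma>] gamma_density_nonneg[OF \<sigma>]
    by (intro G.mix_pos) (auto simp: has_bochner_integral_iff)
  have le1: "\<bar>bump_laplacian \<sigma> x\<bar> \<le> 2 powr \<sigma> * C * gauss_mix lborel (erlang_series tail_coeff) abs x" for x :: 'a
  proof -
    have pt: "\<bar>lap_weight \<sigma> s\<bar> \<le> 2 powr \<sigma> * C * erlang_series tail_coeff s" for s
    proof -
      have "erlang_series (\<lambda>k. C * tail_coeff k) s = C * erlang_series tail_coeff s"
        unfolding erlang_series_def mult.assoc
        by (rule suminf_mult[OF summable_rabs_cancel[OF erlang_series_summable[OF summable_abs_tail_coeff]]])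
      then show ?thesis
        using abs_erlang_series_le[OF summable_mult[OF summable_tail_coeff, of C], of "sing_coeff \<sigma>" s] C(2)
        by (simp add: lap_weight_def abs_mult mult.assoc)
    qed
    have "\<bar>bump_laplacian \<sigma> x\<bar> \<le> (LINT s|lborel. \<bar>lap_weight \<sigma> s * gauss \<bar>s\<bar> x\<bar>)"
      unfolding bump_laplacian_def gauss_mix_def by (rule integral_abs_bound)
    also have "\<dots> \<le> (LINT s|lborel. 2 powr \<sigma> * C * (erlang_series tail_coeff s * gauss \<bar>s\<bar> x))"
    proof (rule integral_mono)
      show "\<bar>lap_weight \<sigma> s * gauss \<bar>s\<bar> x\<bar> \<le> 2 powr \<sigma> * C * (erlang_series tail_coeff s * gauss \<bar>s\<bar> x)" for s
        using mult_right_mono[OF pt[of s], of "gauss \<bar>s\<bar> x"] gauss_pos[of "\<bar>s\<bar>" x]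
        by (simp add: abs_mult mult.assoc)
    qed (intro integrable_abs L.mix_integrand integrable_mult_right E.mix_integrand)+
    finally show ?thesis by (simp add: gauss_mix_def)
  qed
  have le2: "gauss_mix lborel (erlang_series tail_coeff) abs x * c \<le> bump \<sigma> x" for x :: 'a
  proof -
    have hb: "has_bochner_integral (lborel \<Otimes>\<^sub>M lborel)
       (\<lambda>(s, t). (erlang_series tail_coeff s * gauss \<bar>s\<bar> x) * (gamma_density \<sigma> t * gauss \<bar>t\<bar> (0::'a)))
       (gauss_mix lborel (erlang_series tail_coeff) abs x * c)"
      unfolding c_def gauss_mix_def
      by (intro has_bochner_integral_product lborel.sigma_finite_measure_axioms has_bochner_integral_integrable
          E.mix_integrand G.mix_integrand)
    have "gauss_mix lborel (erlang_series tail_coeff) abs x * c =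
       integral\<^sup>L (lborel \<Otimes>\<^sub>M lborel) (\<lambda>(s, t).
          (erlang_series tail_coeff s * gauss \<bar>s\<bar> x) * (gamma_density \<sigma> t * gauss \<bar>t\<bar> (0::'a)))"
      using hb by (simp add: has_bochner_integral_iff)
    also have "\<dots> \<le> bump \<sigma> x"
      unfolding bump_def gauss_mix_def
    proof (rule integral_mono[OF _ B.mix_integrand])
      fix \<omega> :: "real \<times> real"
      obtain s t where \<omega>: "\<omega> = (s, t)" by (cases \<omega>)
      have "gauss \<bar>t\<bar> (0::'a) * gauss \<bar>s\<bar> x \<le> gauss (\<bar>s\<bar> + \<bar>t\<bar>) x"
        using gauss_add_ge[of "\<bar>s\<bar>" "\<bar>t\<bar>" x] by (simp add: gauss_def[of _ 0])
      then have "(erlang_series tail_coeff s * gamma_density \<sigma> t) * (gauss \<bar>t\<bar> (0::'a) * gauss \<bar>s\<bar> x)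
          \<le> (erlang_series tail_coeff s * gamma_density \<sigma> t) * gauss (\<bar>s\<bar> + \<bar>t\<bar>) x"
        using gamma_density_nonneg[OF \<sigma>] erlang_series_tail_nonneg by (intro mult_left_mono) auto
      then show "(case \<omega> of (s, t) \<Rightarrow>
          (erlang_series tail_coeff s * gauss \<bar>s\<bar> x) * (gamma_density \<sigma> t * gauss \<bar>t\<bar> (0::'a)))
          \<le> bump_weight \<sigma> \<omega> * gauss (case \<omega> of (s, t) \<Rightarrow> \<bar>s\<bar> + \<bar>t\<bar>) x"
        by (simp add: \<omega> bump_weight_def mult_ac)
    qed (use hb in \<open>auto simp: has_bochner_integral_iff\<close>)
    finally show ?thesis .
  qed
  have "\<bar>bump_laplacian \<sigma> x\<bar> \<le> (2 powr \<sigma> * C / c) * bump \<sigma> x" for x :: 'a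
  proof -
    have "2 powr \<sigma> * C * gauss_mix lborel (erlang_series tail_coeff) abs x \<le> 2 powr \<sigma> * C * (bump \<sigma> x / c)"
      using le2[of x] c C by (intro mult_left_mono) (auto simp: pos_le_divide_eq)
    with le1[of x] show ?thesis by simp
  qed
  then show ?thesis using C c by (intro exI[of _ "2 powr \<sigma> * C / c"]) auto
qed

section \<open>Smoothness through Fourier synthesis\<close>

text \<open>The amplitudes for which all polynomial moments exist; differentiating the synthesised function
  multiplies the amplitude by a linear factor and stays in this class.\<close>

definition rapid :: "('a::euclidean_space \<Rightarrow> complex) \<Rightarrow> bool" where
  "rapid H \<longleftrightarrow> H \<in> borel_measurable borel \<and> (\<forall>k. integrable lborel (\<lambda>\<xi>. norm \<xi> ^ k * norm (H \<xi>)))"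

text \<open>The factor \<open>r\<close> in the phase makes the class invariant under dilations of the variable \<open>x\<close>.\<close>

definition fourier_synth :: "real \<Rightarrow> ('a::euclidean_space \<Rightarrow> complex) \<Rightarrow> 'a \<Rightarrow> real" where
  "fourier_synth r H x = Re (LINT \<xi>|lborel. cis (r * (x \<bullet> \<xi>)) * H \<xi>)"

lemma rapid_mult:
  assumes H: "rapid H" and [measurable]: "m \<in> borel_measurable borel"
    and le: "\<And>\<xi>. norm (m \<xi>) \<le> C * norm \<xi>"
  shows "rapid (\<lambda>\<xi>. m \<xi> * H \<xi>)"
proof -
  have [measurable]: "H \<in> borel_measurable borel" using H by (simp add: rapid_def)
  have "integrable lborel (\<lambda>\<xi>. norm \<xi> ^ k * norm (m \<xi> * H \<xi>))" for k
  proof (rule Bochner_Integration.integrable_bound)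
    show "integrable lborel (\<lambda>\<xi>. C * (norm \<xi> ^ Suc k * norm (H \<xi>)))"
      using H unfolding rapid_def by (intro integrable_mult_right) blast
    have "norm \<xi> ^ k * norm (m \<xi> * H \<xi>) \<le> C * (norm \<xi> ^ Suc k * norm (H \<xi>))" for \<xi>
    proof -
      have "(norm \<xi> ^ k * norm (H \<xi>)) * norm (m \<xi>) \<le> (norm \<xi> ^ k * norm (H \<xi>)) * (C * norm \<xi>)"
        by (intro mult_left_mono le) auto
      then show ?thesis by (simp add: norm_mult mult_ac)
    qed
    then show "AE \<xi> in lborel. norm (norm \<xi> ^ k * norm (m \<xi> * H \<xi>)) \<le> norm (C * (norm \<xi> ^ Suc k * norm (H \<xi>)))"
      by (intro AE_I2) (simp add: order_trans[OF _ abs_ge_self])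
  qed measurable
  then show ?thesis by (simp add: rapid_def)
qed

lemma rapid_integrable_cis:
  assumes H: "rapid H" and [measurable]: "p \<in> borel_measurable borel"
  shows "integrable lborel (\<lambda>\<xi>. cis (p \<xi>) * H \<xi>)"
proof (rule Bochner_Integration.integrable_bound)
  show "integrable lborel (\<lambda>\<xi>. norm \<xi> ^ 0 * norm (H \<xi>))" using H unfolding rapid_def by blast
  show "(\<lambda>\<xi>. cis (p \<xi>) * H \<xi>) \<in> borel_measurable lborel"
  proof -
    have [measurable]: "H \<in> borel_measurable borel" using H by (simp add: rapid_def)
    show ?thesis by measurable
  qed
qed (auto simp: norm_mult)

lemma cis_taylor: "norm (cis (a + b) - cis a - \<i> * of_real b * cis a) \<le> b\<^sup>2 / 2"
proof -
  have "cis (a + b) - cis a - \<i> * of_real b * cis a = cis a * (cis b - (1 + \<i> * of_real b))"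
    by (simp add: algebra_simps cis_mult)
  also have "norm \<dots> \<le> b\<^sup>2 / 2"
    using iexp_approx1[of b 1] by (simp add: norm_mult cis_conv_exp power2_eq_square)
  finally show ?thesis .
qed

text \<open>The quadratic Taylor bound for \<open>cis\<close> is integrable against the second moment of the amplitude, so
  the remainder is \<open>O(|h|\<^sup>2)\<close>.\<close>

lemma fourier_synth_has_derivative:
  assumes H: "rapid H"
  shows "(fourier_synth r H has_derivative
           (\<lambda>h. fourier_synth r (\<lambda>\<xi>. \<i> * of_real (r * (h \<bullet> \<xi>)) * H \<xi>) x)) (at x)"
proof -
  have [measurable]: "H \<in> borel_measurable borel" using H by (simp add: rapid_def)
  have rH: "rapid (\<lambda>\<xi>. \<i> * of_real (r * (h \<bullet> \<xi>)) * H \<xi>)" for h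
    using Cauchy_Schwarz_ineq2[of h]
    by (intro rapid_mult[OF H, where C = "\<bar>r\<bar> * norm h"])
       (auto simp: norm_mult abs_mult mult.assoc intro!: mult_left_mono)
  let ?D = "\<lambda>h. fourier_synth r (\<lambda>\<xi>. \<i> * of_real (r * (h \<bullet> \<xi>)) * H \<xi>) x"
  define B where "B = (LINT \<xi>|lborel. norm \<xi> ^ 2 * norm (H \<xi>)) * r\<^sup>2 / 2"
  have int2: "integrable lborel (\<lambda>\<xi>. norm \<xi> ^ 2 * norm (H \<xi>))" using H unfolding rapid_def by blast
  have lin: "linear ?D"
  proof (rule linearI)
    show "?D (a + b) = ?D a + ?D b" for a b
      unfolding fourier_synth_def
      by (subst plus_complex.simps(1)[symmetric],
          subst Bochner_Integration.integral_add[OF rapid_integrable_cis[OF rH] rapid_integrable_cis[OF rH], symmetric])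
         (auto simp: algebra_simps intro!: arg_cong[of _ _ Re] Bochner_Integration.integral_cong)
    show "?D (c *\<^sub>R a) = c *\<^sub>R ?D a" for a c
    proof -
      have "(LINT \<xi>|lborel. cis (r * (x \<bullet> \<xi>)) * (\<i> * of_real (r * ((c *\<^sub>R a) \<bullet> \<xi>)) * H \<xi>)) =
         (LINT \<xi>|lborel. of_real c * (cis (r * (x \<bullet> \<xi>)) * (\<i> * of_real (r * (a \<bullet> \<xi>)) * H \<xi>)))"
        by (intro Bochner_Integration.integral_cong) (auto simp: mult_ac)
      then show ?thesis by (simp add: fourier_synth_def)
    qed
  qed
  have quad: "norm (fourier_synth r H (x + h) - fourier_synth r H x - ?D h) \<le> B * (norm h)\<^sup>2" for h
  proof -
    let ?f = "\<lambda>\<xi>. (cis (r * ((x + h) \<bullet> \<xi>)) - cis (r * (x \<bullet> \<xi>)) - \<i> * of_real (r * (h \<bullet> \<xi>)) * cis (r * (x \<bullet> \<xi>))) * H \<xi>"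
    have eq: "?f = (\<lambda>\<xi>. cis (r * ((x + h) \<bullet> \<xi>)) * H \<xi> - cis (r * (x \<bullet> \<xi>)) * H \<xi> - cis (r * (x \<bullet> \<xi>)) * (\<i> * of_real (r * (h \<bullet> \<xi>)) * H \<xi>))"
      by (simp add: fun_eq_iff algebra_simps)
    have i1: "integrable lborel (\<lambda>\<xi>. cis (r * ((x + h) \<bullet> \<xi>)) * H \<xi>)"
      "integrable lborel (\<lambda>\<xi>. cis (r * (x \<bullet> \<xi>)) * H \<xi>)"
      "integrable lborel (\<lambda>\<xi>. cis (r * (x \<bullet> \<xi>)) * (\<i> * of_real (r * (h \<bullet> \<xi>)) * H \<xi>))"
      by (intro rapid_integrable_cis H rH; measurable)+
    have "fourier_synth r H (x + h) - fourier_synth r H x - ?D h = Re (LINT \<xi>|lborel. ?f \<xi>)"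
      unfolding eq fourier_synth_def using i1 by simp
    also have "norm \<dots> \<le> norm (LINT \<xi>|lborel. ?f \<xi>)" by (simp add: abs_Re_le_cmod)
    also have "\<dots> \<le> (LINT \<xi>|lborel. (r\<^sup>2 * (norm h)\<^sup>2 / 2) * (norm \<xi> ^ 2 * norm (H \<xi>)))"
    proof (rule Bochner_Integration.integral_norm_bound_integral)
      show "integrable lborel ?f" unfolding eq using i1 by (intro Bochner_Integration.integrable_diff)
      fix \<xi> :: 'a
      have "norm (?f \<xi>) \<le> (r * (h \<bullet> \<xi>))\<^sup>2 / 2 * norm (H \<xi>)"
        unfolding norm_mult using cis_taylor[of "r * (x \<bullet> \<xi>)" "r * (h \<bullet> \<xi>)"]
        by (intro mult_right_mono) (auto simp: inner_add_left distrib_left)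
      also have "(h \<bullet> \<xi>)\<^sup>2 \<le> (norm h)\<^sup>2 * (norm \<xi>)\<^sup>2"
        using Cauchy_Schwarz_ineq[of h \<xi>] by (simp add: power2_norm_eq_inner)
      then have "(r * (h \<bullet> \<xi>))\<^sup>2 / 2 * norm (H \<xi>) \<le> r\<^sup>2 * ((norm h)\<^sup>2 * (norm \<xi>)\<^sup>2) / 2 * norm (H \<xi>)"
        unfolding power_mult_distrib by (intro mult_right_mono divide_right_mono mult_left_mono) auto
      finally show "norm (?f \<xi>) \<le> (r\<^sup>2 * (norm h)\<^sup>2 / 2) * (norm \<xi> ^ 2 * norm (H \<xi>))"
        by (simp add: mult_ac)
    qed (use int2 in simp)
    also have "\<dots> = B * (norm h)\<^sup>2" by (simp add: B_def)
    finally show ?thesis .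
  qed
  have B: "0 \<le> B" unfolding B_def by (intro divide_nonneg_nonneg mult_nonneg_nonneg integral_nonneg_AE) auto
  show ?thesis
    unfolding has_derivative_at
  proof (intro conjI)
    show "bounded_linear ?D" using lin by (rule linear_conv_bounded_linear[THEN iffD1])
    show "(\<lambda>h. norm (fourier_synth r H (x + h) - fourier_synth r H x - ?D h) / norm h) \<midarrow>0\<rightarrow> 0"
    proof (rule Lim_null_comparison)
      show "\<forall>\<^sub>F h in at 0. norm (norm (fourier_synth r H (x + h) - fourier_synth r H x - ?D h) / norm h) \<le> B * norm h"
        using quad by (intro always_eventually) (simp add: divide_le_eq power2_eq_square mult.assoc B)
      show "((\<lambda>h. B * norm h) \<longlongrightarrow> 0) (at 0)" by (auto intro!: tendsto_eq_intros)
    qed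
  qed
qed

lemma smooth_fourier_synth:
  assumes H: "rapid (H :: 'a::euclidean_space \<Rightarrow> complex)"
  shows "smooth (fourier_synth r H)"
proof -
  have "\<exists>H'. rapid H' \<and> foldr partial_deriv is (fourier_synth r H) = fourier_synth r H'" for "is" :: "'a list"
  proof (induction "is")
    case (Cons i "is")
    then obtain H' where H': "rapid H'" "foldr partial_deriv is (fourier_synth r H) = fourier_synth r H'" by blast
    have "partial_deriv i (fourier_synth r H') = fourier_synth r (\<lambda>\<xi>. \<i> * of_real (r * (i \<bullet> \<xi>)) * H' \<xi>)"
      unfolding partial_deriv_def
      by (intro ext) (subst frechet_derivative_at[symmetric, OF fourier_synth_has_derivative[OF H'(1)]], rule refl)
    moreover have "rapid (\<lambda>\<xi>. \<i> * of_real (r * (i \<bullet> \<xi>)) * H' \<xi>)"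
      using Cauchy_Schwarz_ineq2[of i]
      by (intro rapid_mult[OF H'(1), where C = "\<bar>r\<bar> * norm i"])
         (auto simp: norm_mult abs_mult mult.assoc intro!: mult_left_mono)
    ultimately show ?case using H'(2) by auto
  qed (use H in auto)
  moreover have "fourier_synth r H' differentiable_on UNIV" if "rapid H'" for H' :: "'a \<Rightarrow> complex"
    using fourier_synth_has_derivative[OF that]
    by (auto simp: differentiable_on_def differentiable_def)
  ultimately show ?thesis unfolding smooth_def by metis
qed

section \<open>Integrability, scaling and the L2 Fourier transform\<close>

lemma one_plus_powr_le_exp:
  fixes c s :: real
  assumes "0 < c" "0 \<le> s"
  shows "\<exists>B\<ge>0. \<forall>t\<ge>0. (1 + t) powr s \<le> B * exp (c * t)"
proof (cases "s = 0")
  case True then show ?thesis using assms by (intro exI[of _ "1::real"]) auto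
next
  case False
  \<comment> \<open>\<open>a \<le> 1\<close> gives \<open>1 + t \<le> exp (a t) / a\<close>, and \<open>a s \<le> c\<close> controls the exponent after taking the power.\<close>
  define a where "a = min 1 (c / s)"
  have a: "0 < a" "a \<le> 1" "a * s \<le> c" using assms False by (auto simp: a_def min_def field_simps)
  have "(1 + t) powr s \<le> (1 / a) powr s * exp (c * t)" if t: "0 \<le> t" for t
  proof -
    have "a * (1 + t) \<le> 1 + a * t" using a by (simp add: algebra_simps)
    also have "\<dots> \<le> exp (a * t)" by (rule exp_ge_add_one_self)
    finally have "1 + t \<le> (1 / a) * exp (a * t)" using a by (simp add: field_simps)
    then have "(1 + t) powr s \<le> ((1 / a) * exp (a * t)) powr s"
      using t assms by (intro powr_mono2) auto
    also have "\<dots> = (1 / a) powr s * exp (a * t * s)" using a by (simp add: powr_divide exp_powr_real)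
    also have "\<dots> \<le> (1 / a) powr s * exp (c * t)"
      using mult_right_mono[OF a(3) t] by (intro mult_left_mono) (auto simp: mult_ac)
    finally show ?thesis .
  qed
  then show ?thesis by (intro exI[of _ "(1 / a) powr s"]) auto
qed

lemma gaussian_integrable:
  assumes "0 < c" shows "integrable lborel (\<lambda>x::'a::euclidean_space. exp (- c * (norm x)\<^sup>2))"
proof -
  have "has_bochner_integral lborel (\<lambda>x::'a. complex_of_real (exp (- (norm x)\<^sup>2 / (2 * (1 / (2 * c))))))
     (of_real ((2 * pi * (1 / (2 * c))) powr (real DIM('a) / 2)))"
    using gaussian_fourier[of "1 / (2 * c)" "0::'a"] assms by simp
  then have "integrable lborel (\<lambda>x::'a. exp (- (norm x)\<^sup>2 / (2 * (1 / (2 * c)))))"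
    by (simp add: has_bochner_integral_iff complex_of_real_integrable_eq)
  moreover have "- (norm x)\<^sup>2 / (2 * (1 / (2 * c))) = - c * (norm x)\<^sup>2" for x :: 'a
    using assms by (simp add: field_simps)
  ultimately show ?thesis by (simp only:)
qed

lemma gaussian_bound_rapid:
  assumes [measurable]: "H \<in> borel_measurable borel" and c: "0 < c"
    and le: "\<And>\<xi>::'a::euclidean_space. norm (H \<xi>) \<le> B * exp (- c * (norm \<xi>)\<^sup>2)"
  shows "rapid H"
  unfolding rapid_def
proof (intro conjI allI)
  fix k
  obtain D where D: "0 \<le> D" "\<And>t. 0 \<le> t \<Longrightarrow> (1 + t) powr real k \<le> D * exp (c / 2 * t)"
    using one_plus_powr_le_exp[of "c / 2" "real k"] c by auto
  have B: "0 \<le> B" using order_trans[OF norm_ge_zero le[of 0]] by simp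
  have "norm \<xi> ^ k * norm (H \<xi>) \<le> (D * B) * exp (- (c / 2) * (norm \<xi>)\<^sup>2)" for \<xi> :: 'a
  proof -
    have "0 \<le> (norm \<xi> - 1)\<^sup>2" by simp
    then have "2 * norm \<xi> \<le> 1 + (norm \<xi>)\<^sup>2" by (simp add: power2_eq_square algebra_simps)
    then have "norm \<xi> \<le> 1 + (norm \<xi>)\<^sup>2" using norm_ge_zero[of \<xi>] by linarith
    then have "norm \<xi> ^ k \<le> (1 + (norm \<xi>)\<^sup>2) ^ k" by (intro power_mono) auto
    also have "\<dots> = (1 + (norm \<xi>)\<^sup>2) powr real k" by (intro powr_realpow[symmetric]) (simp add: add_pos_nonneg)
    also have "\<dots> \<le> D * exp (c / 2 * (norm \<xi>)\<^sup>2)" by (rule D(2)) simp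
    finally have "norm \<xi> ^ k * norm (H \<xi>) \<le> (D * exp (c / 2 * (norm \<xi>)\<^sup>2)) * (B * exp (- c * (norm \<xi>)\<^sup>2))"
      by (intro mult_mono le) (auto simp: D B)
    also have "\<dots> = (D * B) * (exp (c / 2 * (norm \<xi>)\<^sup>2) * exp (- c * (norm \<xi>)\<^sup>2))" by simp
    also have "exp (c / 2 * (norm \<xi>)\<^sup>2) * exp (- c * (norm \<xi>)\<^sup>2) = exp (- (c / 2) * (norm \<xi>)\<^sup>2)"
      by (simp add: mult_exp_exp)
    finally show ?thesis .
  qed
  then show "integrable lborel (\<lambda>\<xi>. norm \<xi> ^ k * norm (H \<xi>))"
    using c by (intro Bochner_Integration.integrable_bound[OF integrable_mult_right[OF gaussian_integrable[of "c/2"], of "D * B"]])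
      (auto simp: D B abs_mult)
qed fact

lemma lborel_integral_scale:
  fixes f :: "'a::euclidean_space \<Rightarrow> 'b::{banach, second_countable_topology}"
  assumes [measurable]: "f \<in> borel_measurable borel" and R: "0 < R"
  shows "(LINT x|lborel. f x) = R ^ DIM('a) *\<^sub>R (LINT x|lborel. f (R *\<^sub>R x))"
    and "integrable lborel f \<longleftrightarrow> integrable lborel (\<lambda>x. f (R *\<^sub>R x))"
proof -
  have eq: "lborel = density (distr lborel borel (\<lambda>x::'a. 0 + R *\<^sub>R x)) (\<lambda>_. ennreal (R ^ DIM('a)))"
    using lborel_affine[of R "0::'a"] R by simp
  show "(LINT x|lborel. f x) = R ^ DIM('a) *\<^sub>R (LINT x|lborel. f (R *\<^sub>R x))"
    by (subst eq, subst integral_density) (use R in \<open>auto simp: integral_distr\<close>)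
  show "integrable lborel f \<longleftrightarrow> integrable lborel (\<lambda>x. f (R *\<^sub>R x))"
    by (subst eq, subst integrable_density) (use R integrable_scaleR_right[of "inverse (R ^ DIM('a))" lborel "\<lambda>x. R ^ DIM('a) *\<^sub>R f (R *\<^sub>R x)"]
        in \<open>auto simp: integrable_distr_eq\<close>)
qed

lemma L2_spaceI_bounded:
  fixes f :: "'a::euclidean_space \<Rightarrow> 'b::{banach, second_countable_topology}"
  assumes [measurable]: "f \<in> borel_measurable borel"
    and int: "integrable lborel f" and le: "\<And>x. norm (f x) \<le> B"
  shows "f \<in> L2_space"
proof -
  have "integrable lborel (\<lambda>x. (norm (f x))\<^sup>2)"
  proof (rule Bochner_Integration.integrable_bound)
    show "integrable lborel (\<lambda>x. B * norm (f x))" using int by simp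
    show "AE x in lborel. norm ((norm (f x))\<^sup>2) \<le> norm (B * norm (f x))"
    proof (rule AE_I2)
      fix x
      have "norm (f x) * norm (f x) \<le> B * norm (f x)" by (intro mult_right_mono le) auto
      then show "norm ((norm (f x))\<^sup>2) \<le> norm (B * norm (f x))"
        by (simp add: power2_eq_square order_trans[OF _ abs_ge_self])
    qed
  qed measurable
  then have "integrable lebesgue (\<lambda>x. (norm (f x))\<^sup>2)"
    by (subst integrable_completion) auto
  then show ?thesis by (simp add: L2_space_def measurable_completion)
qed

text \<open>For an integrable function the constant approximating sequence will do.\<close>

lemma has_fourier_L2I:
  fixes f F :: "'a::euclidean_space \<Rightarrow> complex"
  assumes f: "integrable lebesgue f" "f \<in> L2_space" "fourier f \<in> L2_space" "F \<in> L2_space"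
    and eq: "AE \<xi> in lebesgue. fourier f \<xi> = F \<xi>"
  shows "has_fourier_L2 f F"
proof -
  have "(LINT \<xi>|lebesgue. (norm (fourier f \<xi> - F \<xi>))\<^sup>2) = (LINT \<xi>|(lebesgue :: 'a measure). 0)"
  proof (rule Bochner_Integration.integral_cong_AE)
    have [measurable]: "fourier f \<in> borel_measurable lebesgue" "F \<in> borel_measurable lebesgue"
      using f by (auto simp: L2_space_def)
    show "(\<lambda>\<xi>. (norm (fourier f \<xi> - F \<xi>))\<^sup>2) \<in> borel_measurable lebesgue" by measurable
    show "AE \<xi> in lebesgue. (norm (fourier f \<xi> - F \<xi>))\<^sup>2 = 0" using eq by eventually_elim simp
  qed simp
  then show ?thesis
    unfolding has_fourier_L2_def
    by (intro conjI exI[of _ "\<lambda>_. f"]) (use f in \<open>auto simp: L2_norm_def\<close>)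
qed

section \<open>Dilates of the bump as test functions\<close>

text \<open>The Fourier transform of \<open>gauss_mix M w \<tau>\<close>.\<close>

definition mix_symbol :: "'b measure \<Rightarrow> ('b \<Rightarrow> real) \<Rightarrow> ('b \<Rightarrow> real) \<Rightarrow> 'a::euclidean_space \<Rightarrow> real" where
  "mix_symbol M w \<tau> \<xi> = exp (- ((norm \<xi>)\<^sup>2 / 2)) * mix_laplace M w \<tau> ((norm \<xi>)\<^sup>2 / 2)"

lemma gaussian_bound_L2:
  fixes F :: "'a::euclidean_space \<Rightarrow> complex"
  assumes [measurable]: "F \<in> borel_measurable borel" and c: "0 < c" "0 \<le> B"
    and le: "\<And>\<xi>. norm (F \<xi>) \<le> B * exp (- c * (norm \<xi>)\<^sup>2)"
  shows "F \<in> L2_space"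
proof (rule L2_spaceI_bounded)
  show "integrable lborel F"
    by (rule Bochner_Integration.integrable_bound[OF integrable_mult_right[OF gaussian_integrable[OF c(1)], of B]])
       (use le c in \<open>auto simp: abs_mult\<close>)
  show "norm (F \<xi>) \<le> B * 1" for \<xi>
    using c by (intro order_trans[OF le] mult_left_mono) auto
qed measurable

lemma fourier_mult:
  "fourier (\<lambda>x. of_real (c * f x)) \<xi> = of_real c * fourier (\<lambda>x. of_real (f x)) \<xi>"
proof -
  have "(LINT x|lebesgue. cis (- (x \<bullet> \<xi>)) * of_real (c * f x)) =
     (LINT x|lebesgue. of_real c * (cis (- (x \<bullet> \<xi>)) * of_real (f x)))"
    by (intro Bochner_Integration.integral_cong) auto
  then show ?thesis by (simp add: fourier_def)
qed

context mixing
begin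

lemma symbol_meas [measurable]: "(mix_symbol M w \<tau> :: 'a::euclidean_space \<Rightarrow> real) \<in> borel_measurable borel"
  unfolding mix_symbol_def by measurable

lemma abs_symbol_le:
  "\<bar>mix_symbol M w \<tau> (\<xi>::'a::euclidean_space)\<bar> \<le> (LINT \<omega>|M. \<bar>w \<omega>\<bar>) * exp (- (1/2) * (norm \<xi>)\<^sup>2)"
  using abs_laplace_le[of "(norm \<xi>)\<^sup>2 / 2"]
  by (simp add: mix_symbol_def abs_mult mult.commute mult_left_mono)

lemma smooth_mix_scaled:
  assumes R: "0 < R"
  shows "smooth (\<lambda>x::'a::euclidean_space. gauss_mix M w \<tau> (x /\<^sub>R R))"
proof -
  define c where "c = (2 * pi) powr (real DIM('a) / 2)"
  have c: "0 < c" by (simp add: c_def)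
  have "gauss_mix M w \<tau> (x /\<^sub>R R) = fourier_synth (1 / R) (\<lambda>\<xi>. of_real (mix_symbol M w \<tau> \<xi> / c)) x" for x :: 'a
  proof -
    have "(LINT \<xi>|lborel. cis (1 / R * (x \<bullet> \<xi>)) * complex_of_real (mix_symbol M w \<tau> \<xi> / c)) =
        (LINT \<xi>|lborel. cis ((x /\<^sub>R R) \<bullet> \<xi>) * of_real (exp (- ((norm \<xi>)\<^sup>2 / 2)) * mix_laplace M w \<tau> ((norm \<xi>)\<^sup>2 / 2)) / of_real c)"
      by (intro Bochner_Integration.integral_cong refl) (simp only: mix_symbol_def
          inner_scaleR_left divide_inverse mult_1_left of_real_mult of_real_inverse mult.assoc)
    also have "\<dots> = of_real (c * gauss_mix M w \<tau> (x /\<^sub>R R)) / of_real c"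
      by (subst integral_divide_zero) (simp only: mix_inversion[symmetric] c_def)
    finally show ?thesis using c by (simp add: fourier_synth_def)
  qed
  moreover have "smooth (fourier_synth (1 / R) (\<lambda>\<xi>::'a. of_real (mix_symbol M w \<tau> \<xi> / c)))"
  proof (rule smooth_fourier_synth, rule gaussian_bound_rapid)
    show "norm (complex_of_real (mix_symbol M w \<tau> \<xi> / c)) \<le> (LINT \<omega>|M. \<bar>w \<omega>\<bar>) / c * exp (- (1/2) * (norm \<xi>)\<^sup>2)" for \<xi> :: 'a
      using divide_right_mono[OF abs_symbol_le[of \<xi>], of c] c by (simp add: abs_divide del: of_real_divide)
  qed (auto simp: c_def[symmetric])
  ultimately show ?thesis by presburger
qed

lemma mix_scaled_integrable:
  assumes R: "0 < R"
  shows "integrable lborel (\<lambda>x::'a::euclidean_space. gauss_mix M w \<tau> (x /\<^sub>R R))"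
  using lborel_integral_scale(2)[of "gauss_mix M w \<tau> :: 'a \<Rightarrow> real" "inverse R"]
    mix_integrable[where 'a = 'a] R by simp

lemma mix_scaled_L2:
  assumes R: "0 < R"
  shows "(\<lambda>x::'a::euclidean_space. complex_of_real (c * gauss_mix M w \<tau> (x /\<^sub>R R))) \<in> L2_space"
proof (rule L2_spaceI_bounded)
  show "integrable lborel (\<lambda>x::'a. complex_of_real (c * gauss_mix M w \<tau> (x /\<^sub>R R)))"
    by (intro integrable_of_real integrable_mult_right mix_scaled_integrable R)
  show "norm (complex_of_real (c * gauss_mix M w \<tau> (x /\<^sub>R R))) \<le> \<bar>c\<bar> * (LINT \<omega>|M. \<bar>w \<omega>\<bar>)" for x :: 'a
    using mult_left_mono[OF abs_mix_le[of "x /\<^sub>R R"], of "\<bar>c\<bar>"] by (simp add: norm_mult)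
qed measurable

lemma mix_scaled_fourier:
  assumes R: "0 < R"
  shows "fourier (\<lambda>x::'a::euclidean_space. of_real (gauss_mix M w \<tau> (x /\<^sub>R R))) \<xi> =
     of_real (R ^ DIM('a) * mix_symbol M w \<tau> (R *\<^sub>R \<xi>))"
proof -
  define c where "c = (2 * pi) powr (real DIM('a) / 2)"
  have c: "0 < c" by (simp add: c_def)
  have "(LINT x|lebesgue. cis (- (x \<bullet> \<xi>)) * complex_of_real (gauss_mix M w \<tau> (x /\<^sub>R R))) =
      (LINT x|lborel. cis (- (x \<bullet> \<xi>)) * complex_of_real (gauss_mix M w \<tau> (x /\<^sub>R R)))"
    by (rule integral_completion) measurable
  also have "\<dots> = R ^ DIM('a) *\<^sub>R (LINT x|lborel. cis (- ((R *\<^sub>R x) \<bullet> \<xi>)) * complex_of_real (gauss_mix M w \<tau> ((R *\<^sub>R x) /\<^sub>R R)))"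
    by (rule lborel_integral_scale(1)[OF _ R]) measurable
  also have "\<dots> = R ^ DIM('a) *\<^sub>R (LINT x|lborel. cis (- (x \<bullet> (R *\<^sub>R \<xi>))) * complex_of_real (gauss_mix M w \<tau> x))"
    using R by simp
  also have "\<dots> = R ^ DIM('a) *\<^sub>R of_real (c * mix_symbol M w \<tau> (R *\<^sub>R \<xi>))"
    unfolding mix_fourier mix_symbol_def c_def ..
  finally show ?thesis
    using c unfolding fourier_def
    by (simp add: c_def powr_minus scaleR_conv_of_real)
qed

lemma mix_scaled_fourier_bound:
  assumes R: "0 < R"
  shows "norm (fourier (\<lambda>x::'a::euclidean_space. of_real (c * gauss_mix M w \<tau> (x /\<^sub>R R))) \<xi>) \<le>
     \<bar>c\<bar> * (R ^ DIM('a) * (LINT \<omega>|M. \<bar>w \<omega>\<bar>)) * exp (- (R\<^sup>2 / 2) * (norm \<xi>)\<^sup>2)"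
proof -
  have "\<bar>c\<bar> * (R ^ DIM('a) * \<bar>mix_symbol M w \<tau> (R *\<^sub>R \<xi>)\<bar>) \<le>
     \<bar>c\<bar> * (R ^ DIM('a) * ((LINT \<omega>|M. \<bar>w \<omega>\<bar>) * exp (- (1/2) * (norm (R *\<^sub>R \<xi>))\<^sup>2)))"
    using R by (intro mult_left_mono abs_symbol_le) auto
  then show ?thesis
    unfolding fourier_mult mix_scaled_fourier[OF R] using R
    by (simp add: norm_mult abs_mult norm_power power_mult_distrib mult.assoc)
qed

lemma mix_scaled_fourier_meas [measurable]:
  assumes R: "0 < R"
  shows "fourier (\<lambda>x::'a::euclidean_space. of_real (c * gauss_mix M w \<tau> (x /\<^sub>R R))) \<in> borel_measurable borel"
proof -
  have "fourier (\<lambda>x::'a. of_real (c * gauss_mix M w \<tau> (x /\<^sub>R R))) =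
    (\<lambda>\<xi>. of_real c * of_real (R ^ DIM('a) * mix_symbol M w \<tau> (R *\<^sub>R \<xi>)))"
    by (intro ext) (simp only: fourier_mult mix_scaled_fourier[OF R])
  then show ?thesis by simp
qed

lemma mix_scaled_fourier_L2:
  assumes R: "0 < R"
  shows "fourier (\<lambda>x::'a::euclidean_space. of_real (c * gauss_mix M w \<tau> (x /\<^sub>R R))) \<in> L2_space"
  by (rule gaussian_bound_L2[OF mix_scaled_fourier_meas[OF R] _ _ mix_scaled_fourier_bound[OF R]])
     (use R in auto)

text \<open>The origin is exempt because the comparison of \<open>lap_laplace\<close> is made for \<open>l > 0\<close>; it is a null set.\<close>

lemma mix_scaled_has_fourier:
  assumes R: "0 < R" and F: "F \<in> borel_measurable borel"
    "\<And>\<xi>. \<xi> \<noteq> 0 \<Longrightarrow> F \<xi> = fourier (\<lambda>x::'a::euclidean_space. of_real (c * gauss_mix M w \<tau> (x /\<^sub>R R))) \<xi>"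
  shows "has_fourier_L2 (\<lambda>x. of_real (c * gauss_mix M w \<tau> (x /\<^sub>R R))) F"
proof -
  let ?F = "fourier (\<lambda>x::'a. complex_of_real (c * gauss_mix M w \<tau> (x /\<^sub>R R)))"
  have [measurable]: "F \<in> borel_measurable borel" by fact
  have [measurable]: "?F \<in> borel_measurable borel" by (rule mix_scaled_fourier_meas[OF R])
  have "AE \<xi>::'a in lebesgue. \<xi> \<noteq> 0"
    by (rule AE_completion) (rule AE_lborel_singleton)
  then have eq: "AE \<xi> in lebesgue. ?F \<xi> = F \<xi>" by eventually_elim (simp add: F)
  have "F \<in> L2_space"
  proof -
    have "integrable lebesgue (\<lambda>\<xi>. (norm (?F \<xi>))\<^sup>2)"
      using mix_scaled_fourier_L2[OF R, of c, where 'a = 'a] by (simp add: L2_space_def)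
    then have "integrable lebesgue (\<lambda>\<xi>. (norm (F \<xi>))\<^sup>2)"
      by (rule integrable_cong_AE_imp) (use eq in \<open>auto simp: measurable_completion\<close>)
    then show ?thesis by (simp add: L2_space_def measurable_completion)
  qed
  moreover have "integrable lebesgue (\<lambda>x::'a. complex_of_real (c * gauss_mix M w \<tau> (x /\<^sub>R R)))"
  proof (subst integrable_completion)
    show "integrable lborel (\<lambda>x::'a. complex_of_real (c * gauss_mix M w \<tau> (x /\<^sub>R R)))"
      by (intro integrable_of_real integrable_mult_right mix_scaled_integrable R)
  qed measurable
  ultimately show ?thesis
    by (intro has_fourier_L2I mix_scaled_L2 mix_scaled_fourier_L2 R eq)
qed

end

lemma bump_symbol:
  fixes \<xi> :: "'a::euclidean_space"
  assumes "\<sigma> \<ge> 1/2" "\<xi> \<noteq> 0"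
  shows "mix_symbol lborel (lap_weight \<sigma>) abs \<xi> =
    norm \<xi> powr (2 * \<sigma>) * mix_symbol (lborel \<Otimes>\<^sub>M lborel) (bump_weight \<sigma>) (\<lambda>(s, t). \<bar>s\<bar> + \<bar>t\<bar>) \<xi>"
proof -
  have "(2 * ((norm \<xi>)\<^sup>2 / 2)) powr \<sigma> = norm \<xi> powr (2 * \<sigma>)"
    using assms by (simp add: powr_powr[symmetric] powr_numeral)
  then show ?thesis
    using lap_laplace[of \<sigma> "(norm \<xi>)\<^sup>2 / 2"] assms by (simp add: mix_symbol_def)
qed

lemma bump_scaled_frac_laplacian:
  assumes \<sigma>: "\<sigma> \<ge> 1/2" and R: "0 < R"
  shows "has_frac_laplacian \<sigma> (\<lambda>x::'a::euclidean_space. bump \<sigma> (x /\<^sub>R R))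
           (\<lambda>x. R powr (- 2 * \<sigma>) * bump_laplacian \<sigma> (x /\<^sub>R R))"
proof -
  interpret B: mixing "lborel \<Otimes>\<^sub>M lborel" "bump_weight \<sigma>" "\<lambda>(s, t). \<bar>s\<bar> + \<bar>t\<bar>"
    using \<sigma> by (intro bump_mixing) simp
  interpret L: mixing lborel "lap_weight \<sigma>" abs by (rule lap_mixing[OF \<sigma>])
  let ?F = "fourier (\<lambda>x::'a. complex_of_real (1 * bump \<sigma> (x /\<^sub>R R)))"
  have [measurable]: "?F \<in> borel_measurable borel"
    unfolding bump_def by (rule B.mix_scaled_fourier_meas[OF R])
  have "has_fourier_L2 (\<lambda>x::'a. complex_of_real (1 * bump \<sigma> (x /\<^sub>R R))) ?F"
    unfolding bump_def by (intro B.mix_scaled_has_fourier[OF R] B.mix_scaled_fourier_meas[OF R] refl)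
  moreover have "has_fourier_L2 (\<lambda>x::'a. complex_of_real (R powr (- 2 * \<sigma>) * bump_laplacian \<sigma> (x /\<^sub>R R)))
      (\<lambda>\<xi>. of_real (norm \<xi> powr (2 * \<sigma>)) * ?F \<xi>)"
    unfolding bump_laplacian_def
  proof (rule L.mix_scaled_has_fourier[OF R])
    fix \<xi> :: 'a assume \<xi>: "\<xi> \<noteq> 0"
    have "mix_symbol lborel (lap_weight \<sigma>) abs (R *\<^sub>R \<xi>) = norm (R *\<^sub>R \<xi>) powr (2 * \<sigma>) *
        mix_symbol (lborel \<Otimes>\<^sub>M lborel) (bump_weight \<sigma>) (\<lambda>(s, t). \<bar>s\<bar> + \<bar>t\<bar>) (R *\<^sub>R \<xi>)"
      using \<sigma> \<xi> R by (intro bump_symbol) auto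
    moreover have "R powr (- 2 * \<sigma>) * norm (R *\<^sub>R \<xi>) powr (2 * \<sigma>) = norm \<xi> powr (2 * \<sigma>)"
      using R by (simp add: powr_mult powr_minus)
    ultimately have "R powr (- 2 * \<sigma>) * mix_symbol lborel (lap_weight \<sigma>) abs (R *\<^sub>R \<xi>) = norm \<xi> powr (2 * \<sigma>) *
        mix_symbol (lborel \<Otimes>\<^sub>M lborel) (bump_weight \<sigma>) (\<lambda>(s, t). \<bar>s\<bar> + \<bar>t\<bar>) (R *\<^sub>R \<xi>)"
      by (simp only: mult.assoc[symmetric])
    then show "of_real (norm \<xi> powr (2 * \<sigma>)) * ?F \<xi> =
      fourier (\<lambda>x::'a. complex_of_real (R powr (- 2 * \<sigma>) * gauss_mix lborel (lap_weight \<sigma>) abs (x /\<^sub>R R))) \<xi>"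
      unfolding fourier_mult bump_def B.mix_scaled_fourier[OF R] L.mix_scaled_fourier[OF R] of_real_mult[symmetric] of_real_1 mult_1
      by (simp only: mult.left_commute)
  qed measurable
  ultimately show ?thesis
    unfolding has_frac_laplacian_def by (intro exI[of _ ?F]) simp
qed

lemma bump_scaled_sobolev:
  assumes \<sigma>: "\<sigma> \<ge> 1/2" and R: "0 < R"
  shows "(\<lambda>x::'a::euclidean_space. bump \<sigma> (x /\<^sub>R R)) \<in> sobolev_space (2 * \<sigma>)"
proof -
  interpret B: mixing "lborel \<Otimes>\<^sub>M lborel" "bump_weight \<sigma>" "\<lambda>(s, t). \<bar>s\<bar> + \<bar>t\<bar>"
    using \<sigma> by (intro bump_mixing) simp
  let ?F = "fourier (\<lambda>x::'a. complex_of_real (1 * bump \<sigma> (x /\<^sub>R R)))"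
  have [measurable]: "?F \<in> borel_measurable borel"
    unfolding bump_def by (rule B.mix_scaled_fourier_meas[OF R])
  have F: "has_fourier_L2 (\<lambda>x::'a. complex_of_real (1 * bump \<sigma> (x /\<^sub>R R))) ?F"
    unfolding bump_def by (intro B.mix_scaled_has_fourier[OF R] B.mix_scaled_fourier_meas[OF R] refl)
  define A where "A = R ^ DIM('a) * (LINT \<omega>|(lborel \<Otimes>\<^sub>M lborel). \<bar>bump_weight \<sigma> \<omega>\<bar>)"
  have A: "0 \<le> A" using R by (simp add: A_def)
  have le: "norm (?F \<xi>) \<le> A * exp (- (R\<^sup>2 / 2) * (norm \<xi>)\<^sup>2)" for \<xi>
    using B.mix_scaled_fourier_bound[OF R, of 1 \<xi>] by (simp add: bump_def A_def)
  obtain D where D: "0 \<le> D" "\<And>t. 0 \<le> t \<Longrightarrow> (1 + t) powr \<sigma> \<le> D * exp (R\<^sup>2 / 4 * t)"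
    using one_plus_powr_le_exp[of "R\<^sup>2 / 4" \<sigma>] R \<sigma> by auto
  have "(\<lambda>\<xi>. of_real ((1 + (norm \<xi>)\<^sup>2) powr \<sigma>) * ?F \<xi>) \<in> L2_space"
  proof (rule gaussian_bound_L2)
    fix \<xi> :: 'a
    have "norm (of_real ((1 + (norm \<xi>)\<^sup>2) powr \<sigma>) * ?F \<xi>) \<le>
        (D * exp (R\<^sup>2 / 4 * (norm \<xi>)\<^sup>2)) * (A * exp (- (R\<^sup>2 / 2) * (norm \<xi>)\<^sup>2))"
      unfolding norm_mult using D(2)[of "(norm \<xi>)\<^sup>2"] D(1) by (intro mult_mono le) auto
    also have "\<dots> = (D * A) * (exp (R\<^sup>2 / 4 * (norm \<xi>)\<^sup>2) * exp (- (R\<^sup>2 / 2) * (norm \<xi>)\<^sup>2))" by simp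
    also have "exp (R\<^sup>2 / 4 * (norm \<xi>)\<^sup>2) * exp (- (R\<^sup>2 / 2) * (norm \<xi>)\<^sup>2) = exp (- (R\<^sup>2 / 4) * (norm \<xi>)\<^sup>2)"
      by (simp add: mult_exp_exp)
    finally show "norm (of_real ((1 + (norm \<xi>)\<^sup>2) powr \<sigma>) * ?F \<xi>) \<le> (D * A) * exp (- (R\<^sup>2 / 4) * (norm \<xi>)\<^sup>2)" .
    show "(\<lambda>\<xi>. of_real ((1 + (norm \<xi>)\<^sup>2) powr \<sigma>) * ?F \<xi>) \<in> borel_measurable borel"
      by measurable
  qed (use R D A in auto)
  then have "(\<lambda>\<xi>. of_real ((1 + (norm \<xi>)\<^sup>2) powr (2 * \<sigma> / 2)) * ?F \<xi>) \<in> L2_space" by simp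
  then show ?thesis
    using F unfolding sobolev_space_def mult_1 by blast
qed

section \<open>A flat cutoff in time\<close>

text \<open>Each additional power of \<open>y\<close> is paid for with half of the remaining exponential rate.\<close>

lemma poly_exp_bounded:
  fixes P :: "real poly"
  assumes "0 < a"
  shows "\<exists>B\<ge>0. \<forall>y\<ge>0. \<bar>poly P y\<bar> * exp (- a * y) \<le> B"
  using assms
proof (induction P arbitrary: a)
  case 0 then show ?case by (auto intro: exI[of _ 0])
next
  case (pCons c P)
  obtain B where B: "0 \<le> B" "\<And>y. 0 \<le> y \<Longrightarrow> \<bar>poly P y\<bar> * exp (- (a/2) * y) \<le> B"
    using pCons.IH[of "a / 2"] pCons.prems by auto
  have "\<bar>poly (pCons c P) y\<bar> * exp (- a * y) \<le> \<bar>c\<bar> + 2 / a * B" if y: "0 \<le> y" for y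
  proof -
    have "(a / 2) * y \<le> exp ((a / 2) * y)" using exp_ge_add_one_self[of "(a/2) * y"] by linarith
    then have "(y * (a / 2)) * exp (- (a / 2) * y) \<le> exp ((a / 2) * y) * exp (- (a / 2) * y)"
      by (intro mult_right_mono) (auto simp: mult.commute)
    then have ye: "y * exp (- (a / 2) * y) \<le> 2 / a"
      using pCons.prems by (simp add: mult_exp_exp field_simps)
    have "exp (- a * y) = exp (- (a / 2) * y) * exp (- (a / 2) * y)" by (simp add: mult_exp_exp)
    then have "\<bar>y * poly P y\<bar> * exp (- a * y) =
       (y * exp (- (a / 2) * y)) * (\<bar>poly P y\<bar> * exp (- (a / 2) * y))"
      using y by (simp add: abs_mult)
    also have "\<dots> \<le> 2 / a * B"
      using y pCons.prems by (intro mult_mono ye B(2)) auto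
    finally have 1: "\<bar>y * poly P y\<bar> * exp (- a * y) \<le> 2 / a * B" .
    have "\<bar>c\<bar> * exp (- a * y) \<le> \<bar>c\<bar> * 1"
      using y pCons.prems by (intro mult_left_mono) auto
    moreover have "\<bar>c + y * poly P y\<bar> * exp (- a * y) \<le> (\<bar>c\<bar> + \<bar>y * poly P y\<bar>) * exp (- a * y)"
      by (intro mult_right_mono abs_triangle_ineq) auto
    ultimately show ?thesis using 1 by (simp add: distrib_right)
  qed
  then show ?case using B pCons.prems by (intro exI[of _ "\<bar>c\<bar> + 2 / a * B"]) auto
qed

text \<open>A polynomial in \<open>y = 1/(1 - t/T)\<close> times \<open>exp (t/T - y)\<close>, extended by zero beyond \<open>T\<close>.  The exponential
  beats every power of \<open>y\<close>, so all derivatives vanish at \<open>T\<close>; the summand \<open>t/T\<close> makes the first derivative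
  of the exponential vanish at \<open>0\<close> as well, as \<open>time_deriv \<eta> 0 = 0\<close> demands.\<close>

definition flat :: "real \<Rightarrow> real poly \<Rightarrow> real \<Rightarrow> real" where
  "flat T Q t = (if t < T then poly Q (1 / (1 - t / T)) * exp (t / T - 1 / (1 - t / T)) else 0)"

text \<open>Since \<open>T y' = y\<^sup>2\<close>, differentiating \<open>Q(y) exp (t/T - y)\<close> replaces \<open>Q\<close> by \<open>(Q' y\<^sup>2 + Q (1 - y\<^sup>2)) / T\<close>.\<close>

definition flat_deriv :: "real poly \<Rightarrow> real poly" where
  "flat_deriv Q = pderiv Q * [:0, 0, 1:] + Q * [:1, 0, -1:]"

lemma flat_smult: "flat T (smult c Q) t = c * flat T Q t"
  by (simp add: flat_def)

lemma flat_deriv_smult: "flat_deriv (smult c Q) = smult c (flat_deriv Q)"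
  by (simp add: flat_deriv_def pderiv_smult smult_add_right)

lemma flat_has_derivative:
  assumes T: "0 < T"
  shows "(flat T Q has_real_derivative flat T (smult (1 / T) (flat_deriv Q)) t) (at t)"
proof -
  consider "t < T" | "t = T" | "T < t" by linarith
  then show ?thesis
  proof cases
    case 1
    define y where "y = (\<lambda>t. 1 / (1 - t / T))"
    have ne: "1 - t / T \<noteq> 0" using 1 T by (simp add: field_simps)
    have dy: "(y has_real_derivative (1 / T) * (y t)\<^sup>2) (at t)"
      unfolding y_def using ne
      by (auto intro!: derivative_eq_intros simp: power2_eq_square field_simps)
    have "((\<lambda>t. poly Q (y t) * exp (t / T - y t)) has_real_derivative
        poly (pderiv Q) (y t) * ((1 / T) * (y t)\<^sup>2) * exp (t / T - y t) +
        exp (t / T - y t) * (1 / T - (1 / T) * (y t)\<^sup>2) * poly Q (y t)) (at t)"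
      by (intro DERIV_mult DERIV_chain2[OF poly_DERIV dy] DERIV_fun_exp DERIV_diff dy DERIV_cdivide DERIV_ident)
    also have "poly (pderiv Q) (y t) * ((1 / T) * (y t)\<^sup>2) * exp (t / T - y t) +
        exp (t / T - y t) * (1 / T - (1 / T) * (y t)\<^sup>2) * poly Q (y t) =
        flat T (smult (1 / T) (flat_deriv Q)) t"
    proof -
      have "flat T (smult (1 / T) (flat_deriv Q)) t = (1 / T) * poly (flat_deriv Q) (y t) * exp (t / T - y t)"
        using 1 by (simp add: flat_def y_def)
      also have "poly (flat_deriv Q) (y t) = poly (pderiv Q) (y t) * (y t)\<^sup>2 + poly Q (y t) * (1 - (y t)\<^sup>2)"
        by (simp add: flat_deriv_def power2_eq_square algebra_simps)
      finally show ?thesis by (simp add: algebra_simps)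
    qed
    finally show ?thesis
      by (rule DERIV_cong_ev[THEN iffD1, rotated -1])
         (use 1 in \<open>auto simp: flat_def y_def intro: eventually_mono[OF eventually_nhds_in_open[of "{..<T}"]]\<close>)
  next
    case 3
    have "((\<lambda>_. 0) has_real_derivative flat T (smult (1 / T) (flat_deriv Q)) t) (at t)"
      using 3 by (simp add: flat_def)
    then show ?thesis
      by (rule DERIV_cong_ev[THEN iffD1, rotated -1])
         (use 3 in \<open>auto simp: flat_def intro: eventually_mono[OF eventually_nhds_in_open[of "{T<..}"]]\<close>)
  next
    case 2
    obtain B where B: "0 \<le> B" "\<And>y. 0 \<le> y \<Longrightarrow> \<bar>poly (Q * [:0, 0, 1:]) y\<bar> * exp (- 1 * y) \<le> B"
      using poly_exp_bounded[of 1 "Q * [:0, 0, 1:]"] by auto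
    \<comment> \<open>A bound quadratic in \<open>h\<close> at the end point, where \<open>h = - T/y\<close>, gives derivative zero there.\<close>
    have quad: "\<bar>flat T Q (T + h)\<bar> \<le> (exp 1 * B / T\<^sup>2) * h\<^sup>2" for h
    proof (cases "h < 0")
      case True
      define y where "y = T / (- h)"
      have y: "0 < y" "1 / (1 - (T + h) / T) = y" "h\<^sup>2 * y\<^sup>2 = T\<^sup>2"
        using T True by (auto simp: y_def field_simps power2_eq_square)
      have "\<bar>flat T Q (T + h)\<bar> = \<bar>poly Q y\<bar> * exp ((T + h) / T - y)"
        using True by (simp add: flat_def y abs_mult)
      also have "\<dots> \<le> \<bar>poly Q y\<bar> * exp (1 - y)"
        using True T by (intro mult_left_mono) (auto simp: field_simps)
      also have "\<dots> = exp 1 * (\<bar>poly (Q * [:0, 0, 1:]) y\<bar> * exp (- 1 * y)) / y\<^sup>2"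
        using y(1) by (simp add: abs_mult power2_eq_square exp_diff exp_minus field_simps)
      also have "\<dots> \<le> exp 1 * B / y\<^sup>2"
        using y(1) by (intro divide_right_mono mult_left_mono B) auto
      also have "\<dots> = (exp 1 * B / T\<^sup>2) * h\<^sup>2"
        using y(1) T True unfolding y(3)[symmetric] by simp
      finally show ?thesis .
    next
      case False
      then show ?thesis using B by (simp add: flat_def)
    qed
    have "((\<lambda>h. (flat T Q (T + h) - flat T Q T) / h) \<longlongrightarrow> 0) (at 0)"
    proof (rule Lim_null_comparison)
      show "\<forall>\<^sub>F h in at 0. norm ((flat T Q (T + h) - flat T Q T) / h) \<le> (exp 1 * B / T\<^sup>2) * \<bar>h\<bar>"
      proof (rule always_eventually, rule allI)
        fix h :: real
        show "norm ((flat T Q (T + h) - flat T Q T) / h) \<le> (exp 1 * B / T\<^sup>2) * \<bar>h\<bar>"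
        proof (cases "h = 0")
          case False
          have "\<bar>flat T Q (T + h)\<bar> \<le> ((exp 1 * B / T\<^sup>2) * \<bar>h\<bar>) * \<bar>h\<bar>"
            using quad[of h] by (simp add: power2_eq_square)
          with False show ?thesis by (simp add: flat_def[of T Q T] pos_divide_le_eq)
        qed simp
      qed
      show "((\<lambda>h. (exp 1 * B / T\<^sup>2) * \<bar>h\<bar>) \<longlongrightarrow> 0) (at 0)"
        by (intro tendsto_mult_right_zero tendsto_rabs_zero tendsto_ident_at)
    qed
    then show ?thesis unfolding 2 DERIV_def using T by (simp add: flat_def[of T _ T])
  qed
qed

lemma time_deriv_eqI:
  assumes t: "0 \<le> t" and T: "0 < T" and eq: "\<And>s. 0 \<le> s \<Longrightarrow> f s = flat T Q s"
  shows "time_deriv f t = flat T (smult (1 / T) (flat_deriv Q)) t"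
    and "f differentiable (at t within {0..})"
proof -
  have "(flat T Q has_vector_derivative flat T (smult (1 / T) (flat_deriv Q)) t) (at t within {0..})"
    using flat_has_derivative[OF T, of Q t]
    by (auto simp: has_real_derivative_iff_has_vector_derivative intro: has_vector_derivative_at_within)
  then have d: "(f has_vector_derivative flat T (smult (1 / T) (flat_deriv Q)) t) (at t within {0..})"
    by (rule has_vector_derivative_transform[rotated 2]) (use t eq in auto)
  have "at t within {0..} \<noteq> bot"
  proof
    assume "at t within {0..} = bot"
    moreover have "at_right t \<le> at t within {0..}" using t by (intro at_le) auto
    ultimately show False using trivial_limit_at_right_real[of t] by (simp add: bot_unique)
  qed
  with d show "time_deriv f t = flat T (smult (1 / T) (flat_deriv Q)) t"
    unfolding time_deriv_def by (intro vector_derivative_within)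
  show "f differentiable (at t within {0..})"
    using d by (auto simp: has_vector_derivative_def differentiable_def)
qed

definition cutoff :: "real \<Rightarrow> real \<Rightarrow> real" where "cutoff T = flat T 1"

lemma time_deriv_cutoff:
  assumes "0 < T" "0 \<le> t"
  shows "time_deriv (cutoff T) t = flat T (flat_deriv 1) t / T"
    and "time_deriv (time_deriv (cutoff T)) t = flat T (flat_deriv (flat_deriv 1)) t / T\<^sup>2"
proof -
  have 1: "time_deriv (cutoff T) t = flat T (smult (1 / T) (flat_deriv 1)) t" if "0 \<le> t" for t
    using assms that by (intro time_deriv_eqI) (auto simp: cutoff_def)
  then show "time_deriv (cutoff T) t = flat T (flat_deriv 1) t / T"
    using assms by (simp add: flat_smult)
  have "time_deriv (time_deriv (cutoff T)) t = flat T (smult (1 / T) (flat_deriv (smult (1 / T) (flat_deriv 1)))) t"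
    by (rule time_deriv_eqI[OF assms(2,1) 1])
  then show "time_deriv (time_deriv (cutoff T)) t = flat T (flat_deriv (flat_deriv 1)) t / T\<^sup>2"
    by (simp add: flat_deriv_smult flat_smult power2_eq_square)
qed

lemma cutoff_test_function:
  assumes T: "0 < T"
  shows "time_test_function (cutoff T)"
proof -
  have iter: "\<exists>Q. \<forall>t\<ge>0. (time_deriv ^^ k) (cutoff T) t = flat T Q t" for k
  proof (induction k)
    case 0 then show ?case by (auto simp: cutoff_def)
  next
    case (Suc k)
    then obtain Q where "\<And>t. 0 \<le> t \<Longrightarrow> (time_deriv ^^ k) (cutoff T) t = flat T Q t" by blast
    then have "time_deriv ((time_deriv ^^ k) (cutoff T)) t = flat T (smult (1 / T) (flat_deriv Q)) t" if "0 \<le> t" for t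
      by (rule time_deriv_eqI[OF that T])
    then show ?case by auto
  qed
  have "(time_deriv ^^ k) (cutoff T) differentiable_on {0..}" for k
    using iter[of k] time_deriv_eqI(2)[OF _ T] unfolding differentiable_on_def by auto
  moreover have "\<forall>t\<ge>T. cutoff T t = 0" by (simp add: cutoff_def flat_def)
  ultimately show ?thesis unfolding time_test_function_def by blast
qed

lemma cutoff_nonneg: "0 \<le> cutoff T t"
  by (simp add: cutoff_def flat_def)

lemma cutoff_0: "0 < T \<Longrightarrow> cutoff T 0 = exp (- 1)"
  by (simp add: cutoff_def flat_def)

lemma time_deriv_cutoff_0: "0 < T \<Longrightarrow> time_deriv (cutoff T) 0 = 0"
  by (simp add: time_deriv_cutoff flat_def flat_deriv_def)

lemma cutoff_continuous: "0 < T \<Longrightarrow> continuous_on UNIV (cutoff T)"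
  unfolding cutoff_def
  by (intro continuous_at_imp_continuous_on ballI) (metis flat_has_derivative DERIV_isCont)

text \<open>The power \<open>1 - 1/q > 0\<close> of the exponential left over on the left-hand side absorbs the polynomial.\<close>

lemma flat_le_cutoff_powr:
  assumes q: "1 < q"
  shows "\<exists>C\<ge>0. \<forall>T>0. \<forall>t\<ge>0. \<bar>flat T Q t\<bar> \<le> C * cutoff T t powr (1 / q)"
proof -
  define b where "b = 1 - 1 / q"
  have b: "0 < b" using q by (simp add: b_def)
  obtain B where B: "0 \<le> B" "\<And>y. 0 \<le> y \<Longrightarrow> \<bar>poly Q y\<bar> * exp (- b * y) \<le> B"
    using poly_exp_bounded[OF b, of Q] by auto
  have "\<bar>flat T Q t\<bar> \<le> (exp b * B) * cutoff T t powr (1 / q)" if T: "0 < T" and t: "0 \<le> t" for T t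
  proof (cases "t < T")
    case True
    define y where "y = 1 / (1 - t / T)"
    define E where "E = exp (t / T - y)"
    have y: "0 \<le> y" using True T by (simp add: y_def)
    have E: "E = E powr b * E powr (1 / q)" by (simp add: b_def E_def powr_add[symmetric])
    have "E powr b = exp ((t / T - y) * b)" by (simp add: E_def exp_powr_real)
    also have "\<dots> \<le> exp (b + - b * y)"
      using True T b t by (simp add: algebra_simps pos_divide_le_eq)
    finally have Eb: "E powr b \<le> exp b * exp (- b * y)" by (simp only: exp_add)
    have "\<bar>poly Q y\<bar> * E powr b \<le> \<bar>poly Q y\<bar> * (exp b * exp (- b * y))"
      by (intro mult_left_mono Eb) auto
    also have "\<dots> = exp b * (\<bar>poly Q y\<bar> * exp (- b * y))" by simp
    also have "\<dots> \<le> exp b * B" by (intro mult_left_mono B y) auto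
    finally have "\<bar>poly Q y\<bar> * E powr b * E powr (1 / q) \<le> exp b * B * E powr (1 / q)"
      by (intro mult_right_mono) auto
    moreover have "\<bar>flat T Q t\<bar> = \<bar>poly Q y\<bar> * E" "cutoff T t = E"
      using True by (simp_all add: flat_def cutoff_def y_def E_def abs_mult)
    ultimately show ?thesis using E by (simp add: mult.assoc)
  qed (simp add: flat_def cutoff_def)
  then show ?thesis using B by (intro exI[of _ "exp b * B"]) auto
qed

text \<open>Bounding the derivatives by the power \<open>1/q\<close> of the cutoff is what allows Hoelder's inequality to
  recover \<open>|u|\<^sup>q\<close> weighted by the cutoff itself.\<close>

lemma cutoff_derivative_bounds:
  assumes q: "1 < q"
  shows "\<exists>C\<ge>0. \<forall>T>0. \<forall>t\<ge>0. cutoff T t \<le> C * cutoff T t powr (1 / q) \<and>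
     \<bar>time_deriv (cutoff T) t\<bar> \<le> C / T * cutoff T t powr (1 / q) \<and>
     \<bar>time_deriv (time_deriv (cutoff T)) t\<bar> \<le> C / T\<^sup>2 * cutoff T t powr (1 / q)"
proof -
  obtain C0 C1 C2 where C: "0 \<le> C0" "0 \<le> C1" "0 \<le> C2"
    "\<And>T t. 0 < T \<Longrightarrow> 0 \<le> t \<Longrightarrow> \<bar>flat T 1 t\<bar> \<le> C0 * cutoff T t powr (1 / q)"
    "\<And>T t. 0 < T \<Longrightarrow> 0 \<le> t \<Longrightarrow> \<bar>flat T (flat_deriv 1) t\<bar> \<le> C1 * cutoff T t powr (1 / q)"
    "\<And>T t. 0 < T \<Longrightarrow> 0 \<le> t \<Longrightarrow> \<bar>flat T (flat_deriv (flat_deriv 1)) t\<bar> \<le> C2 * cutoff T t powr (1 / q)"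
    using flat_le_cutoff_powr[OF q, of 1] flat_le_cutoff_powr[OF q, of "flat_deriv 1"]
      flat_le_cutoff_powr[OF q, of "flat_deriv (flat_deriv 1)"] by metis
  define C where "C = C0 + C1 + C2"
  have le: "C0 * e \<le> C * e" "C1 * e \<le> C * e" "C2 * e \<le> C * e" if "0 \<le> e" for e
    using that C by (auto simp: C_def intro!: mult_right_mono)
  show ?thesis
  proof (intro exI[of _ C] conjI allI impI)
    show "0 \<le> C" using C by (simp add: C_def)
    fix T t :: real assume T: "0 < T" and t: "0 \<le> t"
    let ?e = "cutoff T t powr (1 / q)"
    have *: "\<bar>flat T 1 t\<bar> \<le> C * ?e" "\<bar>flat T (flat_deriv 1) t\<bar> \<le> C * ?e"
      "\<bar>flat T (flat_deriv (flat_deriv 1)) t\<bar> \<le> C * ?e"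
      using C(4-6)[OF T t] le[of ?e] by (auto intro: order_trans)
    show "cutoff T t \<le> C * ?e" using *(1) by (simp add: cutoff_def)
    show "\<bar>time_deriv (cutoff T) t\<bar> \<le> C / T * ?e"
      using divide_right_mono[OF *(2), of T] T by (simp add: time_deriv_cutoff t)
    show "\<bar>time_deriv (time_deriv (cutoff T)) t\<bar> \<le> C / T\<^sup>2 * ?e"
      using divide_right_mono[OF *(3), of "T\<^sup>2"] T by (simp add: time_deriv_cutoff t)
  qed
qed

section \<open>Power means and the weak right-hand side\<close>

text \<open>A convex function lies above its tangent.\<close>

lemma powr_tangent:
  fixes x m r :: real
  assumes "0 \<le> x" "0 < m" "1 < r"
  shows "m powr r + r * m powr (r - 1) * (x - m) \<le> x powr r"
proof -
  have "(x / m) * 1 \<le> (x / m) powr r / r + 1 powr (r / (r - 1)) / (r / (r - 1))"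
    using assms by (intro Youngs_inequality) (auto simp: field_simps)
  then have "r * (x / m) \<le> r * ((x / m) powr r / r + (r - 1) / r)"
    using assms by (intro mult_left_mono) auto
  also have "\<dots> = (x / m) powr r + (r - 1)"
    using assms by (simp add: distrib_left)
  finally have "1 + r * (x / m - 1) \<le> (x / m) powr r"
    by (simp add: algebra_simps)
  then have "m powr r * (1 + r * (x / m - 1)) \<le> m powr r * (x / m) powr r"
    by (intro mult_left_mono) auto
  moreover have "m powr r * (x / m) powr r = x powr r"
    using assms by (simp add: powr_divide)
  moreover have "m powr r * (1 + r * (x / m - 1)) = m powr r + r * m powr (r - 1) * (x - m)"
    using assms by (simp add: powr_diff field_simps)
  ultimately show ?thesis by simp
qed

text \<open>Jensen's inequality for the measure \<open>w M\<close>, by integrating the tangent at the mean value; the right-hand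
  side may be infinite.  It stands in for Hoelder's inequality throughout.\<close>

lemma weighted_power_mean:
  fixes f w :: "'a \<Rightarrow> real"
  assumes [measurable]: "f \<in> borel_measurable M"
    and f: "\<And>x. 0 \<le> f x" and w: "\<And>x. 0 \<le> w x" and r: "1 < r"
    and iw: "integrable M w" and ifw: "integrable M (\<lambda>x. f x * w x)" and pos: "0 < integral\<^sup>L M w"
  shows "ennreal ((LINT x|M. f x * w x) powr r) \<le>
     ennreal (integral\<^sup>L M w powr (r - 1)) * (\<integral>\<^sup>+x. ennreal (f x powr r * w x) \<partial>M)"
proof (cases "(\<integral>\<^sup>+x. ennreal (f x powr r * w x) \<partial>M) = \<infinity> \<or> (LINT x|M. f x * w x) = 0")
  case True
  then show ?thesis using pos by (auto simp: ennreal_mult_top)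
next
  case False
  have [measurable]: "w \<in> borel_measurable M" using iw by simp
  define W S where "W = integral\<^sup>L M w" and "S = (LINT x|M. f x * w x)"
  have "0 \<le> S" unfolding S_def using f w by (intro integral_nonneg_AE) auto
  with False have S: "0 < S" by (simp add: S_def)
  \<comment> \<open>The mean value of \<open>f\<close>, at which the tangent is taken.\<close>
  define m where "m = S / W"
  have m: "0 < m" "m * W = S" using S pos by (auto simp: m_def W_def)
  have int: "integrable M (\<lambda>x. f x powr r * w x)"
    using False w by (intro integrableI_bounded) (auto simp: less_top)
  have "m powr r * W = (LINT x|M. m powr r * w x + r * m powr (r - 1) * (f x * w x - m * w x))"
    using iw ifw m by (simp add: S_def[symmetric] W_def[symmetric])
  also have "\<dots> \<le> (LINT x|M. f x powr r * w x)"
  proof (rule integral_mono)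
    show "m powr r * w x + r * m powr (r - 1) * (f x * w x - m * w x) \<le> f x powr r * w x" for x
      using mult_right_mono[OF powr_tangent[OF f m(1) r, of x] w[of x]] by (simp add: algebra_simps)
  qed (use iw ifw int in auto)
  finally have 1: "m powr r * W \<le> (LINT x|M. f x powr r * w x)" .
  have "S powr r = W powr (r - 1) * (m powr r * W)"
    using m pos unfolding m(2)[symmetric]
    by (simp add: powr_mult W_def[symmetric] powr_diff)
  also have "\<dots> \<le> W powr (r - 1) * (LINT x|M. f x powr r * w x)"
    using 1 by (intro mult_left_mono) auto
  finally have "ennreal (S powr r) \<le> ennreal (W powr (r - 1) * (LINT x|M. f x powr r * w x))"
    by (rule ennreal_leI)
  also have "\<dots> = ennreal (W powr (r - 1)) * (\<integral>\<^sup>+x. ennreal (f x powr r * w x) \<partial>M)"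
    using w by (subst nn_integral_eq_integral[OF int]) (auto simp: ennreal_mult' integral_nonneg_AE)
  finally show ?thesis by (simp add: S_def W_def)
qed

text \<open>A non-integrable \<open>f\<close> has integral \<open>0\<close>, and \<open>h\<close> is nonnegative.\<close>

lemma abs_integral_le:
  fixes f h :: "'a \<Rightarrow> real"
  assumes "integrable M h" "\<And>x. \<bar>f x\<bar> \<le> h x"
  shows "\<bar>integral\<^sup>L M f\<bar> \<le> integral\<^sup>L M h"
proof (cases "integrable M f")
  case True
  then have "\<bar>integral\<^sup>L M f\<bar> \<le> (LINT x|M. \<bar>f x\<bar>)" by (intro integral_abs_bound)
  also have "\<dots> \<le> integral\<^sup>L M h" using True assms by (intro integral_mono) auto
  finally show ?thesis .
next
  case False
  have "0 \<le> h x" for x using assms(2)[of x] by linarith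
  then show ?thesis using False by (simp add: not_integrable_integral_eq integral_nonneg_AE)
qed

lemma L2_weighted_integrable:
  fixes u \<phi> :: "'a::euclidean_space \<Rightarrow> real"
  assumes u: "u \<in> L2_space" and \<phi>: "integrable lebesgue \<phi>" "\<And>x. 0 \<le> \<phi> x" "\<And>x. \<phi> x \<le> B"
  shows "integrable lebesgue (\<lambda>x. \<bar>u x\<bar> * \<phi> x)"
proof (rule Bochner_Integration.integrable_bound)
  have [measurable]: "u \<in> borel_measurable lebesgue" "\<phi> \<in> borel_measurable lebesgue"
    using u \<phi> by (auto simp: L2_space_def)
  show "integrable lebesgue (\<lambda>x. B * (norm (u x))\<^sup>2 + \<phi> x)"
    using u \<phi> by (auto simp: L2_space_def)
  show "AE x in lebesgue. norm (\<bar>u x\<bar> * \<phi> x) \<le> norm (B * (norm (u x))\<^sup>2 + \<phi> x)"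
  proof (rule AE_I2)
    fix x
    have "0 \<le> (\<bar>u x\<bar> - 1)\<^sup>2" by simp
    then have "2 * \<bar>u x\<bar> \<le> \<bar>u x\<bar>\<^sup>2 + 1" by (simp add: power2_eq_square algebra_simps)
    then have "\<bar>u x\<bar> \<le> \<bar>u x\<bar>\<^sup>2 + 1" by linarith
    then have "\<bar>u x\<bar> * \<phi> x \<le> (\<bar>u x\<bar>\<^sup>2 + 1) * \<phi> x" by (intro mult_right_mono \<phi>)
    also have "\<dots> \<le> B * \<bar>u x\<bar>\<^sup>2 + \<phi> x"
      using mult_right_mono[OF \<phi>(3), of "\<bar>u x\<bar>\<^sup>2" x] by (simp add: algebra_simps)
    finally show "norm (\<bar>u x\<bar> * \<phi> x) \<le> norm (B * (norm (u x))\<^sup>2 + \<phi> x)"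
      using \<phi>(2)[of x] by (simp add: abs_mult)
  qed
  show "(\<lambda>x. \<bar>u x\<bar> * \<phi> x) \<in> borel_measurable lebesgue" by measurable
qed

text \<open>The power mean inequality with exponent \<open>2\<close>, that is, Cauchy-Schwarz with the weight \<open>\<phi>\<close>.\<close>

lemma L2_weighted_le:
  fixes u \<phi> :: "'a::euclidean_space \<Rightarrow> real"
  assumes u: "u \<in> L2_space" and \<phi>: "integrable lebesgue \<phi>" "\<And>x. 0 \<le> \<phi> x" "\<And>x. \<phi> x \<le> B"
    and pos: "0 < integral\<^sup>L lebesgue \<phi>"
  shows "(LINT x|lebesgue. \<bar>u x\<bar> * \<phi> x) \<le> sqrt (integral\<^sup>L lebesgue \<phi> * B) * L2_norm u"
proof -
  have [measurable]: "u \<in> borel_measurable lebesgue" "\<phi> \<in> borel_measurable lebesgue"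
    using u \<phi> by (auto simp: L2_space_def)
  have B: "0 \<le> B" using \<phi>(2,3)[of undefined] by linarith
  have iu: "integrable lebesgue (\<lambda>x. (u x)\<^sup>2)" using u by (simp add: L2_space_def)
  define I where "I = (LINT x|lebesgue. \<bar>u x\<bar> * \<phi> x)"
  have I: "0 \<le> I" unfolding I_def using \<phi> by (intro integral_nonneg_AE) auto
  have "ennreal (I powr 2) \<le> ennreal (integral\<^sup>L lebesgue \<phi> powr (2 - 1)) * (\<integral>\<^sup>+x. ennreal (\<bar>u x\<bar> powr 2 * \<phi> x) \<partial>lebesgue)"
    unfolding I_def by (intro weighted_power_mean L2_weighted_integrable[OF u \<phi>] \<phi> pos) auto
  also have "(\<integral>\<^sup>+x. ennreal (\<bar>u x\<bar> powr 2 * \<phi> x) \<partial>lebesgue) \<le> (\<integral>\<^sup>+x. ennreal (B * (u x)\<^sup>2) \<partial>lebesgue)"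
    by (intro nn_integral_mono ennreal_leI)
       (auto simp: powr_numeral mult.commute[of "(u _)\<^sup>2"] intro!: mult_right_mono \<phi>(3))
  also have "\<dots> = ennreal (B * (LINT x|lebesgue. (u x)\<^sup>2))"
    using iu B by (subst nn_integral_eq_integral) auto
  finally have "ennreal (I\<^sup>2) \<le> ennreal (integral\<^sup>L lebesgue \<phi> * (B * (LINT x|lebesgue. (u x)\<^sup>2)))"
    using pos I by (simp add: mult_left_mono ennreal_mult' powr_numeral)
  then have "I\<^sup>2 \<le> integral\<^sup>L lebesgue \<phi> * (B * (LINT x|lebesgue. (u x)\<^sup>2))"
    using pos B by (subst (asm) ennreal_le_iff) auto
  then have "I \<le> sqrt (integral\<^sup>L lebesgue \<phi> * (B * (LINT x|lebesgue. (u x)\<^sup>2)))"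
    by (rule real_le_rsqrt)
  then show ?thesis by (simp add: I_def L2_norm_def real_sqrt_mult mult.assoc)
qed

lemma continuous_L2_weighted:
  fixes u :: "real \<Rightarrow> 'a::euclidean_space \<Rightarrow> real"
  assumes u: "continuous_L2 u" and \<phi>: "integrable lebesgue \<phi>" "\<And>x. 0 \<le> \<phi> x" "\<And>x. \<phi> x \<le> B"
    and pos: "0 < integral\<^sup>L lebesgue \<phi>"
  shows "continuous_on {0..} (\<lambda>t. LINT x|lebesgue. \<bar>u t x\<bar> * \<phi> x)"
  unfolding continuous_on_def
proof
  fix t :: real assume t: "t \<in> {0..}"
  have uL: "u s \<in> L2_space" if "0 \<le> s" for s using u that by (simp add: continuous_L2_def)
  let ?U = "\<lambda>t. LINT x|lebesgue. \<bar>u t x\<bar> * \<phi> x"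
  have le: "\<bar>?U s - ?U t\<bar> \<le> sqrt (integral\<^sup>L lebesgue \<phi> * B) * L2_norm (\<lambda>x. u s x - u t x)" if s: "0 \<le> s" for s
  proof -
    have i: "integrable lebesgue (\<lambda>x. \<bar>u s x\<bar> * \<phi> x)" "integrable lebesgue (\<lambda>x. \<bar>u t x\<bar> * \<phi> x)"
      using s t by (auto intro!: L2_weighted_integrable[OF uL \<phi>])
    have d: "(\<lambda>x. u s x - u t x) \<in> L2_space"
    proof -
      have [measurable]: "u s \<in> borel_measurable lebesgue" "u t \<in> borel_measurable lebesgue"
        using uL s t by (auto simp: L2_space_def)
      have "integrable lebesgue (\<lambda>x. (norm (u s x - u t x))\<^sup>2)"
      proof (rule Bochner_Integration.integrable_bound)
        show "integrable lebesgue (\<lambda>x. 2 * (norm (u s x))\<^sup>2 + 2 * (norm (u t x))\<^sup>2)"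
          using uL[OF s] uL[of t] t by (auto simp: L2_space_def)
        show "AE x in lebesgue. norm ((norm (u s x - u t x))\<^sup>2) \<le> norm (2 * (norm (u s x))\<^sup>2 + 2 * (norm (u t x))\<^sup>2)"
        proof (rule AE_I2)
          fix x
          have "0 \<le> (u s x + u t x)\<^sup>2" by simp
          then have "(u s x - u t x)\<^sup>2 \<le> 2 * (u s x)\<^sup>2 + 2 * (u t x)\<^sup>2"
            by (simp add: power2_eq_square algebra_simps)
          then show "norm ((norm (u s x - u t x))\<^sup>2) \<le> norm (2 * (norm (u s x))\<^sup>2 + 2 * (norm (u t x))\<^sup>2)"
            by simp
        qed
      qed measurable
      then show ?thesis by (simp add: L2_space_def)
    qed
    have "?U s - ?U t = (LINT x|lebesgue. \<bar>u s x\<bar> * \<phi> x - \<bar>u t x\<bar> * \<phi> x)"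
      using i by simp
    also have "\<bar>\<dots>\<bar> \<le> (LINT x|lebesgue. \<bar>u s x - u t x\<bar> * \<phi> x)"
    proof (rule abs_integral_le)
      show "integrable lebesgue (\<lambda>x. \<bar>u s x - u t x\<bar> * \<phi> x)" by (rule L2_weighted_integrable[OF d \<phi>])
      show "\<bar>\<bar>u s x\<bar> * \<phi> x - \<bar>u t x\<bar> * \<phi> x\<bar> \<le> \<bar>u s x - u t x\<bar> * \<phi> x" for x
        using mult_right_mono[OF abs_triangle_ineq3[of "u s x" "u t x"] \<phi>(2)[of x]] \<phi>(2)[of x]
        by (simp add: left_diff_distrib[symmetric] abs_mult)
    qed
    also have "\<dots> \<le> sqrt (integral\<^sup>L lebesgue \<phi> * B) * L2_norm (\<lambda>x. u s x - u t x)"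
      by (rule L2_weighted_le[OF d \<phi> pos])
    finally show ?thesis .
  qed
  have "((\<lambda>s. ?U s - ?U t) \<longlongrightarrow> 0) (at t within {0..})"
  proof (rule Lim_null_comparison)
    show "\<forall>\<^sub>F s in at t within {0..}. norm (?U s - ?U t) \<le> sqrt (integral\<^sup>L lebesgue \<phi> * B) * L2_norm (\<lambda>x. u s x - u t x)"
      using le by (auto simp: eventually_at_filter)
    show "((\<lambda>s. sqrt (integral\<^sup>L lebesgue \<phi> * B) * L2_norm (\<lambda>x. u s x - u t x)) \<longlongrightarrow> 0) (at t within {0..})"
      using u t unfolding continuous_L2_def by (intro tendsto_mult_right_zero) auto
  qed
  then show "(?U \<longlongrightarrow> ?U t) (at t within {0..})" by (simp add: LIM_zero_iff)
qed

text \<open>Hoelder's inequality is applied first in space, which replaces \<open>|u|\<^sup>q\<close> by the weighted mean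
  \<open>U(t) = \<integral>|u(t)| \<phi>\<close>, and then in time.  The mean is continuous in \<open>t\<close> by \<open>continuous_L2_weighted\<close>, so the
  argument in time involves a function whose measurability is evident, and the energy \<open>N\<close> enters only
  through the monotonicity of the integral.\<close>

lemma weak_rhs_bound:
  fixes u :: "real \<Rightarrow> 'a::euclidean_space \<Rightarrow> real"
  assumes u: "continuous_L2 u" and q: "1 < q"
    and \<phi>: "integrable lebesgue \<phi>" "\<And>x. 0 \<le> \<phi> x" "\<And>x. \<phi> x \<le> B" and pos: "0 < integral\<^sup>L lebesgue \<phi>"
    and T: "0 < T" and \<eta>: "continuous_on UNIV \<eta>" "\<And>t. 0 \<le> \<eta> t" "\<And>t. T \<le> t \<Longrightarrow> \<eta> t = 0"
    and D: "0 \<le> D" "\<And>t x. 0 \<le> t \<Longrightarrow> \<bar>L t x\<bar> \<le> D * \<eta> t powr (1 / q) * \<phi> x"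
    and N: "N = (\<integral>\<^sup>+t\<in>{0..}. (\<integral>\<^sup>+x. ennreal (\<bar>u t x\<bar> powr q * \<eta> t * \<phi> x) \<partial>lebesgue) \<partial>lebesgue)"
    and fin: "N < \<infinity>"
  shows "(LINT t:{0..}|lebesgue. LINT x|lebesgue. u t x * L t x) \<le>
     D * ((T * integral\<^sup>L lebesgue \<phi>) powr (1 - 1 / q) * enn2real N powr (1 / q))"
proof -
  define W where "W = integral\<^sup>L lebesgue \<phi>"
  define U where "U = (\<lambda>t. LINT x|lebesgue. \<bar>u t x\<bar> * \<phi> x)"
  define f where "f = (\<lambda>t. indicator {0..T} t * (U t * \<eta> t powr (1 / q)))"
  have uL: "u s \<in> L2_space" if "0 \<le> s" for s using u that by (simp add: continuous_L2_def)
  have iU: "integrable lebesgue (\<lambda>x. \<bar>u t x\<bar> * \<phi> x)" if "0 \<le> t" for t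
    by (rule L2_weighted_integrable[OF uL[OF that] \<phi>])
  have U0: "0 \<le> U t" for t unfolding U_def using \<phi> by (intro integral_nonneg_AE) auto
  have W: "0 < W" using pos by (simp add: W_def)
  have "continuous_on {0..T} (\<lambda>t. U t * \<eta> t powr (1 / q))"
    unfolding U_def using q \<eta>(2)
    by (intro continuous_on_mult continuous_on_subset[OF continuous_L2_weighted[OF u \<phi> pos]]
        continuous_on_powr' continuous_on_subset[OF \<eta>(1)] continuous_on_const) auto
  then have "set_integrable lborel {0..T} (\<lambda>t. U t * \<eta> t powr (1 / q))"
    by (rule borel_integrable_atLeastAtMost')
  then have f_lborel: "integrable lborel f"
    by (simp add: set_integrable_def f_def)
  then have if': "integrable lebesgue f"
    by (subst integrable_completion) auto
  have f0: "0 \<le> f t" for t using U0 by (simp add: f_def)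
  have iw: "integrable lebesgue (indicator {0..T} :: real \<Rightarrow> real)"
    using T by (auto intro!: integrable_real_indicator)
  have Tw: "integral\<^sup>L lebesgue (indicator {0..T} :: real \<Rightarrow> real) = T"
    using T by simp
  have ff: "f t * indicator {0..T} t = f t" for t by (simp add: f_def indicator_def)
  have ffq: "f t powr q * indicator {0..T} t = f t powr q" for t by (simp add: f_def indicator_def)
  define S where "S = integral\<^sup>L lebesgue f"
  have S0: "0 \<le> S" unfolding S_def using f0 by (intro integral_nonneg_AE) auto
  have "ennreal ((LINT t|lebesgue. f t * indicator {0..T} t) powr q) \<le>
      ennreal (integral\<^sup>L lebesgue (indicator {0..T} :: real \<Rightarrow> real) powr (q - 1)) *
        (\<integral>\<^sup>+t. ennreal (f t powr q * indicator {0..T} t) \<partial>lebesgue)"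
  proof (rule weighted_power_mean)
    show "integrable lebesgue (\<lambda>t. f t * indicator {0..T} t)" unfolding ff by (rule if')
  qed (use T q iw if' f0 Tw in auto)
  then have 1: "ennreal (S powr q) \<le> ennreal (T powr (q - 1)) * (\<integral>\<^sup>+t. ennreal (f t powr q) \<partial>lebesgue)"
    by (simp only: ff ffq Tw S_def[symmetric])
  have 2: "ennreal (f t powr q) \<le> ennreal (W powr (q - 1)) *
      ((\<integral>\<^sup>+x. ennreal (\<bar>u t x\<bar> powr q * \<eta> t * \<phi> x) \<partial>lebesgue) * indicator {0..} t)" for t
  proof (cases "t \<in> {0..T}")
    case True
    then have t: "0 \<le> t" by simp
    have [measurable]: "u t \<in> borel_measurable lebesgue" "\<phi> \<in> borel_measurable lebesgue"
      using uL[OF t] \<phi> by (auto simp: L2_space_def)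
    have "f t powr q = \<eta> t * U t powr q"
      using True U0 \<eta>(2)[of t] q by (simp add: f_def powr_mult powr_powr)
    then have "ennreal (f t powr q) = ennreal (\<eta> t) * ennreal (U t powr q)"
      using \<eta>(2)[of t] by (simp add: ennreal_mult')
    also have "\<dots> \<le> ennreal (\<eta> t) * (ennreal (W powr (q - 1)) * (\<integral>\<^sup>+x. ennreal (\<bar>u t x\<bar> powr q * \<phi> x) \<partial>lebesgue))"
      unfolding U_def W_def using iU[OF t] pos q \<phi>
      by (intro mult_left_mono weighted_power_mean) auto
    also have "\<dots> = ennreal (W powr (q - 1)) * (\<integral>\<^sup>+x. ennreal (\<eta> t) * ennreal (\<bar>u t x\<bar> powr q * \<phi> x) \<partial>lebesgue)"
      by (subst nn_integral_cmult) (auto simp: mult.left_commute)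
    also have "(\<integral>\<^sup>+x. ennreal (\<eta> t) * ennreal (\<bar>u t x\<bar> powr q * \<phi> x) \<partial>lebesgue) =
        (\<integral>\<^sup>+x. ennreal (\<bar>u t x\<bar> powr q * \<eta> t * \<phi> x) \<partial>lebesgue)"
      using \<eta>(2)[of t] by (intro nn_integral_cong) (simp add: ennreal_mult'[symmetric] mult_ac)
    finally show ?thesis using t by simp
  qed (simp add: f_def)
  have [measurable]: "f \<in> borel_measurable lebesgue" using if' by simp
  have 3: "(\<integral>\<^sup>+t. ennreal (f t powr q) \<partial>lebesgue) \<le> ennreal (W powr (q - 1)) * N"
  proof -
    have "(\<integral>\<^sup>+t. ennreal (f t powr q) \<partial>lebesgue) =
       (\<integral>\<^sup>+t. ennreal (W powr (q - 1)) * ennreal (inverse (W powr (q - 1)) * f t powr q) \<partial>lebesgue)"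
      using W by (intro nn_integral_cong) (simp add: ennreal_mult'[symmetric])
    also have "\<dots> = ennreal (W powr (q - 1)) * (\<integral>\<^sup>+t. ennreal (inverse (W powr (q - 1)) * f t powr q) \<partial>lebesgue)"
      by (rule nn_integral_cmult) measurable
    also have "\<dots> \<le> ennreal (W powr (q - 1)) * N"
      unfolding N
    proof (intro mult_left_mono nn_integral_mono)
      fix t
      have "ennreal (inverse (W powr (q - 1)) * f t powr q) = ennreal (inverse (W powr (q - 1))) * ennreal (f t powr q)"
        by (simp add: ennreal_mult')
      also have "\<dots> \<le> ennreal (inverse (W powr (q - 1))) * (ennreal (W powr (q - 1)) *
         ((\<integral>\<^sup>+x. ennreal (\<bar>u t x\<bar> powr q * \<eta> t * \<phi> x) \<partial>lebesgue) * indicator {0..} t))"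
        by (intro mult_left_mono 2) auto
      also have "\<dots> = (\<integral>\<^sup>+x. ennreal (\<bar>u t x\<bar> powr q * \<eta> t * \<phi> x) \<partial>lebesgue) * indicator {0..} t"
        using W by (simp add: mult.assoc[symmetric] ennreal_mult'[symmetric])
      finally show "ennreal (inverse (W powr (q - 1)) * f t powr q) \<le>
        (\<integral>\<^sup>+x. ennreal (\<bar>u t x\<bar> powr q * \<eta> t * \<phi> x) \<partial>lebesgue) * indicator {0..} t" .
    qed auto
    finally show ?thesis .
  qed
  have "ennreal (S powr q) \<le> ennreal (T powr (q - 1)) * (ennreal (W powr (q - 1)) * ennreal (enn2real N))"
    using order_trans[OF 1 mult_left_mono[OF 3]] fin by simp
  then have "ennreal (S powr q) \<le> ennreal (T powr (q - 1) * (W powr (q - 1) * enn2real N))"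
    by (simp add: ennreal_mult')
  then have "S powr q \<le> T powr (q - 1) * (W powr (q - 1) * enn2real N)"
    by (subst (asm) ennreal_le_iff) auto
  then have "(S powr q) powr (1 / q) \<le> (T powr (q - 1) * (W powr (q - 1) * enn2real N)) powr (1 / q)"
    using q by (intro powr_mono2) auto
  moreover have "(S powr q) powr (1 / q) = S" using q S0 by (simp add: powr_powr)
  moreover have "(T powr (q - 1) * (W powr (q - 1) * enn2real N)) powr (1 / q) =
      (T * W) powr (1 - 1 / q) * enn2real N powr (1 / q)"
    using q W T by (simp add: powr_mult powr_powr diff_divide_distrib)
  ultimately have S: "S \<le> (T * W) powr (1 - 1 / q) * enn2real N powr (1 / q)" by simp
  have "(LINT t:{0..}|lebesgue. LINT x|lebesgue. u t x * L t x) \<le>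
      \<bar>LINT t|lebesgue. indicator {0..} t *\<^sub>R (LINT x|lebesgue. u t x * L t x)\<bar>"
    unfolding set_lebesgue_integral_def by (rule abs_ge_self)
  also have "\<dots> \<le> (LINT t|lebesgue. D * f t)"
  proof (rule abs_integral_le)
    show "integrable lebesgue (\<lambda>t. D * f t)" using if' by simp
    fix t
    show "\<bar>indicator {0..} t *\<^sub>R (LINT x|lebesgue. u t x * L t x)\<bar> \<le> D * f t"
    proof (cases "0 \<le> t")
      case True
      have "\<bar>LINT x|lebesgue. u t x * L t x\<bar> \<le> (LINT x|lebesgue. D * \<eta> t powr (1 / q) * (\<bar>u t x\<bar> * \<phi> x))"
      proof (rule abs_integral_le)
        show "integrable lebesgue (\<lambda>x. D * \<eta> t powr (1 / q) * (\<bar>u t x\<bar> * \<phi> x))"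
          using iU[OF True] by simp
        show "\<bar>u t x * L t x\<bar> \<le> D * \<eta> t powr (1 / q) * (\<bar>u t x\<bar> * \<phi> x)" for x
          using mult_left_mono[OF D(2)[OF True, of x], of "\<bar>u t x\<bar>"] by (simp add: abs_mult mult_ac)
      qed
      also have "\<dots> = D * (\<eta> t powr (1 / q) * U t)" by (simp add: U_def)
      also have "\<dots> = D * f t" using True \<eta>(3)[of t] by (auto simp: f_def indicator_def)
      finally show ?thesis using True by simp
    qed (use D f0 in simp)
  qed
  also have "\<dots> = D * S" by (simp add: S_def)
  also have "\<dots> \<le> D * ((T * W) powr (1 - 1 / q) * enn2real N powr (1 / q))"
    using S D by (intro mult_left_mono)
  finally show ?thesis by (simp add: W_def)
qed

section \<open>Testing the system and the blow-up argument\<close>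

text \<open>The nonlinear term of the weak formulation for the test function of scale \<open>R\<close>.  Time is scaled like
  \<open>R\<^bsup>2\<sigma>\<^esup>\<close> to balance \<open>u\<^sub>t\<close> with \<open>(-\<Delta>)\<^sup>\<sigma> u\<close>, next to which \<open>u\<^sub>t\<^sub>t\<close> is negligible on large scales.\<close>

definition test_energy :: "real \<Rightarrow> real \<Rightarrow> real \<Rightarrow> (real \<Rightarrow> 'a::euclidean_space \<Rightarrow> real) \<Rightarrow> ennreal" where
  "test_energy \<sigma> r R w = (\<integral>\<^sup>+t\<in>{0..}. (\<integral>\<^sup>+x. ennreal (\<bar>w t x\<bar> powr r *
      cutoff (R powr (2 * \<sigma>)) t * bump \<sigma> (x /\<^sub>R R)) \<partial>lebesgue) \<partial>lebesgue)"

lemma bump_bounded: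
  assumes "\<sigma> > 0"
  shows "\<exists>B. \<forall>x::'a::euclidean_space. bump \<sigma> x \<le> B"
proof -
  interpret B: mixing "lborel \<Otimes>\<^sub>M lborel" "bump_weight \<sigma>" "\<lambda>(s, t). \<bar>s\<bar> + \<bar>t\<bar>"
    using assms by (rule bump_mixing)
  show ?thesis
    using B.abs_mix_le[where 'a = 'a] unfolding bump_def by (meson abs_le_D1)
qed

lemma bump_measurable [measurable]:
  "\<sigma> > 0 \<Longrightarrow> (bump \<sigma> :: 'a::euclidean_space \<Rightarrow> real) \<in> borel_measurable borel"
  unfolding bump_def by (rule mixing.mix_meas[OF bump_mixing])

lemma bump_integral:
  assumes \<sigma>: "\<sigma> > 0" and R: "0 < R"
  shows "integrable lebesgue (\<lambda>x::'a::euclidean_space. bump \<sigma> (x /\<^sub>R R))"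
    and "(LINT x::'a|lebesgue. bump \<sigma> (x /\<^sub>R R)) = R ^ DIM('a) * (LINT x::'a|lborel. bump \<sigma> x)"
    and "0 < (LINT x::'a|lborel. bump \<sigma> x)"
proof -
  interpret B: mixing "lborel \<Otimes>\<^sub>M lborel" "bump_weight \<sigma>" "\<lambda>(s, t). \<bar>s\<bar> + \<bar>t\<bar>"
    using \<sigma> by (rule bump_mixing)
  note [measurable] = bump_measurable[OF \<sigma>]
  have m: "(\<lambda>x::'a. bump \<sigma> (x /\<^sub>R R)) \<in> borel_measurable lborel" by measurable
  show "integrable lebesgue (\<lambda>x::'a. bump \<sigma> (x /\<^sub>R R))"
    using B.mix_scaled_integrable[OF R, where 'a = 'a] m by (subst integrable_completion) (auto simp: bump_def)
  have "(LINT x::'a|lebesgue. bump \<sigma> (x /\<^sub>R R)) = (LINT x::'a|lborel. bump \<sigma> (x /\<^sub>R R))"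
    by (rule integral_completion[OF m])
  also have "\<dots> = R ^ DIM('a) *\<^sub>R (LINT x::'a|lborel. bump \<sigma> ((R *\<^sub>R x) /\<^sub>R R))"
    using m by (intro lborel_integral_scale(1)[OF _ R]) simp
  finally show "(LINT x::'a|lebesgue. bump \<sigma> (x /\<^sub>R R)) = R ^ DIM('a) * (LINT x::'a|lborel. bump \<sigma> x)"
    using R by simp
  have i: "integrable lborel (bump \<sigma> :: 'a \<Rightarrow> real)"
    unfolding bump_def by (rule B.mix_integrable)
  have "(LINT x::'a|lborel. bump \<sigma> x) \<noteq> 0"
  proof
    assume "(LINT x::'a|lborel. bump \<sigma> x) = 0"
    then have "AE x::'a in lborel. bump \<sigma> x = 0"
      using bump_pos[OF \<sigma>, where 'a = 'a] by (subst (asm) integral_nonneg_eq_0_iff_AE[OF i]) (auto simp: less_imp_le)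
    then have "AE x::'a in lborel. False"
      by eventually_elim (use bump_pos[OF \<sigma>, where 'a = 'a] in \<open>auto simp: less_le\<close>)
    then show False by (simp add: AE_iff_null null_sets_def emeasure_lborel_UNIV)
  qed
  moreover have "0 \<le> (LINT x::'a|lborel. bump \<sigma> x)"
    using bump_pos[OF \<sigma>, where 'a = 'a] by (intro integral_nonneg_AE) (auto simp: less_imp_le)
  ultimately show "0 < (LINT x::'a|lborel. bump \<sigma> x)" by simp
qed

lemma weak_test:
  fixes u w :: "real \<Rightarrow> 'a::euclidean_space \<Rightarrow> real"
  assumes \<sigma>: "\<sigma> \<ge> 1/2" and R: "0 < R" and weak: "weak_damped_equation \<sigma> r u w h"
  shows "test_energy \<sigma> r R w < \<infinity>"
    and "enn2real (test_energy \<sigma> r R w) + exp (- 1) * (LINT x|lebesgue. h x * bump \<sigma> (x /\<^sub>R R)) =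
      (LINT t:{0..}|lebesgue. LINT x|lebesgue. u t x *
        (time_deriv (time_deriv (cutoff (R powr (2 * \<sigma>)))) t * bump \<sigma> (x /\<^sub>R R)
         - time_deriv (cutoff (R powr (2 * \<sigma>))) t * bump \<sigma> (x /\<^sub>R R)
         + cutoff (R powr (2 * \<sigma>)) t * (R powr (- 2 * \<sigma>) * bump_laplacian \<sigma> (x /\<^sub>R R))))"
proof -
  have s0: "0 < \<sigma>" using \<sigma> by simp
  interpret B: mixing "lborel \<Otimes>\<^sub>M lborel" "bump_weight \<sigma>" "\<lambda>(s, t). \<bar>s\<bar> + \<bar>t\<bar>"
    using s0 by (rule bump_mixing)
  have T: "0 < R powr (2 * \<sigma>)" using R by simp
  obtain B where B: "\<And>x::'a. bump \<sigma> x \<le> B" using bump_bounded[OF s0] by blast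
  have "smooth (\<lambda>x::'a. bump \<sigma> (x /\<^sub>R R))"
    unfolding bump_def by (rule B.smooth_mix_scaled[OF R])
  moreover have "bounded (range (\<lambda>x::'a. bump \<sigma> (x /\<^sub>R R)))"
    using B bump_pos[OF s0, where 'a = 'a] by (intro boundedI[of _ B]) (auto simp: less_imp_le)
  moreover have "\<forall>x::'a. 0 \<le> bump \<sigma> (x /\<^sub>R R)"
    using bump_pos[OF s0, where 'a = 'a] by (auto simp: less_imp_le)
  ultimately have *: "time_test_function (cutoff (R powr (2 * \<sigma>))) \<and> (\<forall>t\<ge>0. cutoff (R powr (2 * \<sigma>)) t \<ge> 0) \<and>
     time_deriv (cutoff (R powr (2 * \<sigma>))) 0 = 0 \<and> smooth (\<lambda>x::'a. bump \<sigma> (x /\<^sub>R R)) \<and>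
     (\<lambda>x::'a. bump \<sigma> (x /\<^sub>R R)) \<in> sobolev_space (2 * \<sigma>) \<and> bounded (range (\<lambda>x::'a. bump \<sigma> (x /\<^sub>R R))) \<and>
     (\<forall>x::'a. 0 \<le> bump \<sigma> (x /\<^sub>R R)) \<and> has_frac_laplacian \<sigma> (\<lambda>x::'a. bump \<sigma> (x /\<^sub>R R))
           (\<lambda>x. R powr (- 2 * \<sigma>) * bump_laplacian \<sigma> (x /\<^sub>R R))"
    using cutoff_test_function[OF T] cutoff_nonneg time_deriv_cutoff_0[OF T]
      bump_scaled_sobolev[OF \<sigma> R] bump_scaled_frac_laplacian[OF \<sigma> R] by blast
  note W = weak[unfolded weak_damped_equation_def, rule_format, OF *, unfolded Let_def]
  show "test_energy \<sigma> r R w < \<infinity>"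
    unfolding test_energy_def by (rule W[THEN conjunct1])
  show "enn2real (test_energy \<sigma> r R w) + exp (- 1) * (LINT x|lebesgue. h x * bump \<sigma> (x /\<^sub>R R)) =
      (LINT t:{0..}|lebesgue. LINT x|lebesgue. u t x *
        (time_deriv (time_deriv (cutoff (R powr (2 * \<sigma>)))) t * bump \<sigma> (x /\<^sub>R R)
         - time_deriv (cutoff (R powr (2 * \<sigma>))) t * bump \<sigma> (x /\<^sub>R R)
         + cutoff (R powr (2 * \<sigma>)) t * (R powr (- 2 * \<sigma>) * bump_laplacian \<sigma> (x /\<^sub>R R))))"
    unfolding test_energy_def cutoff_0[OF T, symmetric] by (rule W[THEN conjunct2])
qed

text \<open>Every term of the differential operator applied to the test function is at most a constant times
  \<open>R\<^bsup>-2\<sigma>\<^esup> \<eta>\<^bsup>1/q\<^esup> \<phi>\<close>, and the space-time volume of the test function is of order \<open>R\<^bsup>2\<sigma>+n\<^esup>\<close>.\<close>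

lemma weak_energy_bound:
  assumes \<sigma>: "\<sigma> \<ge> 1/2" and q: "1 < q"
  shows "\<exists>K\<ge>0. \<forall>R\<ge>1. \<forall>r h. \<forall>u w :: real \<Rightarrow> 'a::euclidean_space \<Rightarrow> real.
     continuous_L2 u \<and> weak_damped_equation \<sigma> r u w h \<and> test_energy \<sigma> q R u < \<infinity> \<longrightarrow>
     enn2real (test_energy \<sigma> r R w) + exp (- 1) * (LINT x|lebesgue. h x * bump \<sigma> (x /\<^sub>R R))
       \<le> K * R powr ((2 * \<sigma> + real DIM('a)) * (1 - 1 / q) - 2 * \<sigma>) * enn2real (test_energy \<sigma> q R u) powr (1 / q)"
proof -
  have s0: "0 < \<sigma>" using \<sigma> by simp
  obtain C where C: "0 \<le> C" "\<And>T t. 0 < T \<Longrightarrow> 0 \<le> t \<Longrightarrow> cutoff T t \<le> C * cutoff T t powr (1 / q)"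
     "\<And>T t. 0 < T \<Longrightarrow> 0 \<le> t \<Longrightarrow> \<bar>time_deriv (cutoff T) t\<bar> \<le> C / T * cutoff T t powr (1 / q)"
     "\<And>T t. 0 < T \<Longrightarrow> 0 \<le> t \<Longrightarrow> \<bar>time_deriv (time_deriv (cutoff T)) t\<bar> \<le> C / T\<^sup>2 * cutoff T t powr (1 / q)"
    using cutoff_derivative_bounds[OF q] by blast
  obtain G where G: "0 \<le> G" "\<And>x::'a. \<bar>bump_laplacian \<sigma> x\<bar> \<le> G * bump \<sigma> x"
    using abs_bump_laplacian_le[OF \<sigma>] by blast
  obtain B where B: "\<And>x::'a. bump \<sigma> x \<le> B" using bump_bounded[OF s0] by blast
  define \<Phi> where "\<Phi> = (LINT x::'a|lborel. bump \<sigma> x)"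
  have \<Phi>: "0 < \<Phi>" unfolding \<Phi>_def by (rule bump_integral(3)[OF s0 zero_less_one])
  define K where "K = C * (2 + G) * \<Phi> powr (1 - 1 / q)"
  have "enn2real (test_energy \<sigma> r R w) + exp (- 1) * (LINT x|lebesgue. h x * bump \<sigma> (x /\<^sub>R R))
       \<le> K * R powr ((2 * \<sigma> + real DIM('a)) * (1 - 1 / q) - 2 * \<sigma>) * enn2real (test_energy \<sigma> q R u) powr (1 / q)"
    if R1: "1 \<le> R" and u: "continuous_L2 u" and weak: "weak_damped_equation \<sigma> r u w h"
      and fin: "test_energy \<sigma> q R u < \<infinity>"
    for R r h and u w :: "real \<Rightarrow> 'a \<Rightarrow> real"
  proof -
    have R: "0 < R" using R1 by simp
    define T where "T = R powr (2 * \<sigma>)"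
    have T: "0 < T" "1 \<le> T" "R powr (- 2 * \<sigma>) = 1 / T"
      using R R1 s0 by (auto simp: T_def ge_one_powr_ge_zero powr_minus_divide)
    define L where "L = (\<lambda>t (x::'a). time_deriv (time_deriv (cutoff T)) t * bump \<sigma> (x /\<^sub>R R)
         - time_deriv (cutoff T) t * bump \<sigma> (x /\<^sub>R R)
         + cutoff T t * (R powr (- 2 * \<sigma>) * bump_laplacian \<sigma> (x /\<^sub>R R)))"
    \<comment> \<open>Two time derivatives and the damping term contribute \<open>1\<close> each, the fractional Laplacian \<open>G\<close>.\<close>
    define D where "D = C * (2 + G) / T"
    have L: "\<bar>L t x\<bar> \<le> D * cutoff T t powr (1 / q) * bump \<sigma> (x /\<^sub>R R)" if t: "0 \<le> t" for t x
    proof -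
      define e b where "e = cutoff T t powr (1 / q)" and "b = bump \<sigma> (x /\<^sub>R R)"
      have e: "0 \<le> e" and b: "0 \<le> b" using bump_pos[OF s0, of "x /\<^sub>R R"] by (auto simp: e_def b_def less_imp_le)
      have "C / T\<^sup>2 * e \<le> C / T * e"
        using T C(1) e by (intro mult_right_mono divide_left_mono) (auto simp: power2_eq_square)
      then have 1: "\<bar>time_deriv (time_deriv (cutoff T)) t * b\<bar> \<le> C / T * e * b"
        using C(4)[OF T(1) t] b unfolding abs_mult by (intro mult_mono) (auto simp: e_def)
      have 2: "\<bar>time_deriv (cutoff T) t * b\<bar> \<le> C / T * e * b"
        using C(3)[OF T(1) t] b unfolding abs_mult by (intro mult_mono) (auto simp: e_def)
      have "\<bar>cutoff T t * (R powr (- 2 * \<sigma>) * bump_laplacian \<sigma> (x /\<^sub>R R))\<bar> =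
          cutoff T t * (1 / T * \<bar>bump_laplacian \<sigma> (x /\<^sub>R R)\<bar>)"
        unfolding T(3) using T(1) by (simp add: abs_mult cutoff_nonneg)
      also have "\<dots> \<le> (C * e) * (1 / T * (G * b))"
        unfolding e_def b_def using C(1) T(1) by (intro mult_mono C(2) G t) (auto simp: G)
      finally have 3: "\<bar>cutoff T t * (R powr (- 2 * \<sigma>) * bump_laplacian \<sigma> (x /\<^sub>R R))\<bar> \<le> (C * e) * (1 / T * (G * b))" .
      have "\<bar>L t x\<bar> \<le> \<bar>time_deriv (time_deriv (cutoff T)) t * b\<bar> + \<bar>time_deriv (cutoff T) t * b\<bar> +
          \<bar>cutoff T t * (R powr (- 2 * \<sigma>) * bump_laplacian \<sigma> (x /\<^sub>R R))\<bar>"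
        unfolding L_def b_def by linarith
      also have "\<dots> \<le> C / T * e * b + C / T * e * b + (C * e) * (1 / T * (G * b))"
        by (intro add_mono 1 2 3)
      also have "\<dots> = D * e * b" unfolding D_def using T(1) by (simp add: field_simps)
      finally show ?thesis by (simp add: e_def b_def)
    qed
    have D: "0 \<le> D" using C G T by (simp add: D_def)
    have "enn2real (test_energy \<sigma> r R w) + exp (- 1) * (LINT x|lebesgue. h x * bump \<sigma> (x /\<^sub>R R)) =
        (LINT t:{0..}|lebesgue. LINT x|lebesgue. u t x * L t x)"
      unfolding weak_test(2)[OF \<sigma> R weak] L_def T_def ..
    also have "\<dots> \<le> D * ((T * (LINT x::'a|lebesgue. bump \<sigma> (x /\<^sub>R R))) powr (1 - 1 / q) *
        enn2real (test_energy \<sigma> q R u) powr (1 / q))"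
    proof (rule weak_rhs_bound[OF u q])
      show "integrable lebesgue (\<lambda>x::'a. bump \<sigma> (x /\<^sub>R R))" by (rule bump_integral(1)[OF s0 R])
      show "0 < (LINT x::'a|lebesgue. bump \<sigma> (x /\<^sub>R R))"
        unfolding bump_integral(2)[OF s0 R] using \<Phi> R by (simp add: \<Phi>_def)
      show "test_energy \<sigma> q R u = (\<integral>\<^sup>+t\<in>{0..}. (\<integral>\<^sup>+x. ennreal (\<bar>u t x\<bar> powr q * cutoff T t * bump \<sigma> (x /\<^sub>R R)) \<partial>lebesgue) \<partial>lebesgue)"
        by (simp add: test_energy_def T_def)
      show "cutoff T t = 0" if "T \<le> t" for t using that by (simp add: cutoff_def flat_def)
    qed (use T D L B fin cutoff_nonneg cutoff_continuous bump_pos[OF s0, where 'a = 'a] in \<open>auto simp: less_imp_le\<close>)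
    also have "T * (LINT x::'a|lebesgue. bump \<sigma> (x /\<^sub>R R)) = R powr (2 * \<sigma> + real DIM('a)) * \<Phi>"
      unfolding bump_integral(2)[OF s0 R] \<Phi>_def T_def using R by (simp add: powr_add powr_realpow)
    also have "(R powr (2 * \<sigma> + real DIM('a)) * \<Phi>) powr (1 - 1 / q) =
        R powr ((2 * \<sigma> + real DIM('a)) * (1 - 1 / q)) * \<Phi> powr (1 - 1 / q)"
      using \<Phi> by (simp add: powr_mult powr_powr)
    also have "D * (R powr ((2 * \<sigma> + real DIM('a)) * (1 - 1 / q)) * \<Phi> powr (1 - 1 / q) * enn2real (test_energy \<sigma> q R u) powr (1 / q))
      = K * R powr ((2 * \<sigma> + real DIM('a)) * (1 - 1 / q) - 2 * \<sigma>) * enn2real (test_energy \<sigma> q R u) powr (1 / q)"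
      unfolding powr_diff[of R] K_def D_def T_def[symmetric]
      by (simp only: times_divide_eq_left times_divide_eq_right mult_ac)
    finally show ?thesis .
  qed
  moreover have "0 \<le> K" using C G by (simp add: K_def)
  ultimately show ?thesis by blast
qed

lemma bump_data_limit:
  fixes h :: "'a::euclidean_space \<Rightarrow> real"
  assumes \<sigma>: "\<sigma> > 0" and h: "integrable lebesgue h"
  shows "(\<lambda>k. LINT x|lebesgue. h x * bump \<sigma> (x /\<^sub>R real (Suc k))) \<longlonglongrightarrow> bump \<sigma> (0::'a) * (LINT x|lebesgue. h x)"
proof -
  interpret B: mixing "lborel \<Otimes>\<^sub>M lborel" "bump_weight \<sigma>" "\<lambda>(s, t). \<bar>s\<bar> + \<bar>t\<bar>"
    using \<sigma> by (rule bump_mixing)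
  note [measurable] = bump_measurable[OF \<sigma>]
  have [measurable]: "h \<in> borel_measurable lebesgue" using h by simp
  obtain B where B: "\<And>x::'a. bump \<sigma> x \<le> B" using bump_bounded[OF \<sigma>] by blast
  have "smooth (bump \<sigma> :: 'a \<Rightarrow> real)"
    using B.smooth_mix_scaled[of 1, where 'a = 'a] by (simp add: bump_def)
  then have "(bump \<sigma> :: 'a \<Rightarrow> real) differentiable_on UNIV"
    unfolding smooth_def by (elim allE[of _ "[]"]) simp
  then have cont: "isCont (bump \<sigma> :: 'a \<Rightarrow> real) 0"
    using differentiable_imp_continuous_on continuous_on_eq_continuous_at by blast
  have "(\<lambda>k. LINT x|lebesgue. h x * bump \<sigma> (x /\<^sub>R real (Suc k))) \<longlonglongrightarrow> (LINT x|lebesgue. h x * bump \<sigma> (0::'a))"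
  proof (rule integral_dominated_convergence)
    show "integrable lebesgue (\<lambda>x. B * \<bar>h x\<bar>)" using h by simp
    show "(\<lambda>x. h x * bump \<sigma> (x /\<^sub>R real (Suc k))) \<in> borel_measurable lebesgue" for k
    proof -
      have "(\<lambda>x::'a. bump \<sigma> (x /\<^sub>R real (Suc k))) \<in> borel_measurable lborel" by measurable
      then have [measurable]: "(\<lambda>x::'a. bump \<sigma> (x /\<^sub>R real (Suc k))) \<in> borel_measurable lebesgue"
        by (rule measurable_completion)
      show ?thesis by measurable
    qed
    show "AE x in lebesgue. (\<lambda>k. h x * bump \<sigma> (x /\<^sub>R real (Suc k))) \<longlonglongrightarrow> h x * bump \<sigma> (0::'a)"
    proof (rule AE_I2)
      fix x :: 'a
      have "(\<lambda>k. inverse (real (Suc k)) *\<^sub>R x) \<longlonglongrightarrow> 0 *\<^sub>R x"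
        by (intro tendsto_scaleR LIMSEQ_inverse_real_of_nat tendsto_const)
      then have "(\<lambda>k. bump \<sigma> (x /\<^sub>R real (Suc k))) \<longlonglongrightarrow> bump \<sigma> (0::'a)"
        using isCont_tendsto_compose[OF cont, of "\<lambda>k. x /\<^sub>R real (Suc k)"] by simp
      then show "(\<lambda>k. h x * bump \<sigma> (x /\<^sub>R real (Suc k))) \<longlonglongrightarrow> h x * bump \<sigma> (0::'a)"
        by (rule tendsto_mult_left)
    qed
    show "AE x in lebesgue. norm (h x * bump \<sigma> (x /\<^sub>R real (Suc k))) \<le> B * \<bar>h x\<bar>" for k
    proof (rule AE_I2)
      fix x :: 'a
      have "\<bar>h x\<bar> * bump \<sigma> (x /\<^sub>R real (Suc k)) \<le> \<bar>h x\<bar> * B" by (intro mult_left_mono B) auto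
      then show "norm (h x * bump \<sigma> (x /\<^sub>R real (Suc k))) \<le> B * \<bar>h x\<bar>"
        using bump_pos[OF \<sigma>, of "x /\<^sub>R real (Suc k)"] by (simp add: abs_mult mult.commute)
    qed
  qed measurable
  then show ?thesis by (simp add: mult.commute)
qed

text \<open>Young's inequality with the conjugate exponents \<open>1/\<theta>\<close> and \<open>1/(1-\<theta>)\<close>.\<close>

lemma absorb_power:
  fixes X A M \<theta> :: real
  assumes "0 < \<theta>" "\<theta> < 1" "0 \<le> X" "0 \<le> M" "X + A \<le> M * X powr \<theta>"
  shows "A \<le> M powr (1 / (1 - \<theta>))"
proof -
  have "X powr \<theta> * M \<le> (X powr \<theta>) powr (1 / \<theta>) / (1 / \<theta>) + M powr (1 / (1 - \<theta>)) / (1 / (1 - \<theta>))"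
    using assms by (intro Youngs_inequality) auto
  also have "\<dots> = \<theta> * X + (1 - \<theta>) * M powr (1 / (1 - \<theta>))"
    using assms by (simp add: powr_powr)
  also have "\<dots> \<le> 1 * X + 1 * M powr (1 / (1 - \<theta>))"
    using assms by (intro add_mono mult_right_mono) auto
  finally show ?thesis using assms by (simp add: mult.commute)
qed

lemma scaling_exponent_nonpos:
  fixes n \<sigma> p q :: real
  assumes \<sigma>: "0 < \<sigma>" and p: "1 < p" and q: "1 < q" and n: "n / (2 * \<sigma>) \<le> (1 + p) / (p * q - 1)"
  shows "((2 * \<sigma> + n) * (1 - 1 / q) - 2 * \<sigma>) + ((2 * \<sigma> + n) * (1 - 1 / p) - 2 * \<sigma>) / q \<le> 0"
proof -
  have pq: "0 < p * q - 1" using p q less_1_mult[of p q] by simp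
  have "n * (p * q - 1) \<le> 2 * \<sigma> * (1 + p)"
    using n \<sigma> pq by (simp add: field_simps)
  moreover have "((2 * \<sigma> + n) * (1 - 1 / q) - 2 * \<sigma>) + ((2 * \<sigma> + n) * (1 - 1 / p) - 2 * \<sigma>) / q =
      (n * (p * q - 1) - 2 * \<sigma> * (1 + p)) / (p * q)"
    using p q by (simp add: field_simps)
  ultimately show ?thesis using p q by (simp add: divide_nonpos_pos)
qed

text \<open>Both weak inequalities are combined, starting from the equation for \<open>u\<close>.  The hypothesis involves \<open>p\<close>
  alone in the numerator; the case where \<open>q\<close> is the larger exponent follows by exchanging \<open>u\<close> and \<open>v\<close>.\<close>

lemma blow_up_ordered:
  fixes \<sigma> p q :: real
  assumes \<sigma>: "\<sigma> \<ge> 1/2" and p: "1 < p" and q: "1 < q"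
    and n: "real DIM('a::euclidean_space) / (2 * \<sigma>) \<le> (1 + p) / (p * q - 1)"
  shows "\<exists>\<epsilon>\<ge>0. \<forall>u\<^sub>1 v\<^sub>1 :: 'a \<Rightarrow> real. \<forall>u v.
     integrable lebesgue u\<^sub>1 \<and> integrable lebesgue v\<^sub>1 \<and>
     \<epsilon> < (LINT x|lebesgue. u\<^sub>1 x) \<and> 0 < (LINT x|lebesgue. v\<^sub>1 x) \<and>
     continuous_L2 u \<and> continuous_L2 v \<and>
     weak_damped_equation \<sigma> p u v u\<^sub>1 \<and> weak_damped_equation \<sigma> q v u v\<^sub>1 \<longrightarrow> False"
proof -
  have s0: "0 < \<sigma>" using \<sigma> by simp
  define a where "a = (\<lambda>r. (2 * \<sigma> + real DIM('a)) * (1 - 1 / r) - 2 * \<sigma>)"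
  obtain Kq where Kq: "0 \<le> Kq" "\<And>R r h. \<And>u w :: real \<Rightarrow> 'a \<Rightarrow> real.
     1 \<le> R \<Longrightarrow> continuous_L2 u \<Longrightarrow> weak_damped_equation \<sigma> r u w h \<Longrightarrow> test_energy \<sigma> q R u < \<infinity> \<Longrightarrow>
     enn2real (test_energy \<sigma> r R w) + exp (- 1) * (LINT x|lebesgue. h x * bump \<sigma> (x /\<^sub>R R))
       \<le> Kq * R powr a q * enn2real (test_energy \<sigma> q R u) powr (1 / q)"
    using weak_energy_bound[OF \<sigma> q, where 'a = 'a] unfolding a_def by blast
  obtain Kp where Kp: "0 \<le> Kp" "\<And>R r h. \<And>u w :: real \<Rightarrow> 'a \<Rightarrow> real.
     1 \<le> R \<Longrightarrow> continuous_L2 u \<Longrightarrow> weak_damped_equation \<sigma> r u w h \<Longrightarrow> test_energy \<sigma> p R u < \<infinity> \<Longrightarrow>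
     enn2real (test_energy \<sigma> r R w) + exp (- 1) * (LINT x|lebesgue. h x * bump \<sigma> (x /\<^sub>R R))
       \<le> Kp * R powr a p * enn2real (test_energy \<sigma> p R u) powr (1 / p)"
    using weak_energy_bound[OF \<sigma> p, where 'a = 'a] unfolding a_def by blast
  define \<theta> where "\<theta> = 1 / (p * q)"
  have pq: "1 < p * q" using p q less_1_mult[of p q] by simp
  have \<theta>: "0 < \<theta>" "\<theta> < 1" using pq by (auto simp: \<theta>_def)
  define M where "M = Kq * Kp powr (1 / q)"
  have M: "0 \<le> M" using Kq by (simp add: M_def)
  have b0: "0 < bump \<sigma> (0::'a)" by (rule bump_pos[OF s0])
  \<comment> \<open>\<open>exp (- 1)\<close> is the value of the cutoff at time \<open>0\<close>.\<close>
  define \<epsilon> where "\<epsilon> = M powr (1 / (1 - \<theta>)) / (exp (- 1) * bump \<sigma> (0::'a))"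
  have False if i: "integrable lebesgue u\<^sub>1" "integrable lebesgue v\<^sub>1"
    and e: "\<epsilon> < (LINT x|lebesgue. u\<^sub>1 x)" "0 < (LINT x|lebesgue. v\<^sub>1 x)"
    and c: "continuous_L2 u" "continuous_L2 v"
    and w: "weak_damped_equation \<sigma> p u v u\<^sub>1" "weak_damped_equation \<sigma> q v u v\<^sub>1"
    for u\<^sub>1 v\<^sub>1 :: "'a \<Rightarrow> real" and u v
  proof -
    have key: "exp (- 1) * (LINT x|lebesgue. u\<^sub>1 x * bump \<sigma> (x /\<^sub>R R)) \<le> M powr (1 / (1 - \<theta>))"
      if R: "1 \<le> R" and v1: "0 \<le> (LINT x|lebesgue. v\<^sub>1 x * bump \<sigma> (x /\<^sub>R R))" for R
    proof -
      have R0: "0 < R" using R by simp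
      define X Y where "X = enn2real (test_energy \<sigma> p R v)" and "Y = enn2real (test_energy \<sigma> q R u)"
      have X: "0 \<le> X" and Y: "0 \<le> Y" by (auto simp: X_def Y_def)
      note fin = weak_test(1)[OF \<sigma> R0 w(1)] weak_test(1)[OF \<sigma> R0 w(2)]
      have 1: "X + exp (- 1) * (LINT x|lebesgue. u\<^sub>1 x * bump \<sigma> (x /\<^sub>R R)) \<le> Kq * R powr a q * Y powr (1 / q)"
        unfolding X_def Y_def by (rule Kq(2)[OF R c(1) w(1) fin(2)])
      have "Y + exp (- 1) * (LINT x|lebesgue. v\<^sub>1 x * bump \<sigma> (x /\<^sub>R R)) \<le> Kp * R powr a p * X powr (1 / p)"
        unfolding X_def Y_def by (rule Kp(2)[OF R c(2) w(2) fin(1)])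
      moreover have "0 \<le> exp (- 1) * (LINT x|lebesgue. v\<^sub>1 x * bump \<sigma> (x /\<^sub>R R))" using v1 by simp
      ultimately have "Y \<le> Kp * R powr a p * X powr (1 / p)" by linarith
      then have "Y powr (1 / q) \<le> (Kp * R powr a p * X powr (1 / p)) powr (1 / q)"
        using Y q by (intro powr_mono2) auto
      also have "\<dots> = Kp powr (1 / q) * R powr (a p / q) * X powr \<theta>"
        using Kp(1) R0 X by (simp add: powr_mult powr_powr \<theta>_def)
      finally have "Kq * R powr a q * Y powr (1 / q) \<le> Kq * R powr a q * (Kp powr (1 / q) * R powr (a p / q) * X powr \<theta>)"
        using Kq(1) by (intro mult_left_mono) auto
      also have "\<dots> = R powr (a q + a p / q) * (M * X powr \<theta>)"
        by (simp add: M_def powr_add)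
      also have "\<dots> \<le> 1 * (M * X powr \<theta>)"
      proof (rule mult_right_mono)
        have "a q + a p / q \<le> 0"
          using scaling_exponent_nonpos[OF s0 p q n] by (simp only: a_def)
        then have "R powr (a q + a p / q) \<le> R powr 0" using R by (rule powr_mono)
        then show "R powr (a q + a p / q) \<le> 1" using R0 by simp
      qed (use M in simp)
      finally have "X + exp (- 1) * (LINT x|lebesgue. u\<^sub>1 x * bump \<sigma> (x /\<^sub>R R)) \<le> M * X powr \<theta>"
        using 1 by simp
      then show ?thesis by (rule absorb_power[OF \<theta> X M])
    qed
    have "eventually (\<lambda>k. 0 < (LINT x|lebesgue. v\<^sub>1 x * bump \<sigma> (x /\<^sub>R real (Suc k)))) sequentially"
      using e b0 by (intro order_tendstoD(1)[OF bump_data_limit[OF s0 i(2)]]) simp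
    then have "eventually (\<lambda>k. exp (- 1) * (LINT x|lebesgue. u\<^sub>1 x * bump \<sigma> (x /\<^sub>R real (Suc k))) \<le> M powr (1 / (1 - \<theta>))) sequentially"
      by eventually_elim (intro key, auto)
    then have "exp (- 1) * (bump \<sigma> (0::'a) * (LINT x|lebesgue. u\<^sub>1 x)) \<le> M powr (1 / (1 - \<theta>))"
      by (intro tendsto_upperbound[OF tendsto_mult_left[OF bump_data_limit[OF s0 i(1)]]]) auto
    moreover have "M powr (1 / (1 - \<theta>)) < exp (- 1) * bump \<sigma> (0::'a) * (LINT x|lebesgue. u\<^sub>1 x)"
      using e(1) b0 by (simp add: \<epsilon>_def pos_divide_less_eq mult.commute)
    ultimately show False by (simp add: mult.assoc)
  qed
  moreover have "0 \<le> \<epsilon>" using b0 by (simp add: \<epsilon>_def)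
  ultimately show ?thesis by blast
qed

theorem theorem1p3:
  fixes \<sigma> p q :: real
  assumes "\<sigma> \<ge> 1" and "p > 1" and "q > 1"
    and "real CARD('n::finite) / (2 * \<sigma>) \<le> (1 + max p q) / (p * q - 1)"
  shows "\<exists>\<epsilon>\<^sub>1 \<epsilon>\<^sub>2 :: real. \<epsilon>\<^sub>1 \<ge> 0 \<and> \<epsilon>\<^sub>2 \<ge> 0 \<and>
    (\<forall>u\<^sub>1 v\<^sub>1 :: real ^ 'n \<Rightarrow> real.
       integrable lebesgue u\<^sub>1 \<and> integrable lebesgue v\<^sub>1 \<and>
       (LINT x|lebesgue. u\<^sub>1 x) > \<epsilon>\<^sub>1 \<and> (LINT x|lebesgue. v\<^sub>1 x) > \<epsilon>\<^sub>2 \<longrightarrow>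
       \<not> (\<exists>u v :: real \<Rightarrow> real ^ 'n \<Rightarrow> real. global_sobolev_solution \<sigma> p q u\<^sub>1 v\<^sub>1 u v))"
proof (cases "q \<le> p")
  case True
  then have "real DIM(real ^ 'n) / (2 * \<sigma>) \<le> (1 + p) / (p * q - 1)"
    using assms by simp
  from blow_up_ordered[OF _ assms(2,3) this] assms(1) obtain \<epsilon> where \<epsilon>: "0 \<le> \<epsilon>"
    "\<forall>u\<^sub>1 v\<^sub>1 :: real ^ 'n \<Rightarrow> real. \<forall>u v. integrable lebesgue u\<^sub>1 \<and> integrable lebesgue v\<^sub>1 \<and>
     \<epsilon> < (LINT x|lebesgue. u\<^sub>1 x) \<and> 0 < (LINT x|lebesgue. v\<^sub>1 x) \<and> continuous_L2 u \<and> continuous_L2 v \<and>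
     weak_damped_equation \<sigma> p u v u\<^sub>1 \<and> weak_damped_equation \<sigma> q v u v\<^sub>1 \<longrightarrow> False"
    by auto
  show ?thesis
    by (rule exI[of _ \<epsilon>], rule exI[of _ 0]) (use \<epsilon> in \<open>unfold global_sobolev_solution_def, blast\<close>)
next
  case False
  then have "real DIM(real ^ 'n) / (2 * \<sigma>) \<le> (1 + q) / (q * p - 1)"
    using assms by (simp add: mult.commute)
  from blow_up_ordered[OF _ assms(3,2) this] assms(1) obtain \<epsilon> where \<epsilon>: "0 \<le> \<epsilon>"
    "\<forall>u\<^sub>1 v\<^sub>1 :: real ^ 'n \<Rightarrow> real. \<forall>u v. integrable lebesgue u\<^sub>1 \<and> integrable lebesgue v\<^sub>1 \<and>
     \<epsilon> < (LINT x|lebesgue. u\<^sub>1 x) \<and> 0 < (LINT x|lebesgue. v\<^sub>1 x) \<and> continuous_L2 u \<and> continuous_L2 v \<and>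
     weak_damped_equation \<sigma> q u v u\<^sub>1 \<and> weak_damped_equation \<sigma> p v u v\<^sub>1 \<longrightarrow> False"
    by auto
  show ?thesis
    by (rule exI[of _ 0], rule exI[of _ \<epsilon>]) (use \<epsilon> in \<open>unfold global_sobolev_solution_def, blast\<close>)
qed

end
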